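(* Let $J^1,\dots,J^\ell$ be distinct connected components of $\mathbb F/R^{\mathbb F}$ and $I^1,\dots,I^\ell$ distinct connected components of $\mathbb F/R^{\mathbb F}$. Suppose that for some $k$ with $0\le k\le\ell$, the components $J^1,\dots,J^k,I^1,\dots,I^k$ are arcs and $J^{k+1},\dots,J^\ell,I^{k+1},\dots,I^\ell$ are singletons. For $1\le i\le k$ let $x^i\in J^i$ and $y^i\in I^i$ be points that are not endpoints of these arcs. Then there is a homeomorphism $h$ of $\mathbb F/R^{\mathbb F}$ preserving $\le^{\mathbb F/R^{\mathbb F}}$ (i.e. $(h\times h)[\le^{\mathbb F/R^{\mathbb F}}]=\le^{\mathbb F/R^{\mathbb F}}$) such that $h[J^i]=I^i$ for $1\le i\le\ell$ and $h(x^i)=y^i$ for $1\le i\le k$.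
   Context: Let $\mathcal L_R=\{R,\le\}$. A topological $\mathcal L_R$-structure is a zero-dimensional compact metrizable space with closed interpretations of $R,\le$. An epimorphism is a continuous surjection $\varphi$ with $r^B=(\varphi\times\varphi)[r^A]$ for $r\in\{R,\le\}$; an automorphism is a bijective epimorphism onto itself. A finite Hasse forest is a finite $\mathcal L_R$-structure where $\le$ is a partial order, $a\,R\,b$ iff $a=b$ or one of $a,b$ is an immediate $\le$-successor of the other, and the Hasse diagram has no cycles; $\mathcal F$ is the family of finite Hasse forests. $\mathbb F$ denotes the projective Fraïssé limit of $\mathcal F$ (unique up to isomorphism): a topological $\mathcal L_R$-structure with (L1) every $A\in\mathcal F$ is an epimorphic image of $\mathbb F$; (L2) every clopen cover of $\mathbb F$ is refined by the point-preimages of some epimorphism $\mathbb F\to A$, $A\in\mathcal F$; (L3) for $A\in\mathcal F$ and epimorphisms $\varphi_1,\varphi_2:\mathbb F\to A$ there is an automorphism $\psi$ of $\mathbb F$ with $\varphi_2=\varphi_1\psi$. $R^{\mathbb F}$ is a closed equivalence relation; the Fraïssé fence is $\mathbb F/R^{\mathbb F}$, with quotient map $p$ and the relation $\le^{\mathbb F/R^{\mathbb F}}=(p\times p)[\le^{\mathbb F}]$, which is a closed partial order whose restriction to each connected component is total. $\mathbb F/R^{\mathbb F}$ is a compact metrizable space whose connected components are points or arcs. *)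

theory Defs
  imports "HOL-Analysis.Analysis"
begin

record 'a LR_structure =
  Top :: "'a topology"
  Rrel :: "('a \<times> 'a) set"
  Leq :: "('a \<times> 'a) set"

abbreviation carrier_of :: "'a LR_structure \<Rightarrow> 'a set" where
  "carrier_of S \<equiv> topspace (Top S)"

text \<open>Closedness in the product contains \<open>Rrel S, Leq S \<subseteq> carrier_of S \<times> carrier_of S\<close>;
  \<open>dim_le\<close> is small inductive dimension, so \<open>dim_le 0\<close> says that the clopen sets form a base.\<close>

definition topological_LR_structure :: "'a LR_structure \<Rightarrow> bool" where
  "topological_LR_structure S \<longleftrightarrow>
     compact_space (Top S) \<and> metrizable_space (Top S) \<and> Top S dim_le 0 \<and>
     closedin (prod_topology (Top S) (Top S)) (Rrel S) \<and>
     closedin (prod_topology (Top S) (Top S)) (Leq S)"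

definition epimorphism :: "'a LR_structure \<Rightarrow> 'b LR_structure \<Rightarrow> ('a \<Rightarrow> 'b) \<Rightarrow> bool" where
  "epimorphism A B \<phi> \<longleftrightarrow>
     continuous_map (Top A) (Top B) \<phi> \<and> \<phi> ` carrier_of A = carrier_of B \<and>
     Rrel B = map_prod \<phi> \<phi> ` Rrel A \<and> Leq B = map_prod \<phi> \<phi> ` Leq A"

definition automorphism :: "'a LR_structure \<Rightarrow> ('a \<Rightarrow> 'a) \<Rightarrow> bool" where
  "automorphism A \<psi> \<longleftrightarrow> epimorphism A A \<psi> \<and> bij_betw \<psi> (carrier_of A) (carrier_of A)"

definition immediate_succ :: "('a \<times> 'a) set \<Rightarrow> 'a \<Rightarrow> 'a \<Rightarrow> bool" where
  "immediate_succ le a b \<longleftrightarrow>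
     (a, b) \<in> le \<and> a \<noteq> b \<and> (\<forall>c. (a, c) \<in> le \<and> (c, b) \<in> le \<longrightarrow> c = a \<or> c = b)"

definition hasse_adj :: "('a \<times> 'a) set \<Rightarrow> 'a \<Rightarrow> 'a \<Rightarrow> bool" where
  "hasse_adj le a b \<longleftrightarrow> immediate_succ le a b \<or> immediate_succ le b a"

definition hasse_cycle :: "('a \<times> 'a) set \<Rightarrow> 'a list \<Rightarrow> bool" where
  "hasse_cycle le xs \<longleftrightarrow>
     3 \<le> length xs \<and> distinct xs \<and>
     (\<forall>i < length xs. hasse_adj le (xs ! i) (xs ! (Suc i mod length xs)))"

text \<open>As usual in projective Fraisse theory, structures in the family are nonempty; with the
  empty forest admitted no structure could map onto every member of the family.\<close>

definition hasse_forest :: "'a LR_structure \<Rightarrow> bool" where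
  "hasse_forest A \<longleftrightarrow>
     finite (carrier_of A) \<and> carrier_of A \<noteq> {} \<and> Top A = discrete_topology (carrier_of A) \<and>
     partial_order_on (carrier_of A) (Leq A) \<and>
     Rrel A = {(a, b) \<in> carrier_of A \<times> carrier_of A. a = b \<or> hasse_adj (Leq A) a b} \<and>
     (\<nexists>xs. hasse_cycle (Leq A) xs)"

text \<open>Every finite structure is isomorphic to one whose carrier is a set of natural numbers,
  so it suffices to let the members of the family range over \<open>nat LR_structure\<close>.\<close>

definition projective_fraisse_limit :: "'a LR_structure \<Rightarrow> bool" where
  "projective_fraisse_limit F \<longleftrightarrow>
     topological_LR_structure F \<and>
     (\<forall>A :: nat LR_structure. hasse_forest A \<longrightarrow> (\<exists>\<phi>. epimorphism F A \<phi>)) \<and>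
     (\<forall>\<U>. (\<forall>U\<in>\<U>. openin (Top F) U \<and> closedin (Top F) U) \<and> \<Union>\<U> = carrier_of F \<longrightarrow>
        (\<exists>(A :: nat LR_structure) \<phi>. hasse_forest A \<and> epimorphism F A \<phi> \<and>
           (\<forall>a \<in> carrier_of A. \<exists>U\<in>\<U>. {x \<in> carrier_of F. \<phi> x = a} \<subseteq> U))) \<and>
     (\<forall>(A :: nat LR_structure) \<phi>1 \<phi>2.
        hasse_forest A \<and> epimorphism F A \<phi>1 \<and> epimorphism F A \<phi>2 \<longrightarrow>
        (\<exists>\<psi>. automorphism F \<psi> \<and> (\<forall>x \<in> carrier_of F. \<phi>2 x = \<phi>1 (\<psi> x))))"

definition class_map :: "('a \<times> 'a) set \<Rightarrow> 'a \<Rightarrow> 'a set" where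
  "class_map r x = r `` {x}"

text \<open>Written with preimages rather than unions of classes, this is a topology for every \<open>r\<close>;
  that \<open>Rrel F\<close> is an equivalence relation is a consequence of the limit axioms, not presupposed.\<close>

definition quotient_space :: "'a topology \<Rightarrow> ('a \<times> 'a) set \<Rightarrow> 'a set topology" where
  "quotient_space X r =
     topology (\<lambda>U. U \<subseteq> topspace X // r \<and> openin X {x \<in> topspace X. class_map r x \<in> U})"

lemma openin_quotient_space:
  "openin (quotient_space X r) U \<longleftrightarrow>
     U \<subseteq> topspace X // r \<and> openin X {x \<in> topspace X. class_map r x \<in> U}"
proof -
  let ?P = "\<lambda>U. U \<subseteq> topspace X // r \<and> openin X {x \<in> topspace X. class_map r x \<in> U}"
  have "istopology ?P"
    unfolding istopology_def
  proof (intro conjI allI impI)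
    fix S T assume S: "?P S" and T: "?P T"
    have eq: "{x \<in> topspace X. class_map r x \<in> S \<inter> T} =
        {x \<in> topspace X. class_map r x \<in> S} \<inter> {x \<in> topspace X. class_map r x \<in> T}"
      by auto
    show "S \<inter> T \<subseteq> topspace X // r" using S by auto
    show "openin X {x \<in> topspace X. class_map r x \<in> S \<inter> T}"
      unfolding eq using S T by auto
  next
    fix \<K> assume K: "\<forall>K\<in>\<K>. ?P K"
    have eq: "{x \<in> topspace X. class_map r x \<in> \<Union>\<K>} =
        (\<Union>K\<in>\<K>. {x \<in> topspace X. class_map r x \<in> K})"
      by auto
    show "\<Union>\<K> \<subseteq> topspace X // r" using K by auto
    show "openin X {x \<in> topspace X. class_map r x \<in> \<Union>\<K>}"
      unfolding eq using K by (intro openin_Union) auto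
  qed
  then show ?thesis
    by (simp add: quotient_space_def)
qed

lemma topspace_quotient_space [simp]: "topspace (quotient_space X r) = topspace X // r"
proof
  show "topspace (quotient_space X r) \<subseteq> topspace X // r"
    using openin_quotient_space openin_topspace by blast
  have "{x \<in> topspace X. class_map r x \<in> topspace X // r} = topspace X"
    by (auto simp: class_map_def quotient_def)
  then have "openin (quotient_space X r) (topspace X // r)"
    by (simp add: openin_quotient_space)
  then show "topspace X // r \<subseteq> topspace (quotient_space X r)"
    by (rule openin_subset)
qed

lemma quotient_map_class_map: "quotient_map X (quotient_space X r) (class_map r)"
  by (auto simp: quotient_map_def openin_quotient_space class_map_def quotient_def)

definition fence_space :: "'a LR_structure \<Rightarrow> 'a set topology" where
  "fence_space F = quotient_space (Top F) (Rrel F)"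

definition fence_le :: "'a LR_structure \<Rightarrow> ('a set \<times> 'a set) set" where
  "fence_le F = map_prod (class_map (Rrel F)) (class_map (Rrel F)) ` Leq F"

definition is_arc :: "'a topology \<Rightarrow> 'a set \<Rightarrow> bool" where
  "is_arc X A \<longleftrightarrow>
     A \<subseteq> topspace X \<and> subtopology X A homeomorphic_space top_of_set {0..1::real}"

definition arc_endpoint :: "'a topology \<Rightarrow> 'a set \<Rightarrow> 'a \<Rightarrow> bool" where
  "arc_endpoint X A x \<longleftrightarrow>
     (\<exists>g. homeomorphic_map (top_of_set {0..1::real}) (subtopology X A) g \<and> x \<in> {g 0, g 1})"

end

theory Submission
  imports Defs
begin

text \<open>
  Epimorphisms of the limit onto finite disjoint unions of chains are cofinal, and they determine
  both relations. The preimage of a component of the fence is a strand: a closed set, linearly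
  ordered by \<open>\<le>\<close>, whose jumps are exactly its \<open>R\<close>-related pairs. A back-and-forth between the
  limit and itself yields towers of epimorphisms \<open>f n\<close>, \<open>g n\<close> onto common finite targets, and
  \<open>{(s, t). \<forall>n. f n s = g n t}\<close> induces the homeomorphism. It need not come from an automorphism
  of the limit, because a marked point may have one preimage and its prescribed image two. So all
  maps in the tower are required to collapse the classes of the marked points and of the endpoints
  of their strands, and to send each marked strand onto a full chain. Collapsing makes the
  fibres on a marked arc infinite on either side of the marked point, which leaves room to lift a
  given refinement of the chain exactly.
\<close>

text \<open>The extension axiom lifts a refinement of a finite quotient, but gives no control over
  the image of a marked point or over the part of a chain that its strand covers. So the axiomatic
  lift is kept on unmarked columns and rebuilt by hand on marked ones. Two facts make this possible.
  A locally constant relation-preserving map into chains whose columns start at 0 is an epimorphism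
  onto its image as soon as each column of the image is swept from bottom to top by one strand, so
  only monotone maps with steps of at most one have to be built. And columns can be duplicated, so
  rerouting marked strands never costs surjectivity: an unmarked copy still carries the axiomatic
  lift. Constancy on special classes forbids at most \<open>card (special I v)\<close> edges of a
  column. Hence the constant \<open>Suc (N + card (special I v))\<close>, with \<open>N\<close>
  bounding the heights of the target: that many positions at one level leave \<open>N\<close> edges
  free. Collapsing does no harm to the limit of the tower, because it concerns finitely many classes
  and the fence identifies the points of a class anyway.\<close>

section \<open>Finite disjoint unions of chains\<close>

text \<open>A pair \<open>(c, i)\<close> stands for the element of height \<open>i\<close> in the chain with index \<open>c\<close>.\<close>

definition cle :: "nat \<times> nat \<Rightarrow> nat \<times> nat \<Rightarrow> bool" where
  "cle a b \<longleftrightarrow> fst a = fst b \<and> snd a \<le> snd b"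

definition cadj :: "nat \<times> nat \<Rightarrow> nat \<times> nat \<Rightarrow> bool" where
  "cadj a b \<longleftrightarrow> fst a = fst b \<and> snd a \<le> Suc (snd b) \<and> snd b \<le> Suc (snd a)"

text \<open>Each column is an initial segment of the naturals. With the bottom fixed at 0, a column
  is known from its top, and filling it means reaching height 0 and the greatest height.\<close>

definition column_set :: "(nat \<times> nat) set \<Rightarrow> bool" where
  "column_set X \<longleftrightarrow> finite X \<and> X \<noteq> {} \<and> (\<forall>c i j. (c, j) \<in> X \<and> i \<le> j \<longrightarrow> (c, i) \<in> X)"

definition chains :: "(nat \<times> nat) set \<Rightarrow> (nat \<times> nat) LR_structure" where
  "chains X = \<lparr>Top = discrete_topology X, Rrel = {(a, b) \<in> X \<times> X. cadj a b},
     Leq = {(a, b) \<in> X \<times> X. cle a b}\<rparr>"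

text \<open>The limit axioms quantify over structures on natural numbers, whereas chains live on
  pairs; they are transported through \<open>prod_encode\<close>.\<close>

definition relabel :: "('a \<Rightarrow> 'b) \<Rightarrow> 'a LR_structure \<Rightarrow> 'b LR_structure" where
  "relabel e A = \<lparr>Top = discrete_topology (e ` carrier_of A), Rrel = map_prod e e ` Rrel A,
     Leq = map_prod e e ` Leq A\<rparr>"

lemma chains_simps [simp]:
  "Top (chains X) = discrete_topology X"
  "Rrel (chains X) = {(a, b) \<in> X \<times> X. cadj a b}"
  "Leq (chains X) = {(a, b) \<in> X \<times> X. cle a b}"
  by (auto simp: chains_def)

lemma relabel_simps [simp]:
  "Top (relabel e A) = discrete_topology (e ` carrier_of A)"
  "Rrel (relabel e A) = map_prod e e ` Rrel A"
  "Leq (relabel e A) = map_prod e e ` Leq A"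
  by (auto simp: relabel_def)

lemma column_set_finite: "column_set X \<Longrightarrow> finite X"
  by (simp add: column_set_def)

lemma column_set_nonempty: "column_set X \<Longrightarrow> X \<noteq> {}"
  by (simp add: column_set_def)

lemma column_set_down: "column_set X \<Longrightarrow> (c, j) \<in> X \<Longrightarrow> i \<le> j \<Longrightarrow> (c, i) \<in> X"
  by (auto simp: column_set_def)

lemma column_set_top:
  assumes "column_set X" "c \<in> fst ` X"
  obtains n where "\<And>i. (c, i) \<in> X \<longleftrightarrow> i \<le> n"
proof -
  let ?H = "{i. (c, i) \<in> X}"
  have "?H = snd ` {a \<in> X. fst a = c}"
    by force
  then have fin: "finite ?H" "?H \<noteq> {}"
    using assms by (auto simp: column_set_def)
  then have "Max ?H \<in> ?H"
    by (rule Max_in)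
  then have "(c, i) \<in> X \<longleftrightarrow> i \<le> Max ?H" for i
    using column_set_down[OF assms(1), of c "Max ?H" i] Max_ge[OF fin(1), of i] by blast
  then show thesis
    using that by blast
qed

lemma cle_refl [simp]: "cle a a"
  by (simp add: cle_def)

lemma cadj_refl [simp]: "cadj a a"
  by (simp add: cadj_def)

lemma cadj_sym: "cadj a b \<Longrightarrow> cadj b a"
  by (simp add: cadj_def)

lemma cle_trans: "cle a b \<Longrightarrow> cle b c \<Longrightarrow> cle a c"
  by (simp add: cle_def)

lemma cle_antisym: "cle a b \<Longrightarrow> cle b a \<Longrightarrow> a = b"
  by (simp add: cle_def prod_eq_iff)

lemma cle_linear: "fst a = fst b \<Longrightarrow> cle a b \<or> cle b a"
  by (auto simp: cle_def)

section \<open>Composing, relabelling and factoring epimorphisms\<close>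

lemma epimorphism_compose:
  assumes "epimorphism A B f" "epimorphism B C g"
  shows "epimorphism A C (g \<circ> f)"
  using assms unfolding epimorphism_def map_prod_compose image_comp[symmetric]
  by (metis continuous_map_compose)

lemma epimorphism_relabel:
  assumes "epimorphism A B f" "Top B = discrete_topology (carrier_of B)"
  shows "epimorphism A (relabel e B) (e \<circ> f)"
proof -
  have "continuous_map (Top B) (discrete_topology (e ` carrier_of B)) e"
    by (subst assms(2)) (auto simp: continuous_map_from_discrete_topology)
  then have "epimorphism B (relabel e B) e"
    by (auto simp: epimorphism_def)
  then show ?thesis
    using assms(1) epimorphism_compose by blast
qed

lemma epimorphism_relabel_inv:
  assumes Q: "Rrel B \<subseteq> carrier_of B \<times> carrier_of B" "Leq B \<subseteq> carrier_of B \<times> carrier_of B"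
    and f: "epimorphism A (relabel e B) f" "Top B = discrete_topology (carrier_of B)"
    and d: "\<And>b. b \<in> carrier_of B \<Longrightarrow> d (e b) = b"
  shows "epimorphism A B (d \<circ> f)"
proof -
  have im: "map_prod d d ` map_prod e e ` Q = Q" if "Q \<subseteq> carrier_of B \<times> carrier_of B" for Q
    using that d by (force simp: image_comp map_prod_def split_beta)
  have "d ` e ` carrier_of B = carrier_of B"
    using d by (force simp: image_comp)
  moreover have "continuous_map (discrete_topology (e ` carrier_of B)) (Top B) d"
    using d by (auto simp: continuous_map_from_discrete_topology)
  ultimately have "epimorphism (relabel e B) B d"
    using im Q by (auto simp: epimorphism_def)
  then show ?thesis
    using f(1) epimorphism_compose by blast
qed

text \<open>The relations of \<open>B\<close> and \<open>C\<close> are both images of those of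
  \<open>A\<close>, and \<open>k\<close> carries one image onto the other. It turns two maps of the
  limit, one finer than the other, into a bonding epimorphism between their finite images.\<close>

lemma epimorphism_factor:
  assumes f: "epimorphism A B f" and g: "epimorphism A C g"
    and B: "Top B = discrete_topology (carrier_of B)"
    and sub: "Rrel A \<subseteq> carrier_of A \<times> carrier_of A" "Leq A \<subseteq> carrier_of A \<times> carrier_of A"
    and k: "\<And>a. a \<in> carrier_of A \<Longrightarrow> k (f a) = g a"
  shows "epimorphism B C k"
proof -
  have im: "carrier_of B = f ` carrier_of A" "carrier_of C = g ` carrier_of A"
    using f g by (auto simp: epimorphism_def)
  then have "continuous_map (Top B) (Top C) k"
    using k by (subst B) (auto simp: continuous_map_from_discrete_topology)
  moreover have "k ` carrier_of B = carrier_of C"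
    using k im by (simp add: image_image)
  moreover have "map_prod k k ` map_prod f f ` Q = map_prod g g ` Q"
    if "Q \<subseteq> carrier_of A \<times> carrier_of A" for Q
    using that k by (force simp: image_comp map_prod_def split_beta)
  ultimately show ?thesis
    using f g sub by (auto simp: epimorphism_def)
qed

lemma chains_epimorphismI:
  assumes k: "k ` Y \<subseteq> X" "\<And>a b. cadj a b \<Longrightarrow> cadj (k a) (k b)" "\<And>a b. cle a b \<Longrightarrow> cle (k a) (k b)"
    and adj: "\<And>a b. a \<in> X \<Longrightarrow> b \<in> X \<Longrightarrow> cadj a b \<Longrightarrow> \<exists>a'\<in>Y. \<exists>b'\<in>Y. cadj a' b' \<and> k a' = a \<and> k b' = b"
    and le: "\<And>a b. a \<in> X \<Longrightarrow> b \<in> X \<Longrightarrow> cle a b \<Longrightarrow> \<exists>a'\<in>Y. \<exists>b'\<in>Y. cle a' b' \<and> k a' = a \<and> k b' = b"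
  shows "epimorphism (chains Y) (chains X) k"
proof -
  have rel: "{(a, b) \<in> X \<times> X. r a b} = map_prod k k ` {(a, b) \<in> Y \<times> Y. r a b}"
    if r: "\<And>a b. r a b \<Longrightarrow> r (k a) (k b)"
      "\<And>a b. a \<in> X \<Longrightarrow> b \<in> X \<Longrightarrow> r a b \<Longrightarrow> \<exists>a'\<in>Y. \<exists>b'\<in>Y. r a' b' \<and> k a' = a \<and> k b' = b" for r
  proof
    show "map_prod k k ` {(a, b) \<in> Y \<times> Y. r a b} \<subseteq> {(a, b) \<in> X \<times> X. r a b}"
      using r(1) k(1) by auto
    show "{(a, b) \<in> X \<times> X. r a b} \<subseteq> map_prod k k ` {(a, b) \<in> Y \<times> Y. r a b}"
    proof
      fix z assume "z \<in> {(a, b) \<in> X \<times> X. r a b}"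
      then obtain a b where z: "z = (a, b)" "a \<in> X" "b \<in> X" "r a b" by blast
      then obtain a' b' where ab: "a' \<in> Y" "b' \<in> Y" "r a' b'" "k a' = a" "k b' = b"
        using r(2) by blast
      then have "map_prod k k (a', b') \<in> map_prod k k ` {(a, b) \<in> Y \<times> Y. r a b}"
        by (intro imageI) simp
      then show "z \<in> map_prod k k ` {(a, b) \<in> Y \<times> Y. r a b}"
        using z(1) ab(4,5) by simp
    qed
  qed
  have "X \<subseteq> k ` Y"
    using le cle_refl by blast
  then show ?thesis
    using k(1) rel[of cadj, OF k(2) adj] rel[of cle, OF k(3) le]
    by (auto simp: epimorphism_def continuous_map_from_discrete_topology)
qed

section \<open>Disjoint unions of chains are Hasse forests\<close>

lemma chains_immediate_succ:
  assumes X: "column_set X"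
  shows "immediate_succ (Leq (chains X)) a b \<longleftrightarrow> a \<in> X \<and> b \<in> X \<and> fst a = fst b \<and> snd b = Suc (snd a)"
proof
  assume h: "immediate_succ (Leq (chains X)) a b"
  then have ab: "a \<in> X" "b \<in> X" "fst a = fst b" "snd a \<le> snd b" "a \<noteq> b"
    by (auto simp: immediate_succ_def cle_def)
  then have lt: "snd a < snd b"
    by (auto simp: prod_eq_iff)
  then have "(fst a, Suc (snd a)) \<in> X"
    using column_set_down[OF X, of "fst b" "snd b"] ab by auto
  then have "(fst a, Suc (snd a)) = a \<or> (fst a, Suc (snd a)) = b"
    using h ab lt unfolding immediate_succ_def
    by (elim conjE allE[of _ "(fst a, Suc (snd a))"]) (auto simp: cle_def)
  then show "a \<in> X \<and> b \<in> X \<and> fst a = fst b \<and> snd b = Suc (snd a)"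
    using ab by (cases a; cases b) auto
next
  assume "a \<in> X \<and> b \<in> X \<and> fst a = fst b \<and> snd b = Suc (snd a)"
  then obtain c i where ab: "a = (c, i)" "b = (c, Suc i)" "(c, i) \<in> X" "(c, Suc i) \<in> X"
    by (metis prod.collapse)
  have "d = (c, i) \<or> d = (c, Suc i)" if "cle (c, i) d" "cle d (c, Suc i)" for d
    using that by (cases d) (auto simp: cle_def)
  then show "immediate_succ (Leq (chains X)) a b"
    using ab by (simp add: immediate_succ_def) (simp add: cle_def)
qed

text \<open>A vertex of greatest height on a cycle has both neighbours one step below it in its
  column, so they coincide; but in a list of at least three distinct entries they are
  different.\<close>

lemma chains_no_cycle:
  assumes X: "column_set X"
  shows "\<not> hasse_cycle (Leq (chains X)) xs"
proof
  assume h: "hasse_cycle (Leq (chains X)) xs"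
  define n where "n = length xs"
  have n: "3 \<le> n" and dist: "distinct xs"
    using h by (auto simp: hasse_cycle_def n_def)
  have adj: "fst (xs ! i) = fst (xs ! (Suc i mod n)) \<and>
      (snd (xs ! i) = Suc (snd (xs ! (Suc i mod n))) \<or> snd (xs ! (Suc i mod n)) = Suc (snd (xs ! i)))"
    if "i < n" for i
    using h that unfolding hasse_cycle_def n_def hasse_adj_def chains_immediate_succ[OF X] by auto
  define m where "m = Max ((\<lambda>i. snd (xs ! i)) ` {..<n})"
  have "m \<in> (\<lambda>i. snd (xs ! i)) ` {..<n}"
    unfolding m_def using n by (intro Max_in) (auto simp: lessThan_empty_iff)
  then obtain i where i: "i < n" "snd (xs ! i) = m"
    by auto
  have le: "snd (xs ! j) \<le> m" if "j < n" for j
    unfolding m_def using that by (intro Max_ge) auto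
  \<comment> \<open>\<open>j\<close> and \<open>q\<close> are the cyclic predecessor and successor
    of the position \<open>i\<close> of greatest height.\<close>
  define j where "j = (if i = 0 then n - 1 else i - 1)"
  have j: "j < n" "Suc j mod n = i"
    using i n by (auto simp: j_def)
  define q where "q = Suc i mod n"
  have q: "q < n"
    using n by (simp add: q_def)
  have "xs ! j = xs ! q"
    using adj[OF i(1)] adj[OF j(1)] le[OF j(1)] le[OF q] i j(2)
    by (auto simp: prod_eq_iff q_def)
  then have "j = q"
    using dist j q by (simp add: nth_eq_iff_index_eq n_def)
  then show False
    using i n by (auto simp: j_def q_def mod_Suc split: if_splits)
qed

lemma hasse_forest_relabel_chains:
  fixes e :: "nat \<times> nat \<Rightarrow> 'b"
  assumes X: "column_set X" and e: "inj e"
  shows "hasse_forest (relabel e (chains X))"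
proof -
  let ?L = "Leq (relabel e (chains X))"
  have L: "(e a, e b) \<in> ?L \<longleftrightarrow> a \<in> X \<and> b \<in> X \<and> cle a b" for a b
    using e by (auto simp: inj_eq)
  have Lsub: "\<exists>a b. x = e a \<and> y = e b \<and> a \<in> X \<and> b \<in> X \<and> cle a b" if "(x, y) \<in> ?L" for x y
    using that by auto
  have succ: "immediate_succ ?L (e a) (e b) \<longleftrightarrow> immediate_succ (Leq (chains X)) a b" for a b
  proof -
    have "(\<forall>c. (e a, c) \<in> ?L \<and> (c, e b) \<in> ?L \<longrightarrow> c = e a \<or> c = e b) \<longleftrightarrow>
        (\<forall>c. (a, c) \<in> Leq (chains X) \<and> (c, b) \<in> Leq (chains X) \<longrightarrow> c = a \<or> c = b)"
    proof (intro iffI allI impI)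
      fix c assume "\<forall>c. (e a, c) \<in> ?L \<and> (c, e b) \<in> ?L \<longrightarrow> c = e a \<or> c = e b"
        and "(a, c) \<in> Leq (chains X) \<and> (c, b) \<in> Leq (chains X)"
      then have "e c = e a \<or> e c = e b"
        using L by (metis (no_types, lifting) case_prodD chains_simps(3) mem_Collect_eq mem_Sigma_iff)
      then show "c = a \<or> c = b"
        using e by (auto simp: inj_eq)
    next
      fix c assume h: "\<forall>c. (a, c) \<in> Leq (chains X) \<and> (c, b) \<in> Leq (chains X) \<longrightarrow> c = a \<or> c = b"
        and c: "(e a, c) \<in> ?L \<and> (c, e b) \<in> ?L"
      obtain c' where c': "c = e c'"
        using c Lsub by blast
      have "c' = a \<or> c' = b"
        using h[rule_format, of c'] c unfolding c' L by simp
      then show "c = e a \<or> c = e b"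
        using c' by blast
    qed
    then show ?thesis
      using L e unfolding immediate_succ_def by (auto simp: inj_eq)
  qed
  have adj: "hasse_adj ?L (e a) (e b) \<longleftrightarrow> hasse_adj (Leq (chains X)) a b" for a b
    unfolding hasse_adj_def succ by (rule refl)
  have "partial_order_on (e ` X) ?L"
    unfolding partial_order_on_def preorder_on_def
  proof (intro conjI)
    show "refl_on (e ` X) ?L"
      by (auto simp: refl_on_def)
    show "?L \<subseteq> e ` X \<times> e ` X"
      by auto
    show "trans ?L"
    proof (rule transI)
      fix x y z assume xy: "(x, y) \<in> ?L" "(y, z) \<in> ?L"
      obtain a b where ab: "x = e a" "y = e b" using Lsub[OF xy(1)] by blast
      obtain c where c: "z = e c" using Lsub[OF xy(2)] by blast
      show "(x, z) \<in> ?L"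
        using xy unfolding ab c L by (blast intro: cle_trans)
    qed
    show "antisym ?L"
    proof (rule antisymI)
      fix x y assume xy: "(x, y) \<in> ?L" "(y, x) \<in> ?L"
      obtain a b where ab: "x = e a" "y = e b" using Lsub[OF xy(1)] by blast
      show "x = y"
        using xy unfolding ab L by (blast dest: cle_antisym)
    qed
  qed
  moreover have "Rrel (relabel e (chains X)) =
      {(a, b) \<in> e ` X \<times> e ` X. a = b \<or> hasse_adj ?L a b}" (is "?R = ?R'")
  proof -
    have cadj: "cadj a b \<longleftrightarrow> a = b \<or> hasse_adj (Leq (chains X)) a b" if "a \<in> X" "b \<in> X" for a b
      using that unfolding hasse_adj_def chains_immediate_succ[OF X] cadj_def prod_eq_iff by auto
    show ?thesis
    proof (intro set_eqI iffI)
      fix z assume "z \<in> ?R"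
      then obtain a b where z: "z = (e a, e b)" "a \<in> X" "b \<in> X" "cadj a b" by auto
      then show "z \<in> ?R'"
        using cadj[of a b] adj[of a b] by (auto simp: inj_eq[OF e])
    next
      fix z assume "z \<in> ?R'"
      then obtain a b where z: "z = (e a, e b)" "a \<in> X" "b \<in> X" "e a = e b \<or> hasse_adj ?L (e a) (e b)"
        by auto
      then have "cadj a b"
        using cadj[of a b] adj[of a b] e by (metis inj_eq)
      then show "z \<in> ?R"
        using z by auto
    qed
  qed
  moreover have "\<not> hasse_cycle ?L xs" for xs
  proof
    assume h: "hasse_cycle ?L xs"
    \<comment> \<open>Every vertex of a cycle is adjacent to another one, hence lies in the range of
      \<open>e\<close>, and the cycle can be pulled back.\<close>
    have "x \<in> range e" if x: "x \<in> set xs" for x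
    proof -
      obtain i where "i < length xs" "x = xs ! i"
        using x by (auto simp: in_set_conv_nth)
      then have "hasse_adj ?L x (xs ! (Suc i mod length xs))"
        using h by (auto simp: hasse_cycle_def)
      then show ?thesis
        using Lsub unfolding hasse_adj_def immediate_succ_def by blast
    qed
    then obtain ys where ys: "xs = map e ys"
      by (metis ex_map_conv rangeE)
    have "hasse_cycle (Leq (chains X)) ys"
      unfolding hasse_cycle_def
    proof (intro conjI allI impI)
      show "3 \<le> length ys" "distinct ys"
        using h ys by (auto simp: hasse_cycle_def distinct_map)
      fix i assume i: "i < length ys"
      then have m: "Suc i mod length ys < length ys"
        by (intro mod_less_divisor) auto
      have "hasse_adj ?L (xs ! i) (xs ! (Suc i mod length xs))"
        using h i ys unfolding hasse_cycle_def by (metis length_map)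
      then show "hasse_adj (Leq (chains X)) (ys ! i) (ys ! (Suc i mod length ys))"
        unfolding ys length_map nth_map[OF i] nth_map[OF m] adj .
    qed
    then show False
      using chains_no_cycle[OF X] by blast
  qed
  ultimately show ?thesis
    using column_set_finite[OF X] column_set_nonempty[OF X] by (simp add: hasse_forest_def)
qed

section \<open>Unfolding a Hasse forest into chains\<close>

text \<open>Induction on the size of the interval from \<open>a\<close> to \<open>b\<close>: a point
  \<open>c\<close> strictly between splits it into two smaller intervals, and the two chains are
  joined at \<open>c\<close>.\<close>

lemma finite_order_saturated_chain:
  assumes fin: "finite C" and po: "partial_order_on C r" and ab: "(a, b) \<in> r"
  shows "\<exists>xs. xs \<noteq> [] \<and> hd xs = a \<and> last xs = b \<and> set xs \<subseteq> C \<and> successively (immediate_succ r) xs"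
  using ab
proof (induction "card {c. (a, c) \<in> r \<and> (c, b) \<in> r}" arbitrary: a b rule: less_induct)
  case less
  have sub: "r \<subseteq> C \<times> C" and tr: "trans r" and as: "antisym r" and rf: "refl_on C r"
    using po by (auto simp: partial_order_on_def preorder_on_def)
  have ab: "a \<in> C" "b \<in> C"
    using less.prems sub by auto
  have fin': "finite {c. (x, c) \<in> r \<and> (c, y) \<in> r}" for x y
    by (rule finite_subset[OF _ fin]) (use sub in auto)
  show ?case
  proof (cases "a = b \<or> immediate_succ r a b")
    case True
    then show ?thesis
    proof
      assume "a = b"
      then show ?thesis using ab by (intro exI[of _ "[a]"]) auto
    next
      assume "immediate_succ r a b"
      then show ?thesis using ab by (intro exI[of _ "[a, b]"]) auto
    qed
  next
    case False
    then obtain c where c: "(a, c) \<in> r" "(c, b) \<in> r" "c \<noteq> a" "c \<noteq> b"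
      using less.prems by (auto simp: immediate_succ_def)
    have 1: "{d. (a, d) \<in> r \<and> (d, c) \<in> r} \<subset> {d. (a, d) \<in> r \<and> (d, b) \<in> r}"
    proof (rule psubsetI)
      show "{d. (a, d) \<in> r \<and> (d, c) \<in> r} \<subseteq> {d. (a, d) \<in> r \<and> (d, b) \<in> r}"
        using c tr by (auto dest: transD)
      have "(b, c) \<notin> r" using c as by (auto dest: antisymD)
      moreover have "(b, b) \<in> r" using rf ab by (auto dest: refl_onD)
      ultimately show "{d. (a, d) \<in> r \<and> (d, c) \<in> r} \<noteq> {d. (a, d) \<in> r \<and> (d, b) \<in> r}"
        using less.prems by blast
    qed
    have 2: "{d. (c, d) \<in> r \<and> (d, b) \<in> r} \<subset> {d. (a, d) \<in> r \<and> (d, b) \<in> r}"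
    proof (rule psubsetI)
      show "{d. (c, d) \<in> r \<and> (d, b) \<in> r} \<subseteq> {d. (a, d) \<in> r \<and> (d, b) \<in> r}"
        using c tr by (auto dest: transD)
      have "(c, a) \<notin> r" using c as by (auto dest: antisymD)
      moreover have "(a, a) \<in> r" using rf ab by (auto dest: refl_onD)
      ultimately show "{d. (c, d) \<in> r \<and> (d, b) \<in> r} \<noteq> {d. (a, d) \<in> r \<and> (d, b) \<in> r}"
        using less.prems by blast
    qed
    obtain xs where xs: "xs \<noteq> []" "hd xs = a" "last xs = c" "set xs \<subseteq> C"
        "successively (immediate_succ r) xs"
      using less.hyps[OF psubset_card_mono[OF fin' 1] c(1)] by blast
    obtain ys where ys: "ys \<noteq> []" "hd ys = c" "last ys = b" "set ys \<subseteq> C"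
        "successively (immediate_succ r) ys"
      using less.hyps[OF psubset_card_mono[OF fin' 2] c(2)] by blast
    \<comment> \<open>Both chains contain \<open>c\<close>; it is dropped from the second
      one.\<close>
    obtain zs where zs: "ys = c # zs"
      using ys by (cases ys) auto
    show ?thesis
    proof (intro exI[of _ "xs @ zs"] conjI)
      show "last (xs @ zs) = b"
        using xs ys zs by (cases "zs = []") auto
      show "successively (immediate_succ r) (xs @ zs)"
        using xs ys zs by (cases zs) (auto simp: successively_append_iff)
    qed (use xs ys zs in auto)
  qed
qed

text \<open>A Hasse forest is unfolded into the disjoint union of its saturated chains, one column for
  each list of successive elements.\<close>

lemma hasse_forest_unfold:
  fixes A :: "'b LR_structure"
  assumes A: "hasse_forest A"
  shows "\<exists>Y k. column_set Y \<and> epimorphism (chains Y) A k"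
proof -
  let ?C = "carrier_of A" and ?r = "Leq A"
  have fin: "finite ?C" and ne: "?C \<noteq> {}" and TopA: "Top A = discrete_topology ?C"
    and po: "partial_order_on ?C ?r"
    and R: "Rrel A = {(a, b) \<in> ?C \<times> ?C. a = b \<or> hasse_adj ?r a b}"
    using A by (auto simp: hasse_forest_def)
  have sub: "?r \<subseteq> ?C \<times> ?C" and tr: "trans ?r" and as: "antisym ?r" and rf: "refl_on ?C ?r"
    using po by (auto simp: partial_order_on_def preorder_on_def)
  define P where "P = {xs. xs \<noteq> [] \<and> set xs \<subseteq> ?C \<and> successively (immediate_succ ?r) xs}"
  have le: "(xs ! i, xs ! j) \<in> ?r \<and> (i < j \<longrightarrow> xs ! i \<noteq> xs ! j)" if xs: "xs \<in> P" and ij: "i \<le> j" "j < length xs" for xs i j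
    using ij
  proof (induction j)
    case 0
    then have "xs ! 0 \<in> ?C" using xs by (auto simp: P_def)
    then show ?case using refl_onD[OF rf] "0" by auto
  next
    case (Suc j)
    show ?case
    proof (cases "i = Suc j")
      case True
      moreover have "xs ! Suc j \<in> ?C" using xs Suc.prems by (auto simp: P_def)
      ultimately show ?thesis using refl_onD[OF rf] by auto
    next
      case False
      then have IH: "(xs ! i, xs ! j) \<in> ?r"
        using Suc by auto
      have "immediate_succ ?r (xs ! j) (xs ! Suc j)"
        using xs Suc.prems by (auto simp: P_def successively_conv_nth)
      then have s: "(xs ! j, xs ! Suc j) \<in> ?r" "xs ! j \<noteq> xs ! Suc j"
        by (auto simp: immediate_succ_def)
      then have "xs ! i \<noteq> xs ! Suc j"
        using IH as by (auto dest: antisymD)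
      then show ?thesis
        using IH s tr by (auto dest: transD)
    qed
  qed
  \<comment> \<open>Saturated chains increase strictly, so they have no repetitions and are no
    longer than the carrier. This makes \<open>P\<close> finite.\<close>
  have "P \<subseteq> {xs. set xs \<subseteq> ?C \<and> length xs \<le> card ?C}"
  proof
    fix xs assume xs: "xs \<in> P"
    have "distinct xs"
      unfolding distinct_conv_nth using le[OF xs] by (metis linorder_neqE_nat order_less_imp_le)
    then have "length xs \<le> card ?C"
      using xs fin card_mono[of ?C "set xs"] by (auto simp: P_def distinct_card)
    then show "xs \<in> {xs. set xs \<subseteq> ?C \<and> length xs \<le> card ?C}"
      using xs by (auto simp: P_def)
  qed
  then have finP: "finite P"
    using finite_lists_length_le[OF fin] finite_subset by blast
  \<comment> \<open>The number given to a saturated chain becomes its column index.\<close>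
  obtain e :: "'b list \<Rightarrow> nat" where e: "inj_on e P"
    using finite_imp_inj_to_nat_seg[OF finP] by blast
  define Y where "Y = {(e xs, i) | xs i. xs \<in> P \<and> i < length xs}"
  define k where "k = (\<lambda>(c, i). inv_into P e c ! i)"
  have k: "k (e xs, i) = xs ! i" if "xs \<in> P" for xs i
    using that e by (simp add: k_def)
  obtain a0 where "a0 \<in> ?C" using ne by blast
  then have "(e [a0], 0) \<in> Y"
    by (auto simp: Y_def P_def intro!: exI[of _ "[a0]"])
  moreover have "Y = (\<Union>xs\<in>P. (\<lambda>i. (e xs, i)) ` {..<length xs})"
    by (auto simp: Y_def)
  then have "finite Y"
    using finP by auto
  ultimately have Y: "column_set Y"
    unfolding column_set_def by (fastforce simp: Y_def)
  have adj: "hasse_adj ?r (xs ! i) (xs ! Suc i)" if "xs \<in> P" "Suc i < length xs" for xs i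
    using that by (auto simp: P_def successively_conv_nth hasse_adj_def)
  have adj': "hasse_adj ?r a b \<Longrightarrow> hasse_adj ?r b a" for a b
    by (auto simp: hasse_adj_def)
  have inC: "xs ! i \<in> ?C" if "xs \<in> P" "i < length xs" for xs i
    using that by (auto simp: P_def)
  have Yin: "(e xs, i) \<in> Y" if "xs \<in> P" "i < length xs" for xs i
    using that by (auto simp: Y_def)
  have img: "k ` Y = ?C"
  proof
    show "k ` Y \<subseteq> ?C"
      using k inC by (auto simp: Y_def)
    show "?C \<subseteq> k ` Y"
    proof
      fix a assume "a \<in> ?C"
      then have "[a] \<in> P" by (auto simp: P_def)
      then show "a \<in> k ` Y"
        using Yin[of "[a]" 0] k[of "[a]" 0] by force
    qed
  qed
  have "epimorphism (chains Y) A k"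
    unfolding epimorphism_def
  proof (intro conjI)
    show "continuous_map (Top (chains Y)) (Top A) k"
      using img by (auto simp: continuous_map_from_discrete_topology)
    show "k ` carrier_of (chains Y) = ?C"
      using img by simp
    show "Rrel A = map_prod k k ` Rrel (chains Y)"
    proof
      show "map_prod k k ` Rrel (chains Y) \<subseteq> Rrel A"
      proof
        fix z assume "z \<in> map_prod k k ` Rrel (chains Y)"
        then obtain y y' where y: "y \<in> Y" "y' \<in> Y" "cadj y y'" and z: "z = (k y, k y')"
          by auto
        obtain xs i where xs: "xs \<in> P" "i < length xs" "y = (e xs, i)"
          using y by (auto simp: Y_def)
        obtain xs' j where xs': "xs' \<in> P" "j < length xs'" "y' = (e xs', j)"
          using y by (auto simp: Y_def)
        have "xs' = xs"
          using y xs xs' e by (auto simp: cadj_def inj_on_eq_iff)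
        then have j: "y' = (e xs, j)" "j < length xs" "i = j \<or> j = Suc i \<or> i = Suc j"
          using xs xs' y by (auto simp: cadj_def)
        then have "xs ! i = xs ! j \<or> hasse_adj ?r (xs ! i) (xs ! j)"
          using adj[OF xs(1)] adj' xs j by auto
        then show "z \<in> Rrel A"
          unfolding R z using k xs j inC[OF xs(1)] by auto
      qed
      show "Rrel A \<subseteq> map_prod k k ` Rrel (chains Y)"
      proof
        fix z assume "z \<in> Rrel A"
        then obtain a b where z: "z = (a, b)" "a \<in> ?C" "b \<in> ?C" "a = b \<or> hasse_adj ?r a b"
          using R by auto
        \<comment> \<open>One-element and two-element chains already realise every related pair;
          only the order requires long chains.\<close>
        then have "\<exists>xs i j. xs \<in> P \<and> i < length xs \<and> j < length xs \<and> i \<le> Suc j \<and> j \<le> Suc i \<and>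
            xs ! i = a \<and> xs ! j = b"
        proof -
          consider "a = b" | "immediate_succ ?r a b" | "immediate_succ ?r b a"
            using z by (auto simp: hasse_adj_def)
          then show ?thesis
          proof cases
            case 1
            then show ?thesis
              using z by (intro exI[of _ "[a]"] exI[of _ 0]) (auto simp: P_def)
          next
            case 2
            then show ?thesis
              using z by (intro exI[of _ "[a, b]"] exI[of _ 0] exI[of _ 1]) (auto simp: P_def)
          next
            case 3
            then show ?thesis
              using z by (intro exI[of _ "[b, a]"] exI[of _ 1] exI[of _ 0]) (auto simp: P_def)
          qed
        qed
        then obtain xs i j where xs: "xs \<in> P" "i < length xs" "j < length xs" "i \<le> Suc j"
            "j \<le> Suc i" "xs ! i = a" "xs ! j = b"
          by blast
        then have "((e xs, i), (e xs, j)) \<in> Rrel (chains Y)"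
          by (auto simp: cadj_def Yin)
        moreover have "k (e xs, i) = a" "k (e xs, j) = b"
          using xs k by auto
        ultimately show "z \<in> map_prod k k ` Rrel (chains Y)"
          unfolding z(1) by (metis map_prod_imageI)
      qed
    qed
    show "Leq A = map_prod k k ` Leq (chains Y)"
    proof
      show "map_prod k k ` Leq (chains Y) \<subseteq> Leq A"
      proof
        fix z assume "z \<in> map_prod k k ` Leq (chains Y)"
        then obtain y y' where y: "y \<in> Y" "y' \<in> Y" "cle y y'" and z: "z = (k y, k y')"
          by auto
        obtain xs i where xs: "xs \<in> P" "i < length xs" "y = (e xs, i)"
          using y by (auto simp: Y_def)
        obtain xs' j where xs': "xs' \<in> P" "j < length xs'" "y' = (e xs', j)"
          using y by (auto simp: Y_def)
        have "xs' = xs"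
          using y xs xs' e by (auto simp: cle_def inj_on_eq_iff)
        then show "z \<in> Leq A"
          using le[OF xs(1), of i j] xs xs' y(3) k[OF xs(1)] unfolding z cle_def by simp
      qed
      show "Leq A \<subseteq> map_prod k k ` Leq (chains Y)"
      proof
        fix z assume "z \<in> Leq A"
        then obtain a b where z: "z = (a, b)" "(a, b) \<in> ?r"
          by (cases z) auto
        then obtain xs where xs: "xs \<noteq> []" "hd xs = a" "last xs = b" "xs \<in> P"
          using finite_order_saturated_chain[OF fin po z(2)] by (auto simp: P_def)
        let ?n = "length xs - 1"
        have "((e xs, 0), (e xs, ?n)) \<in> Leq (chains Y)"
          using xs by (auto simp: cle_def intro!: Yin)
        moreover have "k (e xs, 0) = a" "k (e xs, ?n) = b"
          using xs k by (auto simp: hd_conv_nth last_conv_nth)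
        ultimately show "z \<in> map_prod k k ` Leq (chains Y)"
          unfolding z(1) by (metis map_prod_imageI)
      qed
    qed
  qed
  then show ?thesis
    using Y by blast
qed

section \<open>Maps of the limit onto finite unions of chains\<close>

locale fraisse_limit =
  fixes F :: "'a LR_structure"
  assumes limit: "projective_fraisse_limit F"
begin

abbreviation "S \<equiv> carrier_of F"

text \<open>Local constancy. The value type carries no topology and no finiteness; compactness makes
  the image finite.\<close>

definition lc :: "('a \<Rightarrow> 'q) \<Rightarrow> bool" where
  "lc q \<longleftrightarrow> (\<forall>a. openin (Top F) {s \<in> S. q s = a})"

definition finer :: "('a \<Rightarrow> 'p) \<Rightarrow> ('a \<Rightarrow> 'q) \<Rightarrow> bool" where
  "finer f q \<longleftrightarrow> (\<forall>s\<in>S. \<forall>t\<in>S. f s = f t \<longrightarrow> q s = q t)"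

definition hom :: "('a \<Rightarrow> nat \<times> nat) \<Rightarrow> bool" where
  "hom f \<longleftrightarrow> lc f \<and> (\<forall>(s, t)\<in>Rrel F. cadj (f s) (f t)) \<and> (\<forall>(s, t)\<in>Leq F. cle (f s) (f t))"

text \<open>The target is the image itself, so no finite structure has to be carried along. A
  \<open>hom\<close>, by contrast, may leave relations of its image unlifted and columns that do not
  start at 0.\<close>

definition proj :: "('a \<Rightarrow> nat \<times> nat) \<Rightarrow> bool" where
  "proj f \<longleftrightarrow> column_set (f ` S) \<and> epimorphism F (chains (f ` S)) f"

lemma compact_F: "compact_space (Top F)"
  and metrizable_F: "metrizable_space (Top F)"
  and dim_F: "Top F dim_le 0"
  and closed_R: "closedin (prod_topology (Top F) (Top F)) (Rrel F)"
  and closed_L: "closedin (prod_topology (Top F) (Top F)) (Leq F)"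
  using limit by (auto simp: projective_fraisse_limit_def topological_LR_structure_def)

lemma Hausdorff_F: "Hausdorff_space (Top F)"
  by (simp add: metrizable_F metrizable_imp_Hausdorff_space)

lemma R_sub: "Rrel F \<subseteq> S \<times> S"
  using closedin_subset[OF closed_R] by simp

lemma L_sub: "Leq F \<subseteq> S \<times> S"
  using closedin_subset[OF closed_L] by simp

lemma clopen_base:
  assumes "openin (Top F) U" "s \<in> U"
  obtains V where "openin (Top F) V" "closedin (Top F) V" "s \<in> V" "V \<subseteq> U"
proof -
  have "neighbourhood_base_of (\<lambda>U. closedin (Top F) U \<and> openin (Top F) U) (Top F)"
    using dim_F by (simp add: dimension_le_0_neighbourhood_base_of_clopen)
  then have "\<exists>W V. openin (Top F) W \<and> (closedin (Top F) V \<and> openin (Top F) V) \<and> s \<in> W \<and> W \<subseteq> V \<and> V \<subseteq> U"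
    unfolding neighbourhood_base_of using assms by simp
  then show thesis
    using that by blast
qed

lemma clopen_separate:
  assumes "s \<in> S" "t \<in> S" "s \<noteq> t"
  obtains U where "openin (Top F) U" "closedin (Top F) U" "s \<in> U" "t \<notin> U"
proof -
  have "closedin (Top F) {t}"
    using Hausdorff_F assms by (simp add: closedin_Hausdorff_sing_eq)
  then have "openin (Top F) (S - {t})"
    by blast
  then obtain V where "openin (Top F) V" "closedin (Top F) V" "s \<in> V" "V \<subseteq> S - {t}"
    by (rule clopen_base) (use assms in blast)
  then show thesis
    using that by blast
qed

section \<open>Locally constant maps and common refinements\<close>

lemma lc_openin: "lc q \<Longrightarrow> openin (Top F) {s \<in> S. P (q s)}"
proof -
  assume q: "lc q"
  have "{s \<in> S. P (q s)} = \<Union>{{s \<in> S. q s = a} | a. P a}"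
    by auto
  then show ?thesis
    using q by (auto simp: lc_def)
qed

lemma lc_closedin:
  assumes "lc q"
  shows "closedin (Top F) {s \<in> S. P (q s)}"
proof -
  have "S - {s \<in> S. P (q s)} = {s \<in> S. \<not> P (q s)}"
    by auto
  then show ?thesis
    using lc_openin[OF assms, of "\<lambda>a. \<not> P a"] by (auto simp: closedin_def)
qed

lemma lc_comp: "lc q \<Longrightarrow> lc (\<lambda>s. h (q s))"
  using lc_openin by (auto simp: lc_def)

lemma lc_pair: "lc p \<Longrightarrow> lc q \<Longrightarrow> lc (\<lambda>s. (p s, q s))"
proof -
  assume "lc p" "lc q"
  then have "openin (Top F) ({s \<in> S. p s = fst a} \<inter> {s \<in> S. q s = snd a})" for a
    by (auto simp: lc_def)
  moreover have "{s \<in> S. p s = fst a} \<inter> {s \<in> S. q s = snd a} = {s \<in> S. (p s, q s) = a}" for a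
    by (cases a) auto
  ultimately show ?thesis
    by (simp add: lc_def)
qed

lemma lc_clopen:
  assumes "openin (Top F) U" "closedin (Top F) U"
  shows "lc (\<lambda>s. s \<in> U)"
  unfolding lc_def
proof
  fix a :: bool
  have "{s \<in> S. (s \<in> U) = a} = (if a then U else S - U)"
    using openin_subset[OF assms(1)] by auto
  then show "openin (Top F) {s \<in> S. (s \<in> U) = a}"
    using assms by auto
qed

lemma lc_const: "lc (\<lambda>s. a)"
  using lc_comp[OF lc_clopen[OF openin_topspace closedin_topspace], of "\<lambda>_. a"] .

text \<open>Bundling finitely many maps into one function-valued map lets a single refinement serve
  all of them. \<open>restrict\<close> fixes the values off \<open>I\<close>, so equality of bundles
  is equality on \<open>I\<close>.\<close>

lemma lc_family:
  assumes "finite I" "\<And>i. i \<in> I \<Longrightarrow> lc (q i)"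
  shows "lc (\<lambda>s. restrict (\<lambda>i. q i s) I)"
  using assms
proof (induction I rule: finite_induct)
  case empty
  then show ?case by (simp add: lc_const)
next
  case (insert i I)
  have "(\<lambda>s. restrict (\<lambda>i. q i s) (insert i I)) =
      (\<lambda>s. (\<lambda>(a, r). r(i := a)) (q i s, restrict (\<lambda>i. q i s) I))"
    by (auto simp: fun_eq_iff restrict_def)
  moreover have "lc (q i)" "lc (\<lambda>s. restrict (\<lambda>i. q i s) I)"
    using insert by blast+
  then have "lc (\<lambda>s. (\<lambda>(a, r). r(i := a)) (q i s, restrict (\<lambda>i. q i s) I))"
    by (intro lc_comp[where h = "\<lambda>(a, r). r(i := a)"] lc_pair)
  ultimately show ?case by (simp only:)
qed

lemma finer_family:
  assumes "finer f (\<lambda>s. restrict (\<lambda>i. q i s) I)" "i \<in> I"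
  shows "finer f (q i)"
  unfolding finer_def
proof (intro ballI impI)
  fix s t assume st: "s \<in> S" "t \<in> S" "f s = f t"
  then have "restrict (\<lambda>i. q i s) I = restrict (\<lambda>i. q i t) I"
    using assms(1) unfolding finer_def by blast
  then show "q i s = q i t"
    using assms(2) by (metis restrict_apply')
qed

lemma finerD: "finer f q \<Longrightarrow> s \<in> S \<Longrightarrow> t \<in> S \<Longrightarrow> f s = f t \<Longrightarrow> q s = q t"
  unfolding finer_def by blast

lemma finer_trans: "finer f g \<Longrightarrow> finer g q \<Longrightarrow> finer f q"
  unfolding finer_def by blast

lemma finer_pair: "finer f (\<lambda>s. (p s, q s)) \<longleftrightarrow> finer f p \<and> finer f q"
  unfolding finer_def by blast

text \<open>The fibres form a disjoint open cover, and a finite subcover must contain every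
  non-empty one.\<close>

lemma lc_finite_image:
  assumes "lc q"
  shows "finite (q ` S)"
proof -
  let ?U = "(\<lambda>a. {s \<in> S. q s = a}) ` q ` S"
  have "\<forall>U\<in>?U. openin (Top F) U" "S \<subseteq> \<Union>?U"
    using assms by (auto simp: lc_def)
  then have "\<exists>\<F>. finite \<F> \<and> \<F> \<subseteq> ?U \<and> S \<subseteq> \<Union>\<F>"
    using compact_F unfolding compact_space_alt by meson
  then obtain \<F> where F: "finite \<F>" "\<F> \<subseteq> ?U" "S \<subseteq> \<Union>\<F>"
    by blast
  then obtain A where A: "finite A" "A \<subseteq> q ` S" "\<F> = (\<lambda>a. {s \<in> S. q s = a}) ` A"
    by (meson finite_subset_image)
  then have "q ` S \<subseteq> A"
    using F by auto
  then show ?thesis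
    using A(1) finite_subset by blast
qed

lemma epi_chains_lc: "epimorphism F (chains X) f \<Longrightarrow> lc f"
  unfolding lc_def
proof
  fix a assume f: "epimorphism F (chains X) f"
  then have c: "continuous_map (Top F) (discrete_topology X) f" and im: "f ` S = X"
    by (auto simp: epimorphism_def)
  show "openin (Top F) {s \<in> S. f s = a}"
  proof (cases "a \<in> X")
    case True
    then show ?thesis
      using openin_continuous_map_preimage[OF c, of "{a}"] by simp
  next
    case False
    then have e: "{s \<in> S. f s = a} = {}" using im by auto
    show ?thesis unfolding e by simp
  qed
qed

lemma epi_chains_image: "epimorphism F (chains X) f \<Longrightarrow> f ` S = X"
  by (auto simp: epimorphism_def)

lemma proj_hom: "proj f \<Longrightarrow> hom f"
proof -
  assume f: "proj f"
  then have e: "Rrel (chains (f ` S)) = map_prod f f ` Rrel F" "Leq (chains (f ` S)) = map_prod f f ` Leq F"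
    by (auto simp: proj_def epimorphism_def)
  have "(f s, f t) \<in> Rrel (chains (f ` S))" if "(s, t) \<in> Rrel F" for s t
    unfolding e using that by force
  moreover have "(f s, f t) \<in> Leq (chains (f ` S))" if "(s, t) \<in> Leq F" for s t
    unfolding e using that by force
  ultimately show ?thesis
    using f epi_chains_lc unfolding hom_def proj_def by fastforce
qed

lemma hom_lc: "hom f \<Longrightarrow> lc f"
  by (simp add: hom_def)

lemma hom_R: "hom f \<Longrightarrow> (s, t) \<in> Rrel F \<Longrightarrow> cadj (f s) (f t)"
  by (auto simp: hom_def)

lemma hom_L: "hom f \<Longrightarrow> (s, t) \<in> Leq F \<Longrightarrow> cle (f s) (f t)"
  by (auto simp: hom_def)

lemma hom_R_fst: "hom f \<Longrightarrow> (s, t) \<in> Rrel F \<Longrightarrow> fst (f s) = fst (f t)"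
  using hom_R cadj_def by blast

lemma hom_L_fst: "hom f \<Longrightarrow> (s, t) \<in> Leq F \<Longrightarrow> fst (f s) = fst (f t)"
  using hom_L cle_def by blast

lemma proj_lc: "proj f \<Longrightarrow> lc f"
  using proj_hom hom_lc by blast

lemma proj_R_onto:
  assumes "proj f" "s \<in> S" "t \<in> S" "cadj (f s) (f t)"
  obtains s' t' where "(s', t') \<in> Rrel F" "f s' = f s" "f t' = f t"
proof -
  have "Rrel (chains (f ` S)) = map_prod f f ` Rrel F"
    using assms(1) unfolding proj_def epimorphism_def by blast
  moreover have "(f s, f t) \<in> Rrel (chains (f ` S))"
    using assms(2-4) by simp
  ultimately have "(f s, f t) \<in> map_prod f f ` Rrel F"
    by blast
  then show thesis
    using that by auto
qed

lemma proj_L_onto: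
  assumes "proj f" "s \<in> S" "t \<in> S" "cle (f s) (f t)"
  obtains s' t' where "(s', t') \<in> Leq F" "f s' = f s" "f t' = f t"
proof -
  have "Leq (chains (f ` S)) = map_prod f f ` Leq F"
    using assms(1) unfolding proj_def epimorphism_def by blast
  moreover have "(f s, f t) \<in> Leq (chains (f ` S))"
    using assms(2-4) by simp
  ultimately have "(f s, f t) \<in> map_prod f f ` Leq F"
    by blast
  then show thesis
    using that by auto
qed

text \<open>An adjacent pair of \<open>g\<close>-values comes from a related pair of points, and
  \<open>f\<close> is constant on fibres of \<open>g\<close>. In effect \<open>f\<close> factors
  through \<open>g\<close> by a map preserving adjacency.\<close>

lemma finer_cadj:
  assumes "proj g" "hom f" "finer g f" "s \<in> S" "t \<in> S" "cadj (g s) (g t)"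
  shows "cadj (f s) (f t)"
proof -
  obtain s' t' where st: "(s', t') \<in> Rrel F" "g s' = g s" "g t' = g t"
    using proj_R_onto assms by metis
  then have "f s' = f s" "f t' = f t"
    using finerD[OF assms(3) _ assms(4)] finerD[OF assms(3) _ assms(5)] R_sub by blast+
  then show ?thesis
    using hom_R[OF assms(2) st(1)] by simp
qed

lemma finer_cle:
  assumes "proj g" "hom f" "finer g f" "s \<in> S" "t \<in> S" "cle (g s) (g t)"
  shows "cle (f s) (f t)"
proof -
  obtain s' t' where st: "(s', t') \<in> Leq F" "g s' = g s" "g t' = g t"
    using proj_L_onto assms by metis
  then have "f s' = f s" "f t' = f t"
    using finerD[OF assms(3) _ assms(4)] finerD[OF assms(3) _ assms(5)] L_sub by blast+
  then show ?thesis
    using hom_L[OF assms(2) st(1)] by simp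
qed

section \<open>Lifting and refining by the limit axioms\<close>

lemmas limit_onto = limit[unfolded projective_fraisse_limit_def, THEN conjunct2, THEN conjunct1, rule_format]

lemmas limit_refine =
  limit[unfolded projective_fraisse_limit_def, THEN conjunct2, THEN conjunct2, THEN conjunct1, rule_format]

lemmas limit_extend =
  limit[unfolded projective_fraisse_limit_def, THEN conjunct2, THEN conjunct2, THEN conjunct2, rule_format]

text \<open>Take any epimorphism onto \<open>chains Y\<close>, compose it with \<open>k\<close>, and
  correct it by the automorphism that matches the composite with \<open>\<phi>\<close>.\<close>

lemma lift_forest:
  fixes A :: "nat LR_structure"
  assumes A: "hasse_forest A" "epimorphism F A \<phi>"
    and Y: "column_set Y" "epimorphism (chains Y) A k"
  shows "\<exists>g. epimorphism F (chains Y) g \<and> (\<forall>s\<in>S. \<phi> s = k (g s))"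
proof -
  have "hasse_forest (relabel prod_encode (chains Y))"
    by (rule hasse_forest_relabel_chains[OF Y(1) inj_prod_encode])
  then obtain \<theta> where "epimorphism F (relabel prod_encode (chains Y)) \<theta>"
    using limit_onto by blast
  then have \<theta>: "epimorphism F (chains Y) (prod_decode \<circ> \<theta>)"
    by (rule epimorphism_relabel_inv[rotated 2]) auto
  then have "epimorphism F A (k \<circ> (prod_decode \<circ> \<theta>))"
    using Y(2) epimorphism_compose by blast
  then obtain \<psi> where \<psi>: "automorphism F \<psi>" "\<forall>s\<in>S. \<phi> s = (k \<circ> (prod_decode \<circ> \<theta>)) (\<psi> s)"
    using limit_extend[OF conjI[OF A(1) conjI[OF _ A(2)]]] by blast
  then have "epimorphism F (chains Y) (prod_decode \<circ> \<theta> \<circ> \<psi>)"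
    using \<theta> epimorphism_compose unfolding automorphism_def by blast
  then show ?thesis
    using \<psi>(2) by auto
qed

lemma proj_lift:
  assumes f: "proj f" and Y: "column_set Y" "epimorphism (chains Y) (chains (f ` S)) k"
  obtains g where "proj g" "g ` S = Y" "\<And>s. s \<in> S \<Longrightarrow> f s = k (g s)"
proof -
  let ?A = "relabel prod_encode (chains (f ` S))"
  have "hasse_forest ?A"
    using f by (intro hasse_forest_relabel_chains inj_prod_encode) (auto simp: proj_def)
  moreover have "epimorphism F ?A (prod_encode \<circ> f)"
    using f by (intro epimorphism_relabel) (auto simp: proj_def)
  moreover have "epimorphism (chains Y) ?A (prod_encode \<circ> k)"
    using Y by (intro epimorphism_relabel) auto
  ultimately obtain g where g: "epimorphism F (chains Y) g"
      "\<forall>s\<in>S. (prod_encode \<circ> f) s = (prod_encode \<circ> k) (g s)"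
    using lift_forest Y(1) by blast
  have "g ` S = Y"
    using g epi_chains_image by blast
  then show thesis
    using that[of g] g Y by (auto simp: proj_def)
qed

text \<open>The covering axiom yields a map onto a forest that determines \<open>q\<close>. Lifting
  it along the unfolding of the forest gives a map onto a union of chains that is at least as
  fine.\<close>

lemma refine:
  assumes q: "lc q"
  obtains f where "proj f" "finer f q"
proof -
  let ?U = "(\<lambda>a. {s \<in> S. q s = a}) ` q ` S"
  have "(\<forall>U\<in>?U. openin (Top F) U \<and> closedin (Top F) U) \<and> \<Union>?U = S"
    using lc_openin[OF q] lc_closedin[OF q] by auto
  note limit_refine[OF this]
  then obtain A :: "nat LR_structure" and \<phi> where A\<phi>: "hasse_forest A \<and> epimorphism F A \<phi> \<and>
      (\<forall>a \<in> carrier_of A. \<exists>U\<in>?U. {x \<in> S. \<phi> x = a} \<subseteq> U)"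
    by (elim exE)
  then have A: "hasse_forest A" "epimorphism F A \<phi>"
    and fine: "\<forall>a \<in> carrier_of A. \<exists>U\<in>?U. {x \<in> S. \<phi> x = a} \<subseteq> U"
    using A\<phi>[THEN conjunct1] A\<phi>[THEN conjunct2, THEN conjunct1] A\<phi>[THEN conjunct2, THEN conjunct2]
    by - assumption
  obtain Y k where Y: "column_set Y" "epimorphism (chains Y) A k"
    using hasse_forest_unfold[OF A(1)] by blast
  obtain g where g: "epimorphism F (chains Y) g" "\<forall>s\<in>S. \<phi> s = k (g s)"
    using lift_forest[OF A Y] by blast
  then have "proj g"
    using Y epi_chains_image by (auto simp: proj_def)
  moreover have "finer g q"
    unfolding finer_def
  proof (intro ballI impI)
    fix s t assume st: "s \<in> S" "t \<in> S" "g s = g t"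
    then have "\<phi> s = \<phi> t" "\<phi> s \<in> carrier_of A"
      using g A by (auto simp: epimorphism_def)
    then obtain U where "U \<in> ?U" "s \<in> U" "t \<in> U"
      using bspec[OF fine, of "\<phi> s"] st by auto
    then show "q s = q t"
      by auto
  qed
  ultimately show thesis
    using that by blast
qed

lemma refine2:
  assumes "lc p" "lc q"
  obtains f where "proj f" "finer f p" "finer f q"
  using refine[OF lc_pair[OF assms]] finer_pair by metis

lemma separate:
  assumes "s \<in> S" "t \<in> S" "s \<noteq> t"
  obtains f where "proj f" "f s \<noteq> f t"
proof -
  obtain U where U: "openin (Top F) U" "closedin (Top F) U" "s \<in> U" "t \<notin> U"
    using clopen_separate[OF assms] by blast
  then obtain f where "proj f" "finer f (\<lambda>s. s \<in> U)"
    using refine[OF lc_clopen] by blast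
  then show thesis
    using that[of f] finerD[of f "\<lambda>s. s \<in> U" s t] U assms by blast
qed

text \<open>Choose one separating map for each pair of distinct points and refine them all together
  with \<open>q\<close>.\<close>

lemma separate_finite:
  assumes "finite A" "A \<subseteq> S" "lc q"
  obtains f where "proj f" "inj_on f A" "finer f q"
proof -
  define D where "D = {(s, t) \<in> A \<times> A. s \<noteq> t}"
  have "\<exists>f. proj f \<and> f (fst d) \<noteq> f (snd d)" if "d \<in> D" for d
  proof -
    have "fst d \<in> S" "snd d \<in> S" "fst d \<noteq> snd d"
      using that assms(2) by (auto simp: D_def)
    then obtain f where "proj f" "f (fst d) \<noteq> f (snd d)"
      by (rule separate)
    then show ?thesis by blast
  qed
  then obtain g where g: "\<And>d. d \<in> D \<Longrightarrow> proj (g d) \<and> g d (fst d) \<noteq> g d (snd d)"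
    by metis
  have "finite D"
    unfolding D_def by (rule finite_subset[of _ "A \<times> A"]) (use assms in auto)
  then have "lc (\<lambda>s. restrict (\<lambda>d. g d s) D)"
    using g proj_lc by (intro lc_family) auto
  then obtain f where f: "proj f" "finer f (\<lambda>s. restrict (\<lambda>d. g d s) D)" "finer f q"
    using refine2 assms by blast
  have "inj_on f A"
  proof (rule inj_onI, rule ccontr)
    fix s t assume st: "s \<in> A" "t \<in> A" "f s = f t" "s \<noteq> t"
    then have "(s, t) \<in> D" by (auto simp: D_def)
    then show False
      using finerD[OF finer_family[OF f(2)], of "(s, t)" s t] g[of "(s, t)"] st assms by auto
  qed
  then show thesis
    using that f by blast
qed

section \<open>Both relations are determined by finite quotients\<close>

text \<open>Some clopen box around \<open>(s, t)\<close> misses \<open>Q\<close>, and a map that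
  decides both of its sides cannot confuse \<open>(s, t)\<close> with a member of
  \<open>Q\<close>.\<close>

lemma closed_relation_separate:
  assumes "closedin (prod_topology (Top F) (Top F)) Q" "s \<in> S" "t \<in> S" "(s, t) \<notin> Q"
  obtains f where "proj f" "\<And>s' t'. s' \<in> S \<Longrightarrow> t' \<in> S \<Longrightarrow> f s' = f s \<Longrightarrow> f t' = f t \<Longrightarrow> (s', t') \<notin> Q"
proof -
  have "openin (prod_topology (Top F) (Top F)) (S \<times> S - Q)"
    using assms(1) by (simp add: closedin_def)
  then obtain U V where UV: "openin (Top F) U" "openin (Top F) V" "s \<in> U" "t \<in> V" "U \<times> V \<subseteq> S \<times> S - Q"
    using assms unfolding openin_prod_topology_alt by (metis DiffI SigmaI)
  obtain U' where U': "openin (Top F) U'" "closedin (Top F) U'" "s \<in> U'" "U' \<subseteq> U"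
    using clopen_base UV by blast
  obtain V' where V': "openin (Top F) V'" "closedin (Top F) V'" "t \<in> V'" "V' \<subseteq> V"
    using clopen_base UV by blast
  obtain f where f: "proj f" "finer f (\<lambda>s. s \<in> U')" "finer f (\<lambda>s. s \<in> V')"
    using refine2[OF lc_clopen lc_clopen] U' V' by blast
  show thesis
  proof (rule that[OF f(1)])
    fix s' t' assume "s' \<in> S" "t' \<in> S" "f s' = f s" "f t' = f t"
    then have "s' \<in> U'" "t' \<in> V'"
      using finerD[OF f(2), of s' s] finerD[OF f(3), of t' t] assms U' V' by auto
    then show "(s', t') \<notin> Q"
      using U' V' UV by blast
  qed
qed

text \<open>If the images under \<open>f\<close> are adjacent, then the two fibres contain a related
  pair; a map separating \<open>(s, t)\<close> from the closed relation excludes exactly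
  this.\<close>

lemma R_iff:
  assumes "s \<in> S" "t \<in> S"
  shows "(s, t) \<in> Rrel F \<longleftrightarrow> (\<forall>f. proj f \<longrightarrow> cadj (f s) (f t))"
proof
  show "(s, t) \<in> Rrel F \<Longrightarrow> \<forall>f. proj f \<longrightarrow> cadj (f s) (f t)"
    using hom_R proj_hom by blast
  show "\<forall>f. proj f \<longrightarrow> cadj (f s) (f t) \<Longrightarrow> (s, t) \<in> Rrel F"
  proof (rule ccontr)
    assume h: "\<forall>f. proj f \<longrightarrow> cadj (f s) (f t)" and "(s, t) \<notin> Rrel F"
    then obtain f where f: "proj f" "\<And>s' t'. s' \<in> S \<Longrightarrow> t' \<in> S \<Longrightarrow> f s' = f s \<Longrightarrow> f t' = f t \<Longrightarrow> (s', t') \<notin> Rrel F"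
      using closed_relation_separate[OF closed_R assms] by blast
    then obtain s' t' where "(s', t') \<in> Rrel F" "f s' = f s" "f t' = f t"
      using h proj_R_onto assms by metis
    then show False
      using f(2) R_sub by blast
  qed
qed

lemma L_iff:
  assumes "s \<in> S" "t \<in> S"
  shows "(s, t) \<in> Leq F \<longleftrightarrow> (\<forall>f. proj f \<longrightarrow> cle (f s) (f t))"
proof
  show "(s, t) \<in> Leq F \<Longrightarrow> \<forall>f. proj f \<longrightarrow> cle (f s) (f t)"
    using hom_L proj_hom by blast
  show "\<forall>f. proj f \<longrightarrow> cle (f s) (f t) \<Longrightarrow> (s, t) \<in> Leq F"
  proof (rule ccontr)
    assume h: "\<forall>f. proj f \<longrightarrow> cle (f s) (f t)" and "(s, t) \<notin> Leq F"
    then obtain f where f: "proj f" "\<And>s' t'. s' \<in> S \<Longrightarrow> t' \<in> S \<Longrightarrow> f s' = f s \<Longrightarrow> f t' = f t \<Longrightarrow> (s', t') \<notin> Leq F"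
      using closed_relation_separate[OF closed_L assms] by blast
    then obtain s' t' where "(s', t') \<in> Leq F" "f s' = f s" "f t' = f t"
      using h proj_L_onto assms by metis
    then show False
      using f(2) L_sub by blast
  qed
qed

lemma R_refl: "s \<in> S \<Longrightarrow> (s, s) \<in> Rrel F"
  by (simp add: R_iff)

lemma R_in: "(s, t) \<in> Rrel F \<Longrightarrow> s \<in> S \<and> t \<in> S"
  using R_sub by auto

lemma L_in: "(s, t) \<in> Leq F \<Longrightarrow> s \<in> S \<and> t \<in> S"
  using L_sub by auto

lemma R_sym: "(s, t) \<in> Rrel F \<Longrightarrow> (t, s) \<in> Rrel F"
  using R_in[of s t] R_iff[of s t] R_iff[of t s] cadj_sym by blast

lemma L_refl: "s \<in> S \<Longrightarrow> (s, s) \<in> Leq F"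
  by (simp add: L_iff)

lemma L_trans: "(s, t) \<in> Leq F \<Longrightarrow> (t, w) \<in> Leq F \<Longrightarrow> (s, w) \<in> Leq F"
proof -
  assume st: "(s, t) \<in> Leq F" and tw: "(t, w) \<in> Leq F"
  have "cle (f s) (f w)" if "proj f" for f
    using hom_L[OF proj_hom[OF that] st] hom_L[OF proj_hom[OF that] tw] cle_trans by blast
  then show "(s, w) \<in> Leq F"
    using L_iff L_in[OF st] L_in[OF tw] by blast
qed

lemma L_antisym:
  assumes "(s, t) \<in> Leq F" "(t, s) \<in> Leq F"
  shows "s = t"
proof (rule ccontr)
  assume "s \<noteq> t"
  then obtain f where "proj f" "f s \<noteq> f t"
    using separate L_in[OF assms(1)] by blast
  then show False
    using cle_antisym hom_L[OF proj_hom] assms by blast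
qed

text \<open>Every element becomes two consecutive copies. Two distinct adjacent elements lift to the
  upper copy of the lower one and the lower copy of the upper one; no other pair of copies is
  adjacent.\<close>

lemma doubling:
  assumes f: "proj f"
  obtains g where "proj g" "\<And>s. s \<in> S \<Longrightarrow> f s = (fst (g s), snd (g s) div 2)"
proof -
  let ?X = "f ` S" and ?k = "\<lambda>a :: nat \<times> nat. (fst a, snd a div 2)"
  let ?Y = "{a. ?k a \<in> ?X}"
  have X: "column_set ?X"
    using f by (simp add: proj_def)
  have img: "?k ` ?Y = ?X"
  proof
    show "?X \<subseteq> ?k ` ?Y"
    proof
      fix a assume "a \<in> ?X"
      then have "a = ?k (fst a, 2 * snd a)" "(fst a, 2 * snd a) \<in> ?Y" by auto
      then show "a \<in> ?k ` ?Y" by blast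
    qed
  qed auto
  have Y: "column_set ?Y"
    unfolding column_set_def
  proof (intro conjI allI impI)
    have "?Y \<subseteq> (\<lambda>a. (fst a, 2 * snd a)) ` ?X \<union> (\<lambda>a. (fst a, Suc (2 * snd a))) ` ?X"
    proof
      fix a assume a: "a \<in> ?Y"
      have "a = (fst a, 2 * (snd a div 2)) \<or> a = (fst a, Suc (2 * (snd a div 2)))"
        by (cases a; cases "even (snd a)") auto
      then show "a \<in> (\<lambda>a. (fst a, 2 * snd a)) ` ?X \<union> (\<lambda>a. (fst a, Suc (2 * snd a))) ` ?X"
      proof
        assume "a = (fst a, 2 * (snd a div 2))"
        then show ?thesis
          by (intro UnI1 image_eqI[of _ _ "?k a"]) (use a in simp_all)
      next
        assume "a = (fst a, Suc (2 * (snd a div 2)))"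
        then show ?thesis
          by (intro UnI2 image_eqI[of _ _ "?k a"]) (use a in simp_all)
      qed
    qed
    then show "finite ?Y"
      using column_set_finite[OF X] finite_subset by blast
    show "?Y \<noteq> {}"
      using img column_set_nonempty[OF X] by blast
    fix c i j assume "(c, j) \<in> ?Y \<and> i \<le> j"
    then show "(c, i) \<in> ?Y"
      using column_set_down[OF X, of c "j div 2" "i div 2"] by (auto simp: div_le_mono)
  qed
  have "epimorphism (chains ?Y) (chains ?X) ?k"
  proof (rule chains_epimorphismI)
    fix a b :: "nat \<times> nat"
    show "cle (?k a) (?k b)" if "cle a b"
      using that by (simp add: cle_def div_le_mono)
    show "cadj (?k a) (?k b)" if "cadj a b"
    proof -
      have "snd a div 2 \<le> Suc (snd b div 2)" "snd b div 2 \<le> Suc (snd a div 2)"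
        using that unfolding cadj_def by linarith+
      then show ?thesis
        using that by (simp add: cadj_def)
    qed
    assume ab: "a \<in> ?X" "b \<in> ?X"
    show "\<exists>a'\<in>?Y. \<exists>b'\<in>?Y. cle a' b' \<and> ?k a' = a \<and> ?k b' = b" if "cle a b"
    proof -
      have k: "?k (fst a, 2 * snd a) = a" "?k (fst b, 2 * snd b) = b"
        by auto
      moreover have "cle (fst a, 2 * snd a) (fst b, 2 * snd b)"
        using that by (simp add: cle_def)
      moreover have "(fst a, 2 * snd a) \<in> ?Y" "(fst b, 2 * snd b) \<in> ?Y"
        unfolding mem_Collect_eq k by (fact ab)+
      ultimately show ?thesis
        by blast
    qed
    show "\<exists>a'\<in>?Y. \<exists>b'\<in>?Y. cadj a' b' \<and> ?k a' = a \<and> ?k b' = b" if "cadj a b"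
    proof -
      define a' where "a' = (fst a, if snd a < snd b then Suc (2 * snd a) else 2 * snd a)"
      define b' where "b' = (fst b, if snd b < snd a then Suc (2 * snd b) else 2 * snd b)"
      have k: "?k a' = a" "?k b' = b"
        by (auto simp: a'_def b'_def)
      moreover have "cadj a' b'"
        using that unfolding a'_def b'_def cadj_def by (simp; arith)
      moreover have "a' \<in> ?Y" "b' \<in> ?Y"
        unfolding mem_Collect_eq k by (fact ab)+
      ultimately show ?thesis
        by blast
    qed
  qed auto
  then show thesis
  proof (rule proj_lift[OF f Y])
    fix g assume "proj g" "\<And>s. s \<in> S \<Longrightarrow> f s = ?k (g s)"
    then show thesis by (rule that)
  qed
qed

text \<open>The epimorphism doubling every element of a chain forces the middle one of three
  consecutive related points to lie in two fibres at once.\<close>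

lemma R_class_le_2:
  assumes "(t, s) \<in> Rrel F" "(t, w) \<in> Rrel F"
  shows "s = t \<or> w = t \<or> s = w"
proof (rule ccontr)
  assume "\<not> ?thesis"
  then have ne: "s \<noteq> t" "w \<noteq> t" "s \<noteq> w" by auto
  have S: "s \<in> S" "t \<in> S" "w \<in> S"
    using R_in assms by auto
  obtain f where f: "proj f" "inj_on f {s, t, w}"
  proof (rule separate_finite[of "{s, t, w}" "\<lambda>_. ()"])
    show "lc (\<lambda>_. ())" by (rule lc_const)
  qed (use S in auto)
  obtain g where g: "proj g" "\<And>s. s \<in> S \<Longrightarrow> f s = (fst (g s), snd (g s) div 2)"
    using doubling[OF f(1)] by blast
  have "cadj (g t) (g s)" "cadj (g t) (g w)"
    using assms hom_R[OF proj_hom[OF g(1)]] by blast+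
  moreover have "f s \<noteq> f t" "f w \<noteq> f t" "f s \<noteq> f w"
    using f(2) ne by (auto simp: inj_on_def)
  ultimately have *: "snd (g s) div 2 \<noteq> snd (g t) div 2" "snd (g w) div 2 \<noteq> snd (g t) div 2"
      "snd (g s) div 2 \<noteq> snd (g w) div 2" "snd (g s) \<le> Suc (snd (g t))" "snd (g t) \<le> Suc (snd (g s))"
      "snd (g w) \<le> Suc (snd (g t))" "snd (g t) \<le> Suc (snd (g w))"
    using g(2) S by (auto simp: cadj_def)
  \<comment> \<open>With \<open>b\<close> the height of \<open>g t\<close>: a neighbouring height in
    a different pair of copies lies below \<open>b\<close> if \<open>b\<close> is even and above it
    if \<open>b\<close> is odd. So \<open>s\<close> and \<open>w\<close> get the same
    \<open>f\<close>-value.\<close>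
  have "a div 2 = (if even b then b div 2 - 1 else Suc (b div 2))"
    if "a div 2 \<noteq> b div 2" "a \<le> Suc b" "b \<le> Suc a" for a b :: nat
  proof -
    have "a = b - 1 \<or> a = b \<or> a = Suc b"
      using that by linarith
    then show ?thesis
      using that by (cases "even b") (auto elim!: evenE oddE)
  qed
  from this[OF *(1,4,5)] this[OF *(2,6,7)] *(3) show False
    by simp
qed

lemma R_trans: "(s, t) \<in> Rrel F \<Longrightarrow> (t, w) \<in> Rrel F \<Longrightarrow> (s, w) \<in> Rrel F"
  using R_class_le_2[of t s w] R_sym[of s t] R_refl[of s] R_in[of s t] by blast

lemma equiv_R: "equiv S (Rrel F)"
  by (intro equivI R_sub refl_onI symI transI) (fact R_refl R_sym R_trans)+

end

section \<open>Strands: the preimages of the components\<close>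

context fraisse_limit
begin

text \<open>The quasi-component read off from finite quotients: column preimages are clopen and
  saturated under \<open>Rrel F\<close>. That it is the full preimage of a component is
  \<open>component_eq_strand\<close>.\<close>

definition strand :: "'a \<Rightarrow> 'a set" where
  "strand s = {t \<in> S. \<forall>f. proj f \<longrightarrow> fst (f t) = fst (f s)}"

lemma S_nonempty: "S \<noteq> {}"
proof -
  have "column_set {(0, 0)}"
    by (auto simp: column_set_def)
  then obtain \<phi> where "epimorphism F (relabel prod_encode (chains {(0, 0)})) \<phi>"
    using limit_onto[OF hasse_forest_relabel_chains[OF _ inj_prod_encode]] by blast
  then have "\<phi> ` S = prod_encode ` {(0, 0)}"
    by (auto simp: epimorphism_def)
  then show ?thesis
    by auto
qed

lemma proj_exists: "\<exists>f. proj f"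
proof -
  have "lc (\<lambda>_. ())" by (rule lc_const)
  then show ?thesis
    using refine by blast
qed

text \<open>Elements of one column are comparable, and comparability passes to the coarser
  map.\<close>

lemma finer_fst:
  assumes "proj g" "hom f" "finer g f" "s \<in> S" "t \<in> S" "fst (g s) = fst (g t)"
  shows "fst (f s) = fst (f t)"
proof -
  have "cle (g s) (g t) \<or> cle (g t) (g s)"
    by (rule cle_linear) (rule assms(6))
  then have "cle (f s) (f t) \<or> cle (f t) (f s)"
    using finer_cle[OF assms(1-5)] finer_cle[OF assms(1-3,5,4)] by blast
  then show ?thesis
    by (auto simp: cle_def)
qed

lemma strand_sub: "strand s \<subseteq> S"
  by (auto simp: strand_def)

lemma strand_self: "s \<in> S \<Longrightarrow> s \<in> strand s"
  by (simp add: strand_def)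

lemma strand_eq: "t \<in> strand s \<Longrightarrow> strand t = strand s"
  by (auto simp: strand_def)

lemma strand_hom:
  assumes "hom f" "s \<in> S" "t \<in> strand s"
  shows "fst (f t) = fst (f s)"
proof -
  obtain g where g: "proj g" "finer g f"
    using refine[OF hom_lc[OF assms(1)]] by blast
  then have "fst (g t) = fst (g s)" "t \<in> S"
    using assms(3) by (auto simp: strand_def)
  then show ?thesis
    using finer_fst[OF g(1) assms(1) g(2)] assms(2) by blast
qed

lemma R_strand: "(s, t) \<in> Rrel F \<Longrightarrow> t \<in> strand s"
  using R_in[of s t] hom_R_fst[OF proj_hom, of _ s t] unfolding strand_def by fastforce

lemma L_strand: "(s, t) \<in> Leq F \<Longrightarrow> t \<in> strand s"
  using L_in[of s t] hom_L_fst[OF proj_hom, of _ s t] unfolding strand_def by fastforce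

lemma strand_linear:
  assumes "t \<in> strand s" "w \<in> strand s"
  shows "(t, w) \<in> Leq F \<or> (w, t) \<in> Leq F"
proof (rule ccontr)
  assume h: "\<not> ?thesis"
  have S: "t \<in> S" "w \<in> S"
    using assms strand_sub by auto
  obtain f where f: "proj f" "\<not> cle (f t) (f w)"
    using h L_iff[OF S] by blast
  obtain g where g: "proj g" "\<not> cle (g w) (g t)"
    using h L_iff[OF S(2,1)] by blast
  obtain k where k: "proj k" "finer k f" "finer k g"
    using refine2[OF proj_lc[OF f(1)] proj_lc[OF g(1)]] by blast
  have "fst (k t) = fst (k w)"
    using assms k(1) by (simp add: strand_def)
  then have "cle (k t) (k w) \<or> cle (k w) (k t)"
    by (rule cle_linear)
  then show False
    using finer_cle[OF k(1) proj_hom[OF f(1)] k(2) S] finer_cle[OF k(1) proj_hom[OF g(1)] k(3) S(2,1)]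
      f(2) g(2) by blast
qed

text \<open>The strand is an intersection of clopen column preimages, which are directed under
  refinement; compactness puts one of them inside \<open>V\<close>.\<close>

lemma strand_nbhd:
  assumes V: "openin (Top F) V" "strand s \<subseteq> V" and s: "s \<in> S" and q: "lc q"
  obtains h where "proj h" "finer h q" "{w \<in> S. fst (h w) = fst (h s)} \<subseteq> V"
proof -
  have "\<exists>g. proj g \<and> fst (g w) \<noteq> fst (g s)" if "w \<in> S - V" for w
    using that V(2) by (auto simp: strand_def)
  then obtain g where g: "\<And>w. w \<in> S - V \<Longrightarrow> proj (g w) \<and> fst (g w w) \<noteq> fst (g w s)"
    by metis
  \<comment> \<open>\<open>D w\<close> consists of the points that the map chosen for
    \<open>w\<close> puts in another column than \<open>s\<close>. It contains \<open>w\<close>, so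
    these sets and \<open>V\<close> cover the space.\<close>
  define D where "D = (\<lambda>w. {z \<in> S. fst (g w z) \<noteq> fst (g w s)})"
  let ?U = "insert V (D ` (S - V))"
  have "openin (Top F) (D w)" if "w \<in> S - V" for w
  proof -
    have "lc (g w)"
      using g[OF that] proj_lc by blast
    then show ?thesis
      unfolding D_def by (rule lc_openin)
  qed
  moreover have "S \<subseteq> \<Union>?U"
    using g by (auto simp: D_def)
  ultimately have "\<exists>\<F>. finite \<F> \<and> \<F> \<subseteq> ?U \<and> S \<subseteq> \<Union>\<F>"
    using compact_F[unfolded compact_space_alt, rule_format, of ?U] V(1) by blast
  then obtain \<F> where \<F>: "finite \<F>" "\<F> \<subseteq> ?U" "S \<subseteq> \<Union>\<F>"
    by blast
  then have "finite (\<F> - {V})" "\<F> - {V} \<subseteq> D ` (S - V)"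
    by auto
  then obtain W where W: "W \<subseteq> S - V" "finite W" "\<F> - {V} = D ` W"
    by (meson finite_subset_image)
  have "lc (\<lambda>z. restrict (\<lambda>w. g w z) W)"
    by (rule lc_family[OF W(2)]) (use g W(1) proj_lc in blast)
  then obtain h where h: "proj h" "finer h q" "finer h (\<lambda>z. restrict (\<lambda>w. g w z) W)"
    using refine2[OF q] by blast
  have "z \<in> V" if z: "z \<in> S" "fst (h z) = fst (h s)" for z
  proof (rule ccontr)
    assume "z \<notin> V"
    then obtain U where U: "U \<in> \<F> - {V}" "z \<in> U"
      using \<F>(3) z(1) by blast
    then have "U \<in> D ` W"
      using W(3) by simp
    then obtain w where w: "w \<in> W" "fst (g w z) \<noteq> fst (g w s)"
      using U(2) unfolding D_def by blast
    have "hom (g w)"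
      using g w(1) W(1) proj_hom by blast
    then show False
      using finer_fst[OF h(1) _ finer_family[OF h(3) w(1)] z(1) s z(2)] w(2) by blast
  qed
  then show thesis
    using that[OF h(1,2)] by blast
qed

section \<open>Intermediate values and jumps on a strand\<close>

lemma proj_down:
  assumes "proj h" "s \<in> S" "h s = (c, j)" "i \<le> j"
  obtains w where "w \<in> S" "h w = (c, i)"
proof -
  have "(c, j) \<in> h ` S"
    using assms(2,3) by (metis imageI)
  then have "(c, i) \<in> h ` S"
    using column_set_down[of "h ` S" c j i] assms(1,4) unfolding proj_def by blast
  then show thesis
    using that by auto
qed

text \<open>Along an \<open>h\<close>-column, one step at a time, \<open>f\<close> moves between
  adjacent values, so its height cannot skip \<open>m\<close>.\<close>

lemma discrete_ivt:
  assumes h: "proj h" and f: "hom f" and hf: "finer h f" and s: "s \<in> S" "h s = (c, i)" and ij: "i \<le> j"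
  shows "t \<in> S \<Longrightarrow> h t = (c, j) \<Longrightarrow> snd (f s) \<le> m \<Longrightarrow> m \<le> snd (f t) \<Longrightarrow>
    \<exists>w\<in>S. fst (h w) = c \<and> snd (f w) = m"
  using ij
proof (induction j arbitrary: t rule: dec_induct)
  case base
  then have "f t = f s"
    using finerD[OF hf base(1) s(1)] s(2) by simp
  then show ?case
    using base s by (intro bexI[of _ s]) auto
next
  case (step n)
  obtain t' where t': "t' \<in> S" "h t' = (c, n)"
    using proj_down[OF h step(4,5)] by (metis le_SucI order_refl)
  have "cadj (f t') (f t)"
    by (rule finer_cadj[OF h f hf t'(1) step(4)]) (simp add: t' step(5) cadj_def)
  then have le: "snd (f t) \<le> Suc (snd (f t'))"
    by (simp add: cadj_def)
  show ?case
  proof (cases "m \<le> snd (f t')")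
    case True
    then show ?thesis
      using step.IH t' step.prems by blast
  next
    case False
    then have "m = snd (f t)"
      using le step.prems by simp
    then show ?thesis
      using step.prems by (intro bexI[of _ t]) auto
  qed
qed

text \<open>If the strand missed the value, \<open>strand_nbhd\<close> would give a whole column of
  a finer map missing it, against the discrete version.\<close>

lemma strand_ivt:
  assumes f: "hom f" and s: "s \<in> S" and t: "t \<in> strand s" and m: "snd (f s) \<le> m" "m \<le> snd (f t)"
  obtains w where "w \<in> strand s" "f w = (fst (f s), m)"
proof (rule ccontr)
  assume "\<not> thesis"
  then have none: "\<And>w. w \<in> strand s \<Longrightarrow> f w \<noteq> (fst (f s), m)"
    using that by blast
  let ?V = "{w \<in> S. f w \<noteq> (fst (f s), m)}"
  have "openin (Top F) ?V"
    by (rule lc_openin[OF hom_lc[OF f]])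
  moreover have "strand s \<subseteq> ?V"
    using none strand_sub by blast
  ultimately obtain h where h: "proj h" "finer h f" "{w \<in> S. fst (h w) = fst (h s)} \<subseteq> ?V"
    using strand_nbhd[OF _ _ s hom_lc[OF f]] by blast
  have tS: "t \<in> S"
    using t strand_sub by blast
  have fst: "fst (h t) = fst (h s)"
    using strand_hom[OF proj_hom[OF h(1)] s t] .
  obtain c i j where hs: "h s = (c, i)" and ht: "h t = (c, j)"
    using fst by (metis prod.collapse)
  have "\<exists>w\<in>S. fst (h w) = c \<and> snd (f w) = m"
  proof (cases "i \<le> j")
    case True
    then show ?thesis
      using discrete_ivt[OF h(1) f h(2) s hs True tS ht m] by blast
  next
    case False
    \<comment> \<open>If \<open>h\<close> places \<open>t\<close> below \<open>s\<close>,
      monotonicity leaves the height of \<open>s\<close> itself as the only possible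
      \<open>m\<close>.\<close>
    then have "cle (f t) (f s)"
      by (intro finer_cle[OF h(1) f h(2) tS s]) (simp add: hs ht cle_def)
    then have "snd (f s) = m"
      using m by (simp add: cle_def)
    then show ?thesis
      using s hs by (intro bexI[of _ s]) auto
  qed
  then obtain w where w: "w \<in> S" "fst (h w) = fst (h s)" "snd (f w) = m"
    using hs by auto
  then have "fst (f w) = fst (f s)"
    using finer_fst[OF h(1) f h(2) w(1) s] by blast
  then have "f w = (fst (f s), m)"
    using w(3) by (simp add: prod_eq_iff)
  then show False
    using h(3) w by blast
qed

lemma strand_cle:
  assumes "hom f" "t \<in> strand s" "w \<in> strand s" "snd (f t) < snd (f w)"
  shows "(t, w) \<in> Leq F"
proof -
  have "\<not> cle (f w) (f t)"
    using assms(4) by (simp add: cle_def)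
  then show ?thesis
    using strand_linear[OF assms(2,3)] hom_L[OF assms(1)] by blast
qed

text \<open>If some map placed \<open>s\<close> and \<open>t\<close> more than one step apart, an
  intermediate value would be taken by a point strictly between them.\<close>

lemma strand_jump:
  assumes st: "(s, t) \<in> Leq F"
    and jump: "\<And>w. (s, w) \<in> Leq F \<Longrightarrow> (w, t) \<in> Leq F \<Longrightarrow> w = s \<or> w = t"
  shows "(s, t) \<in> Rrel F"
proof -
  have S: "s \<in> S" "t \<in> S"
    using L_in[OF st] by auto
  have t: "t \<in> strand s"
    by (rule L_strand[OF st])
  have "cadj (f s) (f t)" if f: "proj f" for f
  proof (rule ccontr)
    assume na: "\<not> cadj (f s) (f t)"
    have le: "cle (f s) (f t)"
      using hom_L[OF proj_hom[OF f] st] .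
    then have lt: "Suc (snd (f s)) < snd (f t)"
      using na by (simp add: cle_def cadj_def)
    obtain w where w: "w \<in> strand s" "f w = (fst (f s), Suc (snd (f s)))"
      by (rule strand_ivt[OF proj_hom[OF f] S(1) t, of "Suc (snd (f s))"]) (use lt in auto)
    have "(s, w) \<in> Leq F"
      by (rule strand_cle[OF proj_hom[OF f] strand_self[OF S(1)] w(1)]) (simp add: w(2))
    moreover have "(w, t) \<in> Leq F"
      by (rule strand_cle[OF proj_hom[OF f] w(1) t]) (simp add: w(2) lt)
    ultimately have "w = s \<or> w = t"
      by (rule jump)
    then have "snd (f w) = snd (f s) \<or> snd (f w) = snd (f t)"
      by auto
    then show False
      using lt unfolding w(2) by simp
  qed
  then show ?thesis
    using R_iff[OF S] by blast
qed

text \<open>Converse to \<open>strand_jump\<close>: a map injective on the three points would have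
  to fit three distinct heights within one step.\<close>

lemma R_convex:
  assumes st: "(s, t) \<in> Rrel F" and sw: "(s, w) \<in> Leq F" and wt: "(w, t) \<in> Leq F"
  shows "w = s \<or> w = t"
proof (rule ccontr)
  assume ne: "\<not> ?thesis"
  have S: "s \<in> S" "t \<in> S" "w \<in> S"
    using R_in[OF st] L_in[OF sw] by auto
  obtain f where f: "proj f" "inj_on f {s, w, t}"
  proof (rule separate_finite[of "{s, w, t}" "\<lambda>_. ()"])
    show "lc (\<lambda>_. ())" by (rule lc_const)
  qed (use S in auto)
  have "f w \<noteq> f s" "f w \<noteq> f t"
    using f(2) ne by (auto simp: inj_on_def)
  moreover have "cle (f s) (f w)" "cle (f w) (f t)" "cadj (f s) (f t)"
    using hom_L[OF proj_hom[OF f(1)]] hom_R[OF proj_hom[OF f(1)]] sw wt st by blast+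
  ultimately show False
    by (auto simp: cle_def cadj_def prod_eq_iff)
qed

section \<open>Extrema of closed subsets and crossings between levels\<close>

lemma closedin_L_above: "s \<in> S \<Longrightarrow> closedin (Top F) {w \<in> S. (s, w) \<in> Leq F}"
proof -
  assume s: "s \<in> S"
  let ?C = "(\<lambda>f. {w \<in> S. cle (f s) (f w)}) ` {f. proj f}"
  have "{w \<in> S. (s, w) \<in> Leq F} = \<Inter>?C"
    using L_iff[OF s] proj_exists by auto
  moreover have "closedin (Top F) (\<Inter>?C)"
  proof (rule closedin_Inter)
    show "?C \<noteq> {}" using proj_exists by blast
    fix C assume "C \<in> ?C"
    then obtain f where "proj f" "C = {w \<in> S. cle (f s) (f w)}" by blast
    then show "closedin (Top F) C"
      using lc_closedin[OF proj_lc, of f "cle (f s)"] by simp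
  qed
  ultimately show ?thesis by simp
qed

lemma closedin_L_below: "s \<in> S \<Longrightarrow> closedin (Top F) {w \<in> S. (w, s) \<in> Leq F}"
proof -
  assume s: "s \<in> S"
  let ?C = "(\<lambda>f. {w \<in> S. cle (f w) (f s)}) ` {f. proj f}"
  have "{w \<in> S. (w, s) \<in> Leq F} = \<Inter>?C"
    using L_iff[OF _ s] proj_exists by auto
  moreover have "closedin (Top F) (\<Inter>?C)"
  proof (rule closedin_Inter)
    show "?C \<noteq> {}" using proj_exists by blast
    fix C assume "C \<in> ?C"
    then obtain f where "proj f" "C = {w \<in> S. cle (f w) (f s)}" by blast
    then show "closedin (Top F) C"
      using lc_closedin[OF proj_lc, of f "\<lambda>a. cle a (f s)"] by simp
  qed
  ultimately show ?thesis by simp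
qed

lemma closedin_strand: "closedin (Top F) (strand s)"
proof -
  let ?C = "(\<lambda>f. {w \<in> S. fst (f w) = fst (f s)}) ` {f. proj f}"
  have "strand s = \<Inter>?C"
    using proj_exists by (auto simp: strand_def)
  moreover have "closedin (Top F) (\<Inter>?C)"
  proof (rule closedin_Inter)
    show "?C \<noteq> {}" using proj_exists by blast
    fix C assume "C \<in> ?C"
    then obtain f where "proj f" "C = {w \<in> S. fst (f w) = fst (f s)}" by blast
    then show "closedin (Top F) C"
      using lc_closedin[OF proj_lc, of f "\<lambda>a. fst a = fst (f s)"] by simp
  qed
  ultimately show ?thesis by simp
qed

text \<open>The sets of upper bounds within \<open>Z\<close> of single points have the finite
  intersection property, because finite sets have greatest elements; compactness yields a common
  upper bound in \<open>Z\<close>. With \<open>Q\<close> left arbitrary, the converse order gives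
  minima.\<close>

lemma closed_linear_has_max:
  assumes Z: "closedin (Top F) Z" "Z \<noteq> {}"
    and lin: "\<And>s t. s \<in> Z \<Longrightarrow> t \<in> Z \<Longrightarrow> (s, t) \<in> Q \<or> (t, s) \<in> Q"
    and tr: "\<And>s t w. (s, t) \<in> Q \<Longrightarrow> (t, w) \<in> Q \<Longrightarrow> (s, w) \<in> Q"
    and cl: "\<And>s. s \<in> Z \<Longrightarrow> closedin (Top F) {w \<in> S. (s, w) \<in> Q}"
  shows "\<exists>m\<in>Z. \<forall>z\<in>Z. (z, m) \<in> Q"
proof -
  have fin: "\<exists>m\<in>A. \<forall>z\<in>A. (z, m) \<in> Q" if "finite A" "A \<noteq> {}" "A \<subseteq> Z" for A
    using that
  proof (induction A rule: finite_ne_induct)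
    case (singleton x)
    then show ?case using lin[of x x] by auto
  next
    case (insert x A)
    then obtain m where m: "m \<in> A" "\<forall>z\<in>A. (z, m) \<in> Q" by auto
    have "(x, m) \<in> Q \<or> (m, x) \<in> Q" "(x, x) \<in> Q"
      using lin[of x m] lin[of x x] m insert.prems by auto
    then show ?case
    proof (elim disjE)
      assume "(x, m) \<in> Q"
      then show ?thesis using m by auto
    next
      assume mx: "(m, x) \<in> Q" and xx: "(x, x) \<in> Q"
      have "(z, x) \<in> Q" if "z \<in> A" for z
        using tr[OF _ mx] m that by blast
      then show ?thesis using xx by auto
    qed
  qed
  let ?D = "\<lambda>z. Z \<inter> {w \<in> S. (z, w) \<in> Q}"
  have "\<forall>C\<in>?D ` Z. closedin (Top F) C"
    using cl Z(1) by auto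
  moreover have "\<Inter>\<F> \<noteq> {}" if F: "finite \<F>" "\<F> \<subseteq> ?D ` Z" for \<F>
  proof (cases "\<F> = {}")
    case True
    then show ?thesis by simp
  next
    case False
    obtain A where A: "A \<subseteq> Z" "finite A" "\<F> = ?D ` A"
      using F by (meson finite_subset_image)
    then obtain m where m: "m \<in> A" "\<forall>z\<in>A. (z, m) \<in> Q"
      using fin[of A] False by auto
    have "m \<in> S" "m \<in> Z"
      using closedin_subset[OF Z(1)] m A by auto
    then have "m \<in> \<Inter>\<F>"
      using m A(3) by auto
    then show ?thesis by blast
  qed
  ultimately have "\<Inter>(?D ` Z) \<noteq> {}"
    using compact_F[unfolded compact_space_fip, rule_format, of "?D ` Z"] by blast
  then obtain m where "m \<in> \<Inter>(?D ` Z)"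
    by blast
  then show ?thesis
    using Z(2) by blast
qed

lemma strand_has_max:
  assumes Z: "closedin (Top F) Z" "Z \<noteq> {}" "Z \<subseteq> strand s"
  obtains m where "m \<in> Z" "\<And>z. z \<in> Z \<Longrightarrow> (z, m) \<in> Leq F"
proof -
  have "\<exists>m\<in>Z. \<forall>z\<in>Z. (z, m) \<in> Leq F"
  proof (rule closed_linear_has_max[OF Z(1,2)])
    show "(s, t) \<in> Leq F \<or> (t, s) \<in> Leq F" if "s \<in> Z" "t \<in> Z" for s t
      using strand_linear that Z(3) by blast
    show "closedin (Top F) {w \<in> S. (z, w) \<in> Leq F}" if "z \<in> Z" for z
      using closedin_L_above that Z(3) strand_sub by blast
  qed (rule L_trans)
  then show thesis
    using that by blast
qed

lemma strand_has_min:
  assumes Z: "closedin (Top F) Z" "Z \<noteq> {}" "Z \<subseteq> strand s"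
  obtains m where "m \<in> Z" "\<And>z. z \<in> Z \<Longrightarrow> (m, z) \<in> Leq F"
proof -
  have "\<exists>m\<in>Z. \<forall>z\<in>Z. (z, m) \<in> (Leq F)\<inverse>"
  proof (rule closed_linear_has_max[OF Z(1,2)])
    show "(s, t) \<in> (Leq F)\<inverse> \<or> (t, s) \<in> (Leq F)\<inverse>" if "s \<in> Z" "t \<in> Z" for s t
      using strand_linear that Z(3) by blast
    show "closedin (Top F) {w \<in> S. (z, w) \<in> (Leq F)\<inverse>}" if "z \<in> Z" for z
      using closedin_L_below that Z(3) strand_sub by auto
    show "(s, w) \<in> (Leq F)\<inverse>" if "(s, t) \<in> (Leq F)\<inverse>" "(t, w) \<in> (Leq F)\<inverse>" for s t w
      using L_trans that by blast
  qed
  then show thesis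
    using that by blast
qed

text \<open>Let \<open>m1\<close> be the last point of the strand at height at most \<open>i\<close>
  and \<open>m2\<close> the first one above. Nothing lies strictly between them, so they are
  related.\<close>

lemma strand_crossing:
  assumes f: "hom f" and a: "a \<in> S" and w: "w1 \<in> strand a" "f w1 = (c, i)" "w2 \<in> strand a" "f w2 = (c, Suc i)"
  obtains m1 m2 where "m1 \<in> strand a" "m2 \<in> strand a" "(m1, m2) \<in> Rrel F" "f m1 = (c, i)" "f m2 = (c, Suc i)"
proof -
  have fc: "fst (f z) = c" if "z \<in> strand a" for z
    using strand_hom[OF f a that] strand_hom[OF f a w(1)] w(2) by simp
  let ?Z1 = "strand a \<inter> {z \<in> S. snd (f z) \<le> i}" and ?Z2 = "strand a \<inter> {z \<in> S. Suc i \<le> snd (f z)}"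
  have "closedin (Top F) ?Z1" "closedin (Top F) ?Z2"
    by (intro closedin_Int closedin_strand lc_closedin[OF hom_lc[OF f]])+
  moreover have wz: "w1 \<in> ?Z1" "w2 \<in> ?Z2"
    using w strand_sub by auto
  ultimately have Z: "closedin (Top F) ?Z1" "?Z1 \<noteq> {}" "closedin (Top F) ?Z2" "?Z2 \<noteq> {}"
    by blast+
  obtain m1 where m1: "m1 \<in> ?Z1" "\<And>z. z \<in> ?Z1 \<Longrightarrow> (z, m1) \<in> Leq F"
    by (rule strand_has_max[OF Z(1,2) Int_lower1]) blast
  obtain m2 where m2: "m2 \<in> ?Z2" "\<And>z. z \<in> ?Z2 \<Longrightarrow> (m2, z) \<in> Leq F"
    by (rule strand_has_min[OF Z(3,4) Int_lower1]) blast
  have "cle (f w1) (f m1)" "cle (f m2) (f w2)"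
    using hom_L[OF f] m1(2)[OF wz(1)] m2(2)[OF wz(2)] by blast+
  then have "snd (f m1) = i" "snd (f m2) = Suc i"
    using m1(1) m2(1) w(2,4) by (auto simp: cle_def)
  moreover have "fst (f m1) = c" "fst (f m2) = c"
    using fc m1(1) m2(1) by auto
  ultimately have fm: "f m1 = (c, i)" "f m2 = (c, Suc i)"
    by (simp_all add: prod_eq_iff)
  have m12: "(m1, m2) \<in> Leq F"
    by (rule strand_cle[OF f, of m1 a m2]) (use m1 m2 fm in auto)
  have "(m1, m2) \<in> Rrel F"
  proof (rule strand_jump[OF m12])
    fix z assume z: "(m1, z) \<in> Leq F" "(z, m2) \<in> Leq F"
    have "z \<in> strand m1" "strand m1 = strand a"
      using L_strand[OF z(1)] strand_eq[of m1 a] m1(1) by auto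
    then have "z \<in> ?Z1 \<or> z \<in> ?Z2"
      using strand_sub by auto
    then show "z = m1 \<or> z = m2"
      using m1(2) m2(2) z L_antisym by blast
  qed
  then show thesis
    using that[of m1 m2] m1(1) m2(1) fm by blast
qed

section \<open>Recognising epimorphisms onto chains\<close>

text \<open>A strand that runs from bottom to top of a column takes every value in it, which
  realises the order, and crosses each edge at a related pair, which realises adjacency. All
  epimorphisms built by hand below are verified through this criterion.\<close>

lemma hom_imp_proj:
  assumes f: "hom f"
    and full: "\<And>s. s \<in> S \<Longrightarrow> \<exists>a b. (a, b) \<in> Leq F \<and> fst (f a) = fst (f s) \<and> snd (f a) = 0 \<and>
      (\<forall>t\<in>S. fst (f t) = fst (f s) \<longrightarrow> snd (f t) \<le> snd (f b))"
  shows "proj f"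
proof -
  have wit: "\<exists>a\<in>S. \<forall>c i. c = fst (f s) \<and> (\<exists>t\<in>S. f t = (c, j) \<and> i \<le> j) \<longrightarrow> (\<exists>w\<in>strand a. f w = (c, i))"
    if s: "s \<in> S" for s j
  proof -
    obtain a b where ab: "(a, b) \<in> Leq F" "fst (f a) = fst (f s)" "snd (f a) = 0"
        and top: "\<And>t. t \<in> S \<Longrightarrow> fst (f t) = fst (f s) \<Longrightarrow> snd (f t) \<le> snd (f b)"
      using full[OF s] by blast
    have a: "a \<in> S" and b: "b \<in> strand a"
      using L_in[OF ab(1)] L_strand[OF ab(1)] by auto
    have "\<exists>w\<in>strand a. f w = (c, i)" if "c = fst (f s)" "t \<in> S" "f t = (c, j)" "i \<le> j" for c i t
    proof -
      have "i \<le> snd (f b)"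
        using top[of t] that by simp
      then obtain w where "w \<in> strand a" "f w = (fst (f a), i)"
        by (rule strand_ivt[OF f a b _, rotated]) (simp_all add: ab(3))
      then show ?thesis
        using ab(2) that(1) by auto
    qed
    then show ?thesis
      using a by blast
  qed
  have two: "\<exists>a\<in>S. \<exists>w1\<in>strand a. \<exists>w2\<in>strand a. f w1 = f s \<and> f w2 = f t"
    if st: "s \<in> S" "t \<in> S" "fst (f s) = fst (f t)" "snd (f s) \<le> snd (f t)" for s t
  proof -
    obtain a where a: "a \<in> S" "\<And>c i. c = fst (f s) \<Longrightarrow> (\<exists>u\<in>S. f u = (c, snd (f t)) \<and> i \<le> snd (f t)) \<Longrightarrow>
        (\<exists>w\<in>strand a. f w = (c, i))"
      using wit[OF st(1), of "snd (f t)"] by blast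
    have "\<exists>u\<in>S. f u = (fst (f s), snd (f t))"
      using st by (intro bexI[of _ t]) (auto simp: prod_eq_iff)
    then have "\<exists>w\<in>strand a. f w = (fst (f s), snd (f s))" "\<exists>w\<in>strand a. f w = (fst (f s), snd (f t))"
      using a(2)[of "fst (f s)" "snd (f s)"] a(2)[of "fst (f s)" "snd (f t)"] st(4) by auto
    then show ?thesis
      using a(1) st(3) by (metis prod.collapse)
  qed
  have lc: "lc f"
    by (rule hom_lc[OF f])
  have cont: "continuous_map (Top F) (discrete_topology (f ` S)) f"
    unfolding continuous_map_def using lc_openin[OF lc, of "\<lambda>a. a \<in> U" for U] by auto
  have col: "column_set (f ` S)"
    unfolding column_set_def
  proof (intro conjI allI impI)
    show "finite (f ` S)" "f ` S \<noteq> {}"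
      using lc_finite_image[OF lc] S_nonempty by auto
    fix c i j assume "(c, j) \<in> f ` S \<and> i \<le> j"
    then obtain t where t: "t \<in> S" "f t = (c, j)" "i \<le> j" by auto
    then obtain a w where "a \<in> S" "w \<in> strand a" "f w = (c, i)"
      using wit[OF t(1), of j] by (metis fst_conv)
    then show "(c, i) \<in> f ` S"
      using strand_sub by (metis imageI subsetD)
  qed
  have R1: "map_prod f f ` Rrel F \<subseteq> {(a, b) \<in> f ` S \<times> f ` S. cadj a b}"
    using hom_R[OF f] R_in by fastforce
  have L1: "map_prod f f ` Leq F \<subseteq> {(a, b) \<in> f ` S \<times> f ` S. cle a b}"
    using hom_L[OF f] L_in by fastforce
  have R2: "(f s, f t) \<in> map_prod f f ` Rrel F" if st: "s \<in> S" "t \<in> S" "cadj (f s) (f t)" for s t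
  proof -
    have le: "(f s, f t) \<in> map_prod f f ` Rrel F \<and> (f t, f s) \<in> map_prod f f ` Rrel F"
      if st: "s \<in> S" "t \<in> S" "cadj (f s) (f t)" "snd (f s) \<le> snd (f t)" for s t
    proof -
      obtain a w1 w2 where w: "a \<in> S" "w1 \<in> strand a" "w2 \<in> strand a" "f w1 = f s" "f w2 = f t"
        using two[OF st(1,2) _ st(4)] st(3) by (auto simp: cadj_def)
      have "\<exists>m1 m2. (m1, m2) \<in> Rrel F \<and> f m1 = f s \<and> f m2 = f t"
      proof (cases "snd (f s) = snd (f t)")
        case True
        then have "f s = f t"
          using st(3) by (simp add: cadj_def prod_eq_iff)
        then show ?thesis
          using R_refl[OF st(1)] by metis
      next
        case False
        then have "f s = (fst (f s), snd (f s))" "f t = (fst (f s), Suc (snd (f s)))"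
          using st(3,4) by (auto simp: cadj_def prod_eq_iff)
        then show ?thesis
          using strand_crossing[OF f w(1,2) _ w(3), of "fst (f s)" "snd (f s)"] w(4,5) by metis
      qed
      then obtain m1 m2 where m: "(m1, m2) \<in> Rrel F" "f m1 = f s" "f m2 = f t"
        by blast
      then show ?thesis
        using R_sym[OF m(1)] by (metis map_prod_imageI)
    qed
    show ?thesis
    proof (cases "snd (f s) \<le> snd (f t)")
      case True
      then show ?thesis using le[OF st] by blast
    next
      case False
      then show ?thesis using le[OF st(2,1) cadj_sym[OF st(3)]] by simp
    qed
  qed
  have L2: "(f s, f t) \<in> map_prod f f ` Leq F" if st: "s \<in> S" "t \<in> S" "cle (f s) (f t)" for s t
  proof -
    obtain a w1 w2 where w: "a \<in> S" "w1 \<in> strand a" "w2 \<in> strand a" "f w1 = f s" "f w2 = f t"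
      using two[OF st(1,2)] st(3) by (auto simp: cle_def)
    show ?thesis
    proof (cases "(w1, w2) \<in> Leq F")
      case True
      then show ?thesis
        using w(4,5) by (metis map_prod_imageI)
    next
      case False
      then have "cle (f w2) (f w1)"
        using strand_linear[OF w(2,3)] hom_L[OF f] by blast
      then have "f s = f t"
        using st(3) w(4,5) cle_antisym by metis
      then show ?thesis
        using L_refl[OF st(1)] by (metis map_prod_imageI)
    qed
  qed
  have "{(a, b) \<in> f ` S \<times> f ` S. cadj a b} = map_prod f f ` Rrel F"
    using R1 R2 by blast
  moreover have "{(a, b) \<in> f ` S \<times> f ` S. cle a b} = map_prod f f ` Leq F"
    using L1 L2 by blast
  ultimately have "epimorphism F (chains (f ` S)) f"
    using cont by (simp add: epimorphism_def)
  then show ?thesis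
    using col by (simp add: proj_def)
qed

text \<open>Bottom and top of a column are comparable, so they lift to a comparable pair. Together
  with \<open>hom_imp_proj\<close> this characterises epimorphisms by full strands.\<close>

lemma proj_full:
  assumes f: "proj f" and s: "s \<in> S"
  obtains a b where "(a, b) \<in> Leq F" "fst (f a) = fst (f s)" "snd (f a) = 0"
    "\<And>t. t \<in> S \<Longrightarrow> fst (f t) = fst (f s) \<Longrightarrow> snd (f t) \<le> snd (f b)"
proof -
  have X: "column_set (f ` S)"
    using f by (simp add: proj_def)
  have "fst (f s) \<in> fst ` f ` S"
    using s by blast
  then obtain n where n: "\<And>i. (fst (f s), i) \<in> f ` S \<longleftrightarrow> i \<le> n"
    by (rule column_set_top[OF X]) blast
  have "(fst (f s), 0) \<in> f ` S" "(fst (f s), n) \<in> f ` S"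
    using n by auto
  then obtain a' b' where ab': "a' \<in> S" "b' \<in> S" "f a' = (fst (f s), 0)" "f b' = (fst (f s), n)"
    by auto
  then have "cle (f a') (f b')"
    by (simp add: cle_def)
  then obtain a b where ab: "(a, b) \<in> Leq F" "f a = f a'" "f b = f b'"
    by (rule proj_L_onto[OF f ab'(1,2)])
  show thesis
  proof (rule that[OF ab(1)])
    show "fst (f a) = fst (f s)" "snd (f a) = 0"
      using ab ab' by auto
    fix t assume t: "t \<in> S" "fst (f t) = fst (f s)"
    then have "(fst (f s), snd (f t)) \<in> f ` S"
      by (metis imageI prod.collapse)
    then show "snd (f t) \<le> snd (f b)"
      using n ab ab' by simp
  qed
qed

end

section \<open>Components and endpoints of the fence\<close>

context fraisse_limit
begin

abbreviation p :: "'a \<Rightarrow> 'a set" where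
  "p \<equiv> class_map (Rrel F)"

definition ends :: "'a \<Rightarrow> 'a set" where
  "ends s = {m \<in> strand s. (\<forall>w\<in>strand s. (m, w) \<in> Leq F) \<or> (\<forall>w\<in>strand s. (w, m) \<in> Leq F)}"

lemma topspace_fence: "topspace (fence_space F) = p ` S"
  by (auto simp: fence_space_def quotient_def class_map_def)

lemma quotient_p: "quotient_map (Top F) (fence_space F) p"
  by (simp add: fence_space_def quotient_map_class_map)

lemma continuous_p: "continuous_map (Top F) (fence_space F) p"
  using quotient_p by (rule quotient_imp_continuous_map)

lemma p_eq_iff: "s \<in> S \<Longrightarrow> t \<in> S \<Longrightarrow> p s = p t \<longleftrightarrow> (s, t) \<in> Rrel F"
  unfolding class_map_def by (rule eq_equiv_class_iff[OF equiv_R])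

lemma p_in_iff: "t \<in> p s \<longleftrightarrow> (s, t) \<in> Rrel F"
  by (simp add: class_map_def)

text \<open>Let \<open>m\<close> be the last point between \<open>a\<close> and \<open>b\<close>
  mapped into \<open>E1\<close>, and \<open>t\<close> the first point from \<open>m\<close> on
  mapped into \<open>E2\<close>. They are consecutive, hence in one class, and the image of that
  class lies in both closed sets.\<close>

lemma no_separation:
  assumes s: "s \<in> S" and C: "C \<subseteq> strand s"
    and convex: "\<And>a b w. a \<in> C \<Longrightarrow> b \<in> C \<Longrightarrow> (a, w) \<in> Leq F \<Longrightarrow> (w, b) \<in> Leq F \<Longrightarrow> w \<in> C"
    and E: "closedin (fence_space F) E1" "closedin (fence_space F) E2" "p ` C \<subseteq> E1 \<union> E2"
      "E1 \<inter> E2 \<inter> p ` C = {}"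
    and ab: "a \<in> C" "p a \<in> E1" "b \<in> C" "p b \<in> E2" "(a, b) \<in> Leq F"
  shows False
proof -
  have abS: "a \<in> S" "b \<in> S"
    using L_in[OF ab(5)] by auto
  \<comment> \<open>\<open>C\<close> may fail to be closed, so extrema are taken in the order
    interval from \<open>a\<close> to \<open>b\<close>, which is closed and contained in
    \<open>C\<close> by convexity.\<close>
  let ?Z1 = "strand s \<inter> ({w \<in> S. p w \<in> E1} \<inter> ({w \<in> S. (a, w) \<in> Leq F} \<inter> {w \<in> S. (w, b) \<in> Leq F}))"
  have "closedin (Top F) ?Z1"
    by (intro closedin_Int closedin_strand closedin_L_above closedin_L_below abS
        closedin_continuous_map_preimage[OF continuous_p] E)
  moreover have "a \<in> ?Z1"
    using ab C abS L_refl by auto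
  ultimately obtain m where m: "m \<in> ?Z1" "\<And>z. z \<in> ?Z1 \<Longrightarrow> (z, m) \<in> Leq F"
    using strand_has_max[of ?Z1 s] by blast
  have mS: "m \<in> S"
    using m(1) by blast
  let ?Z2 = "strand s \<inter> ({w \<in> S. p w \<in> E2} \<inter> ({w \<in> S. (m, w) \<in> Leq F} \<inter> {w \<in> S. (w, b) \<in> Leq F}))"
  have "closedin (Top F) ?Z2"
    by (intro closedin_Int closedin_strand closedin_L_above closedin_L_below abS mS
        closedin_continuous_map_preimage[OF continuous_p] E)
  moreover have "b \<in> ?Z2"
    using ab C abS L_refl m(1) by auto
  ultimately obtain t where t: "t \<in> ?Z2" "\<And>z. z \<in> ?Z2 \<Longrightarrow> (t, z) \<in> Leq F"
    using strand_has_min[of ?Z2 s] by blast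
  have mt: "(m, t) \<in> Leq F" and am: "(a, m) \<in> Leq F" and mb: "(m, b) \<in> Leq F"
    and tb: "(t, b) \<in> Leq F"
    using m(1) t(1) by auto
  have "(m, t) \<in> Rrel F"
  proof (rule strand_jump[OF mt])
    fix w assume mw: "(m, w) \<in> Leq F" and wt: "(w, t) \<in> Leq F"
    have aw: "(a, w) \<in> Leq F" and wb: "(w, b) \<in> Leq F"
      using L_trans[OF am mw] L_trans[OF wt tb] by auto
    have wC: "w \<in> C"
      by (rule convex[OF ab(1,3) aw wb])
    then have wS: "w \<in> strand s" "w \<in> S"
      using C strand_sub by auto
    have "p w \<in> E1 \<or> p w \<in> E2"
      using E(3) wC by auto
    then show "w = m \<or> w = t"
    proof
      assume "p w \<in> E1"
      then have "(w, m) \<in> Leq F"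
        using m(2) aw wb wS by blast
      then show ?thesis using L_antisym mw by blast
    next
      assume "p w \<in> E2"
      then have "(t, w) \<in> Leq F"
        using t(2) mw wb wS by blast
      then show ?thesis using L_antisym wt by blast
    qed
  qed
  then have "p m = p t"
    using p_eq_iff R_in by blast
  moreover have "m \<in> C"
    by (rule convex[OF ab(1,3) am mb])
  ultimately show False
    using E(4) m(1) t(1) by auto
qed

lemma convex_connected:
  assumes s: "s \<in> S" and C: "C \<subseteq> strand s"
    and convex: "\<And>a b w. a \<in> C \<Longrightarrow> b \<in> C \<Longrightarrow> (a, w) \<in> Leq F \<Longrightarrow> (w, b) \<in> Leq F \<Longrightarrow> w \<in> C"
  shows "connectedin (fence_space F) (p ` C)"
  unfolding connectedin_closedin
proof (intro conjI notI)
  show "p ` C \<subseteq> topspace (fence_space F)"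
    using C strand_sub topspace_fence by auto
  assume "\<exists>E1 E2. closedin (fence_space F) E1 \<and> closedin (fence_space F) E2 \<and>
      p ` C \<subseteq> E1 \<union> E2 \<and> E1 \<inter> E2 \<inter> p ` C = {} \<and> E1 \<inter> p ` C \<noteq> {} \<and> E2 \<inter> p ` C \<noteq> {}"
  then obtain E1 E2 where E: "closedin (fence_space F) E1" "closedin (fence_space F) E2"
      "p ` C \<subseteq> E1 \<union> E2" "E1 \<inter> E2 \<inter> p ` C = {}" "E1 \<inter> p ` C \<noteq> {}" "E2 \<inter> p ` C \<noteq> {}"
    by blast
  obtain a where a: "a \<in> C" "p a \<in> E1" using E(5) by auto
  obtain b where b: "b \<in> C" "p b \<in> E2" using E(6) by auto
  have "(a, b) \<in> Leq F \<or> (b, a) \<in> Leq F"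
    using strand_linear a b C by blast
  then show False
  proof
    assume ab: "(a, b) \<in> Leq F"
    show False
      by (rule no_separation[OF s C convex E(1-4) a b ab])
  next
    assume ba: "(b, a) \<in> Leq F"
    have E': "p ` C \<subseteq> E2 \<union> E1" "E2 \<inter> E1 \<inter> p ` C = {}"
      using E(3,4) by (simp_all add: Un_commute Int_commute)
    show False
      by (rule no_separation[OF s C convex E(2,1) E' b a ba])
  qed
qed

text \<open>A strand is convex, so its image is connected. Conversely, a column preimage is a clopen
  union of classes, and its image is a clopen set that a component cannot leave.\<close>

lemma component_eq_strand:
  assumes J: "J \<in> connected_components_of (fence_space F)" and s: "s \<in> S" "p s \<in> J"
  shows "J = p ` strand s"
proof
  show "p ` strand s \<subseteq> J"
  proof (rule connected_components_of_maximal[OF J])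
    show "connectedin (fence_space F) (p ` strand s)"
    proof (rule convex_connected[OF s(1) order_refl])
      show "w \<in> strand s" if "a \<in> strand s" "(a, w) \<in> Leq F" for a w
        using L_strand[OF that(2)] strand_eq[OF that(1)] by simp
    qed
    show "\<not> disjnt J (p ` strand s)"
      using s strand_self by (auto simp: disjnt_iff)
  qed
  show "J \<subseteq> p ` strand s"
  proof
    fix y assume y: "y \<in> J"
    have con: "connectedin (fence_space F) J"
      using J connectedin_connected_components_of by blast
    then have "y \<in> p ` S"
      using y connectedin_subset_topspace topspace_fence by blast
    then obtain t where t: "t \<in> S" "y = p t" by blast
    have "fst (f t) = fst (f s)" if f: "proj f" for f
    proof -
      let ?W = "{w \<in> S. fst (f w) = fst (f s)}"
      \<comment> \<open>Related points share a column, so the column preimage is a union of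
        classes.\<close>
      have pre: "{w \<in> S. p w \<in> p ` ?W} = ?W"
      proof
        show "{w \<in> S. p w \<in> p ` ?W} \<subseteq> ?W"
        proof
          fix w assume "w \<in> {w \<in> S. p w \<in> p ` ?W}"
          then obtain u where "w \<in> S" "u \<in> ?W" "p w = p u" by auto
          then have "(w, u) \<in> Rrel F" using p_eq_iff by blast
          then show "w \<in> ?W"
            using hom_R_fst[OF proj_hom[OF f]] \<open>u \<in> ?W\<close> \<open>w \<in> S\<close> by auto
        qed
      qed auto
      have sub: "p ` ?W \<subseteq> topspace (fence_space F)"
        using topspace_fence by auto
      have op: "openin (fence_space F) (p ` ?W)"
        using quotient_p[unfolded quotient_map_def, THEN conjunct2, rule_format, OF sub]
          lc_openin[OF proj_lc[OF f], of "\<lambda>a. fst a = fst (f s)"] unfolding pre by (rule iffD1)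
      have cl: "closedin (fence_space F) (p ` ?W)"
        using quotient_p[unfolded quotient_map_closedin, THEN conjunct2, rule_format, OF sub]
          lc_closedin[OF proj_lc[OF f], of "\<lambda>a. fst a = fst (f s)"] unfolding pre by (rule iffD1)
      have "J \<subseteq> p ` ?W \<or> disjnt J (p ` ?W)"
        by (rule connectedin_clopen_cases[OF con cl op])
      moreover have "p s \<in> p ` ?W"
        using s by blast
      ultimately have "p t \<in> p ` ?W"
        using s(2) y t by (auto simp: disjnt_iff)
      then have "t \<in> ?W"
        using pre t(1) by blast
      then show ?thesis by simp
    qed
    then show "y \<in> p ` strand s"
      using t by (auto simp: strand_def)
  qed
qed

text \<open>Removing the class of an extremal point leaves a convex part of the strand, with
  connected image; removing an inner point of an arc disconnects it.\<close>

lemma ends_not_interior: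
  assumes arc: "is_arc (fence_space F) (p ` strand v)" and v: "v \<in> S"
    and ne: "\<not> arc_endpoint (fence_space F) (p ` strand v) (p v)" and m: "m \<in> ends v"
  shows "(v, m) \<notin> Rrel F"
proof
  assume vm: "(v, m) \<in> Rrel F"
  let ?J = "p ` strand v" and ?C = "strand v - p m"
  have mv: "m \<in> strand v" and mS: "m \<in> S"
    using m strand_sub by (auto simp: ends_def)
  have "connectedin (fence_space F) (p ` ?C)"
  proof (rule convex_connected[OF v])
    fix a b w assume a: "a \<in> ?C" and b: "b \<in> ?C" and aw: "(a, w) \<in> Leq F" and wb: "(w, b) \<in> Leq F"
    have w: "w \<in> strand v"
      using L_strand[OF aw] strand_eq[of a v] a by simp
    have "w \<notin> p m"
    proof
      assume "w \<in> p m"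
      then have mw: "(m, w) \<in> Rrel F" by (simp add: p_in_iff)
      \<comment> \<open>An extremum lies outside \<open>a\<close> or outside \<open>b\<close>, so
        \<open>a\<close> or \<open>b\<close> would be caught between the related points
        \<open>m\<close> and \<open>w\<close>.\<close>
      consider "(m, a) \<in> Leq F" | "(b, m) \<in> Leq F"
        using m a b by (auto simp: ends_def)
      then show False
      proof cases
        case 1
        then have "a = m \<or> a = w"
          using R_convex[OF mw _ aw] by blast
        then show False
          using a mw R_refl[OF mS] by (auto simp: p_in_iff)
      next
        case 2
        then have "b = m \<or> b = w"
          using R_convex[OF R_sym[OF mw] wb] by blast
        then show False
          using b mw R_refl[OF mS] by (auto simp: p_in_iff)
      qed
    qed
    then show "w \<in> ?C" using w by blast
  qed auto
  moreover have "p ` ?C = ?J - {p v}"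
  proof -
    have "p w = p v \<longleftrightarrow> w \<in> p m" if "w \<in> strand v" for w
    proof -
      have "w \<in> S" using that strand_sub by blast
      then have "p w = p v \<longleftrightarrow> p m = p w"
        using p_eq_iff[OF v mS] vm by metis
      then show ?thesis
        using p_eq_iff[OF mS \<open>w \<in> S\<close>] p_in_iff by blast
    qed
    then show ?thesis by blast
  qed
  ultimately have con: "connectedin (fence_space F) (?J - {p v})"
    by simp
  have "top_of_set {0..1::real} homeomorphic_space subtopology (fence_space F) ?J"
    using arc unfolding is_arc_def by (subst homeomorphic_space_sym) (rule conjunct2)
  then obtain g where g: "homeomorphic_map (top_of_set {0..1::real}) (subtopology (fence_space F) ?J) g"
    unfolding homeomorphic_space by blast
  have Jsub: "?J \<subseteq> topspace (fence_space F)"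
    using arc unfolding is_arc_def by (rule conjunct1)
  have img: "g ` {0..1} = ?J" and inj: "inj_on g {0..1}"
    using homeomorphic_imp_surjective_map[OF g] homeomorphic_imp_injective_map[OF g] Jsub
    by (simp_all add: Int_absorb1)
  have "p v \<in> ?J"
    using strand_self[OF v] by blast
  then obtain t where t: "t \<in> {0..1}" "p v = g t"
    using img by (metis imageE)
  have "t \<noteq> 0" "t \<noteq> 1"
    using ne t(2) g unfolding arc_endpoint_def by auto
  then have t01: "0 < t" "t < 1"
    using t(1) by auto
  have "g ` ({0..1} - {t}) = ?J - {p v}"
    using inj_on_image_set_diff[OF inj, of "{0..1}" "{t}"] img t by auto
  then have "connectedin (subtopology (fence_space F) ?J) (g ` ({0..1} - {t}))"
    using con by (auto simp: connectedin_subtopology)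
  then have "connectedin (top_of_set {0..1::real}) ({0..1} - {t})"
    using homeomorphic_map_connectedness[OF g, of "{0..1} - {t}"] by auto
  then have "connected ({0..1} - {t})"
    by (simp add: connectedin_subtopology)
  then have "t \<in> {0..1} - {t}"
    by (rule connectedD_interval[of _ 0 1]) (use t01 in auto)
  then show False by blast
qed

lemma singleton_strand:
  assumes "is_singleton (p ` strand v)" "v \<in> S"
  shows "strand v = p v"
proof -
  obtain y where y: "p ` strand v = {y}"
    using assms(1) by (auto simp: is_singleton_def)
  then have "p w = p v" if "w \<in> strand v" for w
    using that strand_self[OF assms(2)] by blast
  then have "strand v \<subseteq> p v"
    using p_eq_iff[OF assms(2)] strand_sub p_in_iff by blast
  then show ?thesis
    using R_strand p_in_iff by blast
qed

lemma ends_cases: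
  assumes "s \<in> S"
  obtains b t where "b \<in> strand s" "t \<in> strand s" "\<And>w. w \<in> strand s \<Longrightarrow> (b, w) \<in> Leq F"
    "\<And>w. w \<in> strand s \<Longrightarrow> (w, t) \<in> Leq F" "ends s = {b, t}"
proof -
  have ne: "strand s \<noteq> {}"
    using strand_self assms by blast
  obtain b where b: "b \<in> strand s" "\<And>w. w \<in> strand s \<Longrightarrow> (b, w) \<in> Leq F"
    using strand_has_min[OF closedin_strand ne order_refl] by blast
  obtain t where t: "t \<in> strand s" "\<And>w. w \<in> strand s \<Longrightarrow> (w, t) \<in> Leq F"
    using strand_has_max[OF closedin_strand ne order_refl] by blast
  have "ends s = {b, t}"
    using b t L_antisym unfolding ends_def by blast
  then show thesis
    using that b t by blast
qed

end

section \<open>Marked strands and epimorphisms adapted to them\<close>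

text \<open>The monotone map is built greedily, climbing whenever the constraint permits it; every level of
  \<open>a\<close> has enough free edges for the climb to be completed before \<open>a\<close> moves on.\<close>

lemma greedy_climb:
  fixes a \<beta> :: "nat \<Rightarrow> nat"
  assumes a: "\<And>m. m < n \<Longrightarrow> a m \<le> a (Suc m) \<and> a (Suc m) \<le> Suc (a m)"
    and \<beta>: "\<And>j. j < q \<Longrightarrow> \<beta> j \<le> \<beta> (Suc j) \<and> \<beta> (Suc j) \<le> Suc (\<beta> j)"
    and ends: "a 0 = \<beta> 0" "a n = \<beta> q"
    and E: "\<And>e. e \<in> E \<Longrightarrow> e < n \<Longrightarrow> a (Suc e) = a e"
    and large: "\<And>m. m \<le> n \<Longrightarrow> q \<le> card {e. e < n \<and> e \<notin> E \<and> a e = a m \<and> a (Suc e) = a m}"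
  obtains H where "H 0 = 0" "H n = q" "\<And>m. m < n \<Longrightarrow> H m \<le> H (Suc m) \<and> H (Suc m) \<le> Suc (H m)"
    "\<And>e. e \<in> E \<Longrightarrow> e < n \<Longrightarrow> H (Suc e) = H e" "\<And>m. m \<le> n \<Longrightarrow> \<beta> (H m) = a m \<and> H m \<le> q"
proof -
  define H where "H = rec_nat 0 (\<lambda>m h. if m \<notin> E \<and> h < q \<and> \<beta> (Suc h) = a (Suc m) then Suc h else h)"
  have H0: "H 0 = 0"
    by (simp add: H_def)
  have HS: "H (Suc m) = (if m \<notin> E \<and> H m < q \<and> \<beta> (Suc (H m)) = a (Suc m) then Suc (H m) else H m)" for m
    by (simp add: H_def)
  have amono: "a i \<le> a j" if "i \<le> j" "j \<le> n" for i j
    using that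
  proof (induction j rule: dec_induct)
    case (step j)
    then show ?case using a[of j] by auto
  qed simp
  have \<beta>mono: "\<beta> i \<le> \<beta> j" if "i \<le> j" "j \<le> q" for i j
    using that
  proof (induction j rule: dec_induct)
    case (step j)
    then show ?case using \<beta>[of j] by auto
  qed simp
  \<comment> \<open>The number of free edges already passed at the current level of
    \<open>a\<close>. When the level is about to end, it is at least \<open>q\<close>.\<close>
  define cnt where "cnt m = card {e. e < m \<and> e \<notin> E \<and> a e = a m \<and> a (Suc e) = a m}" for m
  have full: "q \<le> cnt m" if m: "m \<le> n" "m = n \<or> a (Suc m) \<noteq> a m" for m
  proof -
    have "e < m" if "e < n" "a e = a m" "a (Suc e) = a m" for e
    proof (rule ccontr)
      assume "\<not> e < m"
      then have "m < n" "a (Suc m) \<le> a (Suc e)" "a m \<le> a (Suc m)"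
        using that m amono[of "Suc m" "Suc e"] amono[of m "Suc m"] by auto
      then show False
        using m that by auto
    qed
    then have "{e. e < n \<and> e \<notin> E \<and> a e = a m \<and> a (Suc e) = a m} \<subseteq>
        {e. e < m \<and> e \<notin> E \<and> a e = a m \<and> a (Suc e) = a m}"
      by blast
    then have "card {e. e < n \<and> e \<notin> E \<and> a e = a m \<and> a (Suc e) = a m} \<le> cnt m"
      unfolding cnt_def by (intro card_mono) auto
    then show ?thesis
      using large[OF m(1)] by linarith
  qed
  \<comment> \<open>As long as a further climb inside the level is possible, every free edge passed
    there has been used for climbing, so \<open>cnt m \<le> H m\<close>. At the end of a level
    \<open>q \<le> cnt m\<close>, so by then the climb inside it is complete.\<close>
  have inv: "m \<le> n \<Longrightarrow> H m \<le> q \<and> \<beta> (H m) = a m \<and> (H m < q \<and> \<beta> (Suc (H m)) = a m \<longrightarrow> cnt m \<le> H m)" for m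
  proof (induction m)
    case 0
    then show ?case using H0 ends by (simp add: cnt_def)
  next
    case (Suc m)
    then have m: "m < n" and IH: "H m \<le> q" "\<beta> (H m) = a m"
        "H m < q \<and> \<beta> (Suc (H m)) = a m \<longrightarrow> cnt m \<le> H m"
      by auto
    show ?case
    proof (cases "a (Suc m) = a m")
      case True
      have sets: "{e. e < Suc m \<and> e \<notin> E \<and> a e = a (Suc m) \<and> a (Suc e) = a (Suc m)} =
          (if m \<in> E then {} else {m}) \<union> {e. e < m \<and> e \<notin> E \<and> a e = a m \<and> a (Suc e) = a m}"
        using True by (auto simp: less_Suc_eq)
      have cnt: "cnt (Suc m) \<le> (if m \<in> E then cnt m else Suc (cnt m))"
        unfolding cnt_def sets using card_insert_le_m1[of 1] by (auto simp: card_insert_if)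
      show ?thesis
      proof (cases "m \<notin> E \<and> H m < q \<and> \<beta> (Suc (H m)) = a (Suc m)")
        case adv: True
        then have "cnt m \<le> H m" using IH True by simp
        then show ?thesis using adv HS[of m] cnt by (auto split: if_splits)
      next
        case False
        then have "H (Suc m) = H m" using HS[of m] by simp
        then show ?thesis using False IH True cnt by (auto split: if_splits)
      qed
    next
      case False
      then have up: "a (Suc m) = Suc (a m)"
        using a[OF m] by auto
      have "m \<notin> E"
        using E[of m] m False by blast
      have "q \<le> cnt m"
        by (rule full) (use m False in auto)
      then have no: "\<not> (H m < q \<and> \<beta> (Suc (H m)) = a m)"
        using IH(3) by auto
      \<comment> \<open>At \<open>q\<close> the value of \<open>a\<close> would already be its last
        one, yet it still rises.\<close>
      have "H m \<noteq> q"
      proof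
        assume "H m = q"
        then have "a m = a n"
          using IH ends by simp
        then show False
          using amono[of "Suc m" n] m up by simp
      qed
      then have lt: "H m < q"
        using IH by simp
      then have "\<beta> (Suc (H m)) = a (Suc m)"
        using no \<beta>[OF lt] IH(2) up by auto
      then have HSm: "H (Suc m) = Suc (H m)"
        using HS[of m] \<open>m \<notin> E\<close> lt by simp
      have "cnt (Suc m) = 0"
      proof -
        have "{e. e < Suc m \<and> e \<notin> E \<and> a e = a (Suc m) \<and> a (Suc e) = a (Suc m)} = {}"
        proof -
          have "a e \<noteq> a (Suc m)" if "e < Suc m" for e
            using amono[of e m] that m up by simp
          then show ?thesis by auto
        qed
        then show ?thesis by (simp add: cnt_def)
      qed
      then show ?thesis
        using HSm lt \<open>\<beta> (Suc (H m)) = a (Suc m)\<close> by simp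
    qed
  qed
  have "H n = q"
  proof (rule ccontr)
    assume "H n \<noteq> q"
    then have lt: "H n < q" and "\<beta> (H n) = a n" and no: "\<beta> (Suc (H n)) = a n \<longrightarrow> cnt n \<le> H n"
      using inv[of n] by auto
    moreover have "\<beta> (Suc (H n)) = a n"
      using \<beta>mono[of "H n" "Suc (H n)"] \<beta>mono[of "Suc (H n)" q] lt ends \<open>\<beta> (H n) = a n\<close> by simp
    ultimately have "q \<le> H n"
      using full[of n] by simp
    then show False using lt by simp
  qed
  then show thesis
    using that[of H] H0 HS inv by simp
qed

text \<open>To prescribe the value \<open>b\<close> at \<open>d\<close>, two greedy climbs are glued
  at \<open>d\<close>: one upwards, and one reflected and running downwards. This is why free edges
  are counted on each side of \<open>d\<close> separately.\<close>

lemma monotone_lift: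
  fixes a \<beta> :: "nat \<Rightarrow> nat"
  assumes a: "\<And>m. m < n \<Longrightarrow> a m \<le> a (Suc m) \<and> a (Suc m) \<le> Suc (a m)"
    and \<beta>: "\<And>j. j < q \<Longrightarrow> \<beta> j \<le> \<beta> (Suc j) \<and> \<beta> (Suc j) \<le> Suc (\<beta> j)"
    and ends: "a 0 = \<beta> 0" "a n = \<beta> q"
    and E: "\<And>e. e \<in> E \<Longrightarrow> e < n \<Longrightarrow> a (Suc e) = a e"
    and d: "d \<le> n" and b: "b \<le> q" and db: "a d = \<beta> b"
    and up: "\<And>m. d \<le> m \<Longrightarrow> m \<le> n \<Longrightarrow>
      q \<le> card {e. d \<le> e \<and> e < n \<and> e \<notin> E \<and> a e = a m \<and> a (Suc e) = a m}"
    and down: "\<And>m. m \<le> d \<Longrightarrow> q \<le> card {e. e < d \<and> e \<notin> E \<and> a e = a m \<and> a (Suc e) = a m}"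
  obtains H where "H 0 = 0" "H n = q" "\<And>m. m < n \<Longrightarrow> H m \<le> H (Suc m) \<and> H (Suc m) \<le> Suc (H m)"
    "\<And>e. e \<in> E \<Longrightarrow> e < n \<Longrightarrow> H (Suc e) = H e" "\<And>m. m \<le> n \<Longrightarrow> \<beta> (H m) = a m \<and> H m \<le> q" "H d = b"
proof -
  have amono: "a i \<le> a j" if "i \<le> j" "j \<le> n" for i j
    using that
  proof (induction j rule: dec_induct)
    case (step j)
    then show ?case using a[of j] by auto
  qed simp
  have \<beta>mono: "\<beta> i \<le> \<beta> j" if "i \<le> j" "j \<le> q" for i j
    using that
  proof (induction j rule: dec_induct)
    case (step j)
    then show ?case using \<beta>[of j] by auto
  qed simp
  obtain U where U: "U 0 = 0" "U (n - d) = q - b"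
    "\<And>m. m < n - d \<Longrightarrow> U m \<le> U (Suc m) \<and> U (Suc m) \<le> Suc (U m)"
    "\<And>e. e \<in> {e. d + e \<in> E} \<Longrightarrow> e < n - d \<Longrightarrow> U (Suc e) = U e"
    "\<And>m. m \<le> n - d \<Longrightarrow> \<beta> (b + U m) = a (d + m) \<and> U m \<le> q - b"
  proof (rule greedy_climb[of "n - d" "\<lambda>m. a (d + m)" "q - b" "\<lambda>j. \<beta> (b + j)" "{e. d + e \<in> E}"])
    show "q - b \<le> card {e. e < n - d \<and> e \<notin> {e. d + e \<in> E} \<and> a (d + e) = a (d + m) \<and> a (d + Suc e) = a (d + m)}"
      if m: "m \<le> n - d" for m
    proof -
      let ?A = "{e. d \<le> e \<and> e < n \<and> e \<notin> E \<and> a e = a (d + m) \<and> a (Suc e) = a (d + m)}"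
      have "q \<le> card ?A"
        using up[of "d + m"] m d by simp
      also have "card ?A \<le> card {e. e < n - d \<and> e \<notin> {e. d + e \<in> E} \<and> a (d + e) = a (d + m) \<and> a (d + Suc e) = a (d + m)}"
      proof (rule card_inj_on_le[where f = "\<lambda>e. e - d"])
        show "inj_on (\<lambda>e. e - d) ?A"
          by (auto simp: inj_on_def)
      qed auto
      finally show ?thesis by simp
    qed
  qed (use a \<beta> ends E d b db in auto)
  \<comment> \<open>Read downwards from \<open>d\<close>, the lower half is again a climb. Heights
    are measured as the drop below \<open>a d\<close>, and the edge at \<open>e\<close> becomes the
    edge at \<open>d - Suc e\<close>.\<close>
  obtain D where D: "D 0 = 0" "D d = b"
    "\<And>m. m < d \<Longrightarrow> D m \<le> D (Suc m) \<and> D (Suc m) \<le> Suc (D m)"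
    "\<And>e. e \<in> {e. d - Suc e \<in> E} \<Longrightarrow> e < d \<Longrightarrow> D (Suc e) = D e"
    "\<And>m. m \<le> d \<Longrightarrow> a d - \<beta> (b - D m) = a d - a (d - m) \<and> D m \<le> b"
  proof (rule greedy_climb[of d "\<lambda>m. a d - a (d - m)" b "\<lambda>j. a d - \<beta> (b - j)" "{e. d - Suc e \<in> E}"])
    fix m assume m: "m < d"
    then have "a (d - Suc m) \<le> a (d - m) \<and> a (d - m) \<le> Suc (a (d - Suc m))"
      using a[of "d - Suc m"] d by (simp add: Suc_diff_Suc)
    then show "a d - a (d - m) \<le> a d - a (d - Suc m) \<and> a d - a (d - Suc m) \<le> Suc (a d - a (d - m))"
      by linarith
  next
    fix j assume j: "j < b"
    then have "\<beta> (b - Suc j) \<le> \<beta> (b - j) \<and> \<beta> (b - j) \<le> Suc (\<beta> (b - Suc j))"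
      using \<beta>[of "b - Suc j"] b by (simp add: Suc_diff_Suc)
    then show "a d - \<beta> (b - j) \<le> a d - \<beta> (b - Suc j) \<and> a d - \<beta> (b - Suc j) \<le> Suc (a d - \<beta> (b - j))"
      by linarith
  next
    fix e assume e: "e \<in> {e. d - Suc e \<in> E}" "e < d"
    then have "a (d - e) = a (d - Suc e)"
      using E[of "d - Suc e"] d by (simp add: Suc_diff_Suc)
    then show "a d - a (d - Suc e) = a d - a (d - e)"
      by simp
  next
    fix m assume m: "m \<le> d"
    let ?A = "{e. e < d \<and> e \<notin> E \<and> a e = a (d - m) \<and> a (Suc e) = a (d - m)}"
    let ?B = "{e. e < d \<and> e \<notin> {e. d - Suc e \<in> E} \<and> a d - a (d - e) = a d - a (d - m) \<and>
        a d - a (d - Suc e) = a d - a (d - m)}"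
    have "q \<le> card ?A"
      using down[of "d - m"] by simp
    also have "card ?A \<le> card ?B"
    proof (rule card_inj_on_le[where f = "\<lambda>e. d - Suc e"])
      show "inj_on (\<lambda>e. d - Suc e) ?A"
        by (auto simp: inj_on_def)
      show "(\<lambda>e. d - Suc e) ` ?A \<subseteq> ?B"
        by (auto simp: Suc_diff_Suc)
    qed auto
    finally show "b \<le> card ?B"
      using b by simp
  qed (use ends db in auto)
  \<comment> \<open>All heights involved are at most \<open>a d\<close>, so equal truncated
    differences mean equal heights.\<close>
  have D\<beta>: "\<beta> (b - D m) = a (d - m) \<and> D m \<le> b" if "m \<le> d" for m
  proof -
    have "\<beta> (b - D m) \<le> a d" "a (d - m) \<le> a d"
      using \<beta>mono[of "b - D m" b] amono[of "d - m" d] b d db by auto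
    then show ?thesis
      using D(5)[OF that] by linarith
  qed
  define H where "H m = (if m \<le> d then b - D (d - m) else b + U (m - d))" for m
  have low: "H m = b - D (d - m)" if "m \<le> d" for m
    using that by (simp add: H_def)
  have high: "H m = b + U (m - d)" if "d \<le> m" for m
    using that D(1) U(1) by (auto simp: H_def)
  show thesis
  proof (rule that[of H])
    show "H 0 = 0" "H n = q" "H d = b"
      using low[of 0] high[of n] low[of d] D U b d by auto
    fix m
    show "H m \<le> H (Suc m) \<and> H (Suc m) \<le> Suc (H m)" if "m < n"
    proof (cases "d \<le> m")
      case True
      then show ?thesis
        using high[of m] high[of "Suc m"] U(3)[of "m - d"] that by (simp add: Suc_diff_le)
    next
      case False
      then have "d - m = Suc (d - Suc m)" "d - Suc m < d"
        by auto
      then have "D (d - Suc m) \<le> D (d - m)" "D (d - m) \<le> Suc (D (d - Suc m))"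
        using D(3)[of "d - Suc m"] by simp_all
      then show ?thesis
        using low[of m] low[of "Suc m"] False by simp linarith
    qed
    show "H (Suc m) = H m" if "m \<in> E" "m < n"
    proof (cases "d \<le> m")
      case True
      then show ?thesis
        using high[of m] high[of "Suc m"] U(4)[of "m - d"] that by (simp add: Suc_diff_le)
    next
      case False
      then have *: "d - m = Suc (d - Suc m)" "d - Suc m < d" "d - Suc (d - Suc m) = m"
        by auto
      then have "D (Suc (d - Suc m)) = D (d - Suc m)"
        using D(4)[of "d - Suc m"] that by simp
      then show ?thesis
        using low[of m] low[of "Suc m"] * False by simp
    qed
    show "\<beta> (H m) = a m \<and> H m \<le> q" if "m \<le> n"
    proof (cases "d \<le> m")
      case True
      then show ?thesis
        using high[of m] U(5)[of "m - d"] that b by simp linarith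
    next
      case False
      then show ?thesis
        using low[of m] D\<beta>[of "d - m"] b by auto
    qed
  qed
qed

context fraisse_limit
begin

text \<open>\<open>I\<close> indexes all chosen components and \<open>K\<close> those that are arcs.
  The clauses on \<open>K\<close> and on \<open>I - K\<close> translate, in the limit, being no
  endpoint of an arc and lying in a one-point component.\<close>

definition marked :: "nat set \<Rightarrow> nat set \<Rightarrow> (nat \<Rightarrow> 'a) \<Rightarrow> bool" where
  "marked I K v \<longleftrightarrow> finite I \<and> K \<subseteq> I \<and> (\<forall>i\<in>I. v i \<in> S) \<and>
     (\<forall>i\<in>I. \<forall>j\<in>I. i \<noteq> j \<longrightarrow> v j \<notin> strand (v i)) \<and>
     (\<forall>i\<in>K. \<forall>m\<in>ends (v i). (v i, m) \<notin> Rrel F) \<and>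
     (\<forall>i\<in>I - K. strand (v i) = p (v i))"

definition special :: "nat set \<Rightarrow> (nat \<Rightarrow> 'a) \<Rightarrow> 'a set" where
  "special I v = (\<Union>i\<in>I. Rrel F `` insert (v i) (ends (v i)))"

text \<open>The value type is arbitrary so that the notion also covers membership in a clopen
  set.\<close>

definition collapse :: "nat set \<Rightarrow> (nat \<Rightarrow> 'a) \<Rightarrow> ('a \<Rightarrow> 'q) \<Rightarrow> bool" where
  "collapse I v f \<longleftrightarrow> (\<forall>(s, t)\<in>Rrel F. s \<in> special I v \<longrightarrow> f s = f t)"

text \<open>If the marked strand fills its column, every value in the column is represented on the
  strand, so a map constructed along the strand is defined on the whole column.\<close>

definition pregood :: "nat set \<Rightarrow> (nat \<Rightarrow> 'a) \<Rightarrow> ('a \<Rightarrow> nat \<times> nat) \<Rightarrow> bool" where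
  "pregood I v f \<longleftrightarrow> proj f \<and>
     (\<forall>i\<in>I. \<forall>s\<in>S. fst (f s) = fst (f (v i)) \<longrightarrow> f s \<in> f ` strand (v i)) \<and>
     (\<forall>i\<in>I. \<forall>j\<in>I. fst (f (v i)) = fst (f (v j)) \<longrightarrow> i = j)"

lemma pregood_proj: "pregood I v f \<Longrightarrow> proj f"
  by (simp add: pregood_def)

lemma pregood_full:
  assumes "pregood I v f" "i \<in> I" "s \<in> S" "fst (f s) = fst (f (v i))"
  shows "f s \<in> f ` strand (v i)"
  using assms(1)[unfolded pregood_def, THEN conjunct2, THEN conjunct1, rule_format, OF assms(2-4)] .

lemma pregood_inj:
  assumes "pregood I v f" "i \<in> I" "j \<in> I" "fst (f (v i)) = fst (f (v j))"
  shows "i = j"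
  using assms(1)[unfolded pregood_def, THEN conjunct2, THEN conjunct2, rule_format, OF assms(2-4)] .

lemma collapseD: "collapse I v f \<Longrightarrow> (s, t) \<in> Rrel F \<Longrightarrow> s \<in> special I v \<Longrightarrow> f s = f t"
  unfolding collapse_def by blast

lemma collapseI: "(\<And>s t. (s, t) \<in> Rrel F \<Longrightarrow> s \<in> special I v \<Longrightarrow> f s = f t) \<Longrightarrow> collapse I v f"
  unfolding collapse_def by blast

lemma special_R: "s \<in> special I v \<Longrightarrow> (s, t) \<in> Rrel F \<Longrightarrow> t \<in> special I v"
  unfolding special_def using R_trans by blast

lemma ends_sub: "ends s \<subseteq> strand s"
  by (auto simp: ends_def)

lemma finite_class: "finite (Rrel F `` {s})"
proof (cases "\<exists>t. (s, t) \<in> Rrel F \<and> t \<noteq> s")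
  case True
  then obtain t where "(s, t) \<in> Rrel F" "t \<noteq> s" by blast
  then have "Rrel F `` {s} \<subseteq> {s, t}"
    using R_class_le_2[of s t] by blast
  then show ?thesis
    by (rule finite_subset) simp
next
  case False
  then have "Rrel F `` {s} \<subseteq> {s}" by blast
  then show ?thesis
    by (rule finite_subset) simp
qed

lemma special_in:
  assumes "marked I K v"
  shows "special I v \<subseteq> (\<Union>i\<in>I. strand (v i))"
proof
  fix s assume "s \<in> special I v"
  then obtain i m where i: "i \<in> I" "m \<in> insert (v i) (ends (v i))" "(m, s) \<in> Rrel F"
    unfolding special_def by blast
  have "v i \<in> S"
    using assms i(1) by (simp add: marked_def)
  then have "m \<in> strand (v i)"
    using i(2) strand_self ends_sub by blast
  then show "s \<in> (\<Union>i\<in>I. strand (v i))"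
    using R_strand[OF i(3)] strand_eq[of m "v i"] i(1) by blast
qed

lemma finite_special:
  assumes "marked I K v"
  shows "finite (special I v)"
proof -
  have "finite (Rrel F `` insert (v i) (ends (v i)))" if "i \<in> I" for i
  proof -
    have "v i \<in> S"
      using assms that by (simp add: marked_def)
    then obtain b t where "ends (v i) = {b, t}"
      by (rule ends_cases)
    moreover have "Rrel F `` {v i, b, t} = Rrel F `` {v i} \<union> Rrel F `` {b} \<union> Rrel F `` {t}"
      by blast
    ultimately show ?thesis
      using finite_class by simp
  qed
  then show ?thesis
    using assms by (auto simp: special_def marked_def)
qed

section \<open>Refining to adapted epimorphisms\<close>

text \<open>\<open>f1\<close> separates the marked strands; the marked columns of a finer
  \<open>h\<close> are so thin that every \<open>f1\<close>-value on them is attained on the strand.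
  Taking there the column index from \<open>h\<close> and the height from \<open>f1\<close>, shifted
  to start at 0, makes the strand fill its column.\<close>

lemma pregood_refine:
  assumes M: "marked I K v" and q: "lc q"
  obtains f where "pregood I v f" "finer f q"
proof -
  have finI: "finite I" and vS: "\<And>i. i \<in> I \<Longrightarrow> v i \<in> S"
    using M by (auto simp: marked_def)
  let ?D = "{(i, j) \<in> I \<times> I. i \<noteq> j}"
  have "\<forall>d\<in>?D. \<exists>g. proj g \<and> fst (g (v (fst d))) \<noteq> fst (g (v (snd d)))"
  proof
    fix d assume "d \<in> ?D"
    then have "v (snd d) \<notin> strand (v (fst d))" "v (snd d) \<in> S"
      using M by (auto simp: marked_def)
    then show "\<exists>g. proj g \<and> fst (g (v (fst d))) \<noteq> fst (g (v (snd d)))"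
      unfolding strand_def by fastforce
  qed
  from bchoice[OF this] obtain sep where
    "\<forall>d\<in>?D. proj (sep d) \<and> fst (sep d (v (fst d))) \<noteq> fst (sep d (v (snd d)))"
    by (elim exE)
  note sep = bspec[OF this]
  have "finite ?D"
    by (rule finite_subset[of _ "I \<times> I"]) (use finI in auto)
  then have "lc (\<lambda>s. restrict (\<lambda>d. sep d s) ?D)"
    by (rule lc_family) (use sep proj_lc in blast)
  then obtain f1 where f1: "proj f1" "finer f1 q" "finer f1 (\<lambda>s. restrict (\<lambda>d. sep d s) ?D)"
    using refine2[OF q] by blast
  have f1hom: "hom f1"
    by (rule proj_hom[OF f1(1)])
  have "\<forall>i\<in>I. \<exists>h. proj h \<and> {w \<in> S. fst (h w) = fst (h (v i))} \<subseteq> {w \<in> S. f1 w \<in> f1 ` strand (v i)}"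
  proof
    fix i assume i: "i \<in> I"
    have op: "openin (Top F) {w \<in> S. f1 w \<in> f1 ` strand (v i)}"
      by (rule lc_openin[OF proj_lc[OF f1(1)]])
    have sub: "strand (v i) \<subseteq> {w \<in> S. f1 w \<in> f1 ` strand (v i)}"
      using strand_sub by blast
    show "\<exists>h. proj h \<and> {w \<in> S. fst (h w) = fst (h (v i))} \<subseteq> {w \<in> S. f1 w \<in> f1 ` strand (v i)}"
      by (rule strand_nbhd[OF op sub vS[OF i] proj_lc[OF f1(1)]]) blast
  qed
  from bchoice[OF this] obtain nb where
    "\<forall>i\<in>I. proj (nb i) \<and> {w \<in> S. fst (nb i w) = fst (nb i (v i))} \<subseteq> {w \<in> S. f1 w \<in> f1 ` strand (v i)}"
    by (elim exE)
  note nb = bspec[OF this]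
  have "lc (\<lambda>s. restrict (\<lambda>i. nb i s) I)"
    by (rule lc_family[OF finI]) (use nb proj_lc in blast)
  then obtain h where h: "proj h" "finer h f1" "finer h (\<lambda>s. restrict (\<lambda>i. nb i s) I)"
    using refine2[OF proj_lc[OF f1(1)]] by blast
  have hhom: "hom h"
    by (rule proj_hom[OF h(1)])
  have col: "f1 w \<in> f1 ` strand (v i)" if "i \<in> I" "w \<in> S" "fst (h w) = fst (h (v i))" for i w
  proof -
    have "hom (nb i)"
      using nb[OF that(1)] proj_hom by blast
    then have "fst (nb i w) = fst (nb i (v i))"
      by (rule finer_fst[OF h(1) _ finer_family[OF h(3) that(1)] that(2) vS[OF that(1)] that(3)])
    then show ?thesis
      using nb[OF that(1)] that(2) by blast
  qed
  have dist: "i = j" if "i \<in> I" "j \<in> I" "fst (h (v i)) = fst (h (v j))" for i j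
  proof (rule ccontr)
    assume "i \<noteq> j"
    then have d: "(i, j) \<in> ?D" using that by simp
    then have "hom (sep (i, j))"
      using sep proj_hom by blast
    then have "fst (sep (i, j) (v i)) = fst (sep (i, j) (v j))"
      using finer_fst[OF h(1) _ finer_trans[OF h(2) finer_family[OF f1(3) d]] vS[OF that(1)] vS[OF that(2)] that(3)]
      by blast
    then show False
      using sep[OF d] by simp
  qed
  have "\<exists>b t. b \<in> strand (v i) \<and> t \<in> strand (v i) \<and> (b, t) \<in> Leq F \<and>
      (\<forall>w\<in>strand (v i). snd (f1 b) \<le> snd (f1 w) \<and> snd (f1 w) \<le> snd (f1 t))" if i: "i \<in> I" for i
  proof -
    obtain b t where bt: "b \<in> strand (v i)" "t \<in> strand (v i)" "\<And>w. w \<in> strand (v i) \<Longrightarrow> (b, w) \<in> Leq F"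
        "\<And>w. w \<in> strand (v i) \<Longrightarrow> (w, t) \<in> Leq F"
      by (rule ends_cases[OF vS[OF i]]) blast
    moreover have "snd (f1 b) \<le> snd (f1 w) \<and> snd (f1 w) \<le> snd (f1 t)" if "w \<in> strand (v i)" for w
      using hom_L[OF f1hom bt(3)[OF that]] hom_L[OF f1hom bt(4)[OF that]] by (simp add: cle_def)
    ultimately show ?thesis
      by blast
  qed
  then obtain bot top where bt: "\<And>i. i \<in> I \<Longrightarrow> bot i \<in> strand (v i) \<and> top i \<in> strand (v i) \<and>
      (bot i, top i) \<in> Leq F \<and>
      (\<forall>w\<in>strand (v i). snd (f1 (bot i)) \<le> snd (f1 w) \<and> snd (f1 w) \<le> snd (f1 (top i)))"
    by metis
  define C where "C = (\<lambda>i. fst (h (v i))) ` I"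
  \<comment> \<open>The least \<open>f1\<close>-height on the strand marked in column
    \<open>c\<close>; the index chosen is unique because the marks lie in distinct columns.\<close>
  define \<alpha> where "\<alpha> c = snd (f1 (bot (SOME i. i \<in> I \<and> fst (h (v i)) = c)))" for c
  have \<alpha>: "\<alpha> (fst (h (v i))) = snd (f1 (bot i))" if "i \<in> I" for i
  proof -
    have "(SOME j. j \<in> I \<and> fst (h (v j)) = fst (h (v i))) = i"
      by (rule some_equality) (use that dist in auto)
    then show ?thesis by (simp add: \<alpha>_def)
  qed
  define f2 where "f2 w = (fst (h w), if fst (h w) \<in> C then snd (f1 w) - \<alpha> (fst (h w)) else snd (h w))" for w
  have f2fst: "fst (f2 w) = fst (h w)" for w
    by (simp add: f2_def)
  have f2in: "f2 w = (fst (h w), snd (f1 w) - snd (f1 (bot i)))" if "i \<in> I" "fst (h w) = fst (h (v i))" for i w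
    using that \<alpha>[OF that(1)] by (auto simp: f2_def C_def)
  have lcf2: "lc f2"
    using lc_comp[OF lc_pair[OF proj_lc[OF h(1)] proj_lc[OF f1(1)]], of
        "\<lambda>(x, y). (fst x, if fst x \<in> C then snd y - \<alpha> (fst x) else snd x)"]
    by (simp add: f2_def[abs_def])
  have homf2: "hom f2"
    unfolding hom_def
  proof (intro conjI lcf2 ballI, clarify, goal_cases)
    case (1 s t)
    then have "cadj (h s) (h t)" "cadj (f1 s) (f1 t)"
      using hom_R[OF hhom] hom_R[OF f1hom] by blast+
    then show ?case
      by (auto simp: f2_def cadj_def)
  next
    case (2 z)
    then obtain s t where z: "z = (s, t)" "(s, t) \<in> Leq F" by (cases z) auto
    then have "cle (h s) (h t)" "cle (f1 s) (f1 t)"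
      using hom_L[OF hhom] hom_L[OF f1hom] by blast+
    then show ?case
      using z(1) by (auto simp: f2_def cle_def)
  qed
  have full: "f2 s \<in> f2 ` strand (v i)" if i: "i \<in> I" and s: "s \<in> S" "fst (h s) = fst (h (v i))" for i s
  proof -
    obtain w where w: "w \<in> strand (v i)" "f1 w = f1 s"
      using col[OF i s] by (metis imageE)
    have "fst (h w) = fst (h (v i))"
      by (rule strand_hom[OF hhom vS[OF i] w(1)])
    then have "f2 w = f2 s"
      using f2in[OF i] s(2) w(2) by simp
    then show ?thesis
      using w(1) by (metis imageI)
  qed
  have "proj f2"
  proof (rule hom_imp_proj[OF homf2])
    fix s assume s: "s \<in> S"
    show "\<exists>a b. (a, b) \<in> Leq F \<and> fst (f2 a) = fst (f2 s) \<and> snd (f2 a) = 0 \<and>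
        (\<forall>t\<in>S. fst (f2 t) = fst (f2 s) \<longrightarrow> snd (f2 t) \<le> snd (f2 b))"
    proof (cases "fst (h s) \<in> C")
      case True
      then obtain i where i: "i \<in> I" "fst (h s) = fst (h (v i))"
        by (auto simp: C_def)
      have hb: "fst (h (bot i)) = fst (h (v i))" "fst (h (top i)) = fst (h (v i))"
        using strand_hom[OF hhom vS[OF i(1)]] bt[OF i(1)] by auto
      have "snd (f2 t) \<le> snd (f2 (top i))" if t: "t \<in> S" "fst (h t) = fst (h s)" for t
      proof -
        have ht: "fst (h t) = fst (h (v i))"
          using t(2) i(2) by simp
        obtain w where "w \<in> strand (v i)" "f1 w = f1 t"
          using col[OF i(1) t(1) ht] by (metis imageE)
        then have "snd (f1 t) \<le> snd (f1 (top i))"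
          using bt[OF i(1)] by metis
        then show ?thesis
          using f2in[OF i(1) ht] f2in[OF i(1) hb(2)] by simp
      qed
      moreover have "snd (f2 (bot i)) = 0"
        using f2in[OF i(1) hb(1)] by simp
      ultimately show ?thesis
        using bt[OF i(1)] hb i(2) by (intro exI[of _ "bot i"] exI[of _ "top i"]) (auto simp: f2fst)
    next
      case False
      obtain a b where ab: "(a, b) \<in> Leq F" "fst (h a) = fst (h s)" "snd (h a) = 0"
          "\<And>t. t \<in> S \<Longrightarrow> fst (h t) = fst (h s) \<Longrightarrow> snd (h t) \<le> snd (h b)"
        by (rule proj_full[OF h(1) s]) blast
      have "fst (h b) = fst (h s)"
        using hom_L_fst[OF hhom ab(1)] ab(2) by simp
      then show ?thesis
        using ab False by (intro exI[of _ a] exI[of _ b]) (auto simp: f2_def)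
    qed
  qed
  then have "pregood I v f2"
    unfolding pregood_def f2fst using full dist by blast
  \<comment> \<open>On a marked column \<open>f2\<close> forgets the heights of \<open>h\<close> but
    still determines \<open>f1\<close>: its height up to a known shift, and its column because
    \<open>h\<close> is finer than \<open>f1\<close>.\<close>
  moreover have "finer f2 q"
    unfolding finer_def
  proof (intro ballI impI)
    fix s t assume st: "s \<in> S" "t \<in> S" "f2 s = f2 t"
    then have hst: "fst (h s) = fst (h t)"
      using f2fst by metis
    have "f1 s = f1 t"
    proof (cases "fst (h s) \<in> C")
      case True
      then obtain i where i: "i \<in> I" "fst (h s) = fst (h (v i))" "fst (h t) = fst (h (v i))"
        using hst by (auto simp: C_def)
      obtain w w' where w: "w \<in> strand (v i)" "f1 w = f1 s" "w' \<in> strand (v i)" "f1 w' = f1 t"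
        using col[OF i(1) st(1) i(2)] col[OF i(1) st(2) i(3)] by (metis imageE)
      then have "snd (f1 (bot i)) \<le> snd (f1 s)" "snd (f1 (bot i)) \<le> snd (f1 t)"
        using bt[OF i(1)] by metis+
      moreover have "snd (f1 s) - snd (f1 (bot i)) = snd (f1 t) - snd (f1 (bot i))"
        using st(3) unfolding f2in[OF i(1,2)] f2in[OF i(1,3)] by simp
      moreover have "fst (f1 s) = fst (f1 t)"
        by (rule finer_fst[OF h(1) f1hom h(2) st(1,2) hst])
      ultimately show ?thesis
        by (simp add: prod_eq_iff)
    next
      case False
      then have "h s = h t"
        using st(3) hst by (simp add: f2_def prod_eq_iff)
      then show ?thesis
        using finerD[OF h(2) st(1,2)] by blast
    qed
    then show "q s = q t"
      using finerD[OF f1(2) st(1,2)] by blast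
  qed
  ultimately show thesis
    by (rule that)
qed

text \<open>Contract the edges crossed by special pairs. The two ends of such an edge have the same
  \<open>q\<close>-value, since \<open>q\<close> agrees on the pair and \<open>f\<close> is finer
  than \<open>q\<close>; so the contraction loses nothing that \<open>q\<close> sees.\<close>

lemma collapse_refine:
  assumes M: "marked I K v" and f: "pregood I v f" "finer f q" and q: "collapse I v q"
  obtains g where "pregood I v g" "collapse I v g" "finer g q"
proof -
  have pf: "proj f" and hf: "hom f"
    using f(1) proj_hom by (auto simp: pregood_def)
  define E where "E c = {e. \<exists>s s'. s \<in> special I v \<and> (s, s') \<in> Rrel F \<and> f s = (c, e) \<and> f s' = (c, Suc e)}" for c
  \<comment> \<open>New heights in column \<open>c\<close>, counting only the edges that survive the
    contraction.\<close>
  define \<kappa> where "\<kappa> c m = card {e. e < m \<and> e \<notin> E c}" for c m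
  have \<kappa>0: "\<kappa> c 0 = 0" for c
    by (simp add: \<kappa>_def)
  have \<kappa>S: "\<kappa> c (Suc m) = (if m \<in> E c then \<kappa> c m else Suc (\<kappa> c m))" for c m
  proof -
    have "{e. e < Suc m \<and> e \<notin> E c} = (if m \<in> E c then {e. e < m \<and> e \<notin> E c} else insert m {e. e < m \<and> e \<notin> E c})"
      by (auto simp: less_Suc_eq)
    then show ?thesis
      by (simp add: \<kappa>_def)
  qed
  have mono: "\<kappa> c m \<le> \<kappa> c m'" if "m \<le> m'" for c m m'
    using that by (induction m' rule: dec_induct) (auto simp: \<kappa>S)
  have step: "\<kappa> c m \<le> Suc (\<kappa> c m')" if "m \<le> Suc m'" for c m m'
  proof -
    have "\<kappa> c m \<le> \<kappa> c (Suc m')"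
      by (rule mono[OF that])
    also have "\<dots> \<le> Suc (\<kappa> c m')"
      by (simp add: \<kappa>S)
    finally show ?thesis .
  qed
  have flat: "e \<in> E c" if "\<kappa> c m = \<kappa> c m'" "m \<le> e" "e < m'" for c m m' e
  proof (rule ccontr)
    assume "e \<notin> E c"
    then have "\<kappa> c (Suc e) = Suc (\<kappa> c e)"
      by (simp add: \<kappa>S)
    moreover have "\<kappa> c m \<le> \<kappa> c e" "\<kappa> c (Suc e) \<le> \<kappa> c m'"
      using mono[OF that(2)] mono[of "Suc e" m' c] that(3) by auto
    ultimately show False
      using that(1) by linarith
  qed
  define g where "g w = (fst (f w), \<kappa> (fst (f w)) (snd (f w)))" for w
  have gfst: "fst (g w) = fst (f w)" for w
    by (simp add: g_def)
  have geq: "g s = g t" if "f s = f t" for s t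
    using that by (simp add: g_def)
  have "lc g"
    using lc_comp[OF hom_lc[OF hf], of "\<lambda>x. (fst x, \<kappa> (fst x) (snd x))"] by (simp add: g_def[abs_def])
  then have homg: "hom g"
    unfolding hom_def using hom_R[OF hf] hom_L[OF hf] mono step by (fastforce simp: g_def cadj_def cle_def)
  have "proj g"
  proof (rule hom_imp_proj[OF homg])
    fix s assume s: "s \<in> S"
    obtain a b where ab: "(a, b) \<in> Leq F" "fst (f a) = fst (f s)" "snd (f a) = 0"
        "\<And>t. t \<in> S \<Longrightarrow> fst (f t) = fst (f s) \<Longrightarrow> snd (f t) \<le> snd (f b)"
      by (rule proj_full[OF pf s]) blast
    have "fst (f b) = fst (f s)"
      using hom_L_fst[OF hf ab(1)] ab(2) by simp
    then show "\<exists>a b. (a, b) \<in> Leq F \<and> fst (g a) = fst (g s) \<and> snd (g a) = 0 \<and>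
        (\<forall>t\<in>S. fst (g t) = fst (g s) \<longrightarrow> snd (g t) \<le> snd (g b))"
      using ab mono by (intro exI[of _ a] exI[of _ b]) (auto simp: g_def \<kappa>0)
  qed
  moreover have "g s \<in> g ` strand (v i)" if si: "i \<in> I" "s \<in> S" "fst (f s) = fst (f (v i))" for i s
  proof -
    obtain w where "w \<in> strand (v i)" "f s = f w"
      using pregood_full[OF f(1) si] by auto
    then show ?thesis
      using geq by blast
  qed
  ultimately have "pregood I v g"
    using pregood_inj[OF f(1)] unfolding pregood_def gfst by blast
  moreover have "collapse I v g"
  proof (rule collapseI)
    fix s t assume st: "(s, t) \<in> Rrel F" "s \<in> special I v"
    obtain c e where fs: "f s = (c, e)" by (cases "f s")
    have t: "t \<in> special I v"
      using special_R st by blast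
    have "cadj (f s) (f t)"
      by (rule hom_R[OF hf st(1)])
    then consider "f t = f s" | "f t = (c, Suc e)" | e' where "e = Suc e'" "f t = (c, e')"
      using fs by (cases "f t") (auto simp: cadj_def le_Suc_eq)
    then show "g s = g t"
    proof cases
      case 1
      show ?thesis by (rule geq[OF 1[symmetric]])
    next
      case 2
      then have "e \<in> E c"
        unfolding E_def using st fs by blast
      then show ?thesis
        using fs 2 by (simp add: g_def \<kappa>S)
    next
      case 3
      then have "e' \<in> E c"
        unfolding E_def using R_sym[OF st(1)] t fs by blast
      then show ?thesis
        using fs 3 by (simp add: g_def \<kappa>S)
    qed
  qed
  moreover have "finer g q"
  proof -
    have chain: "t \<in> S \<Longrightarrow> f t = (c, m') \<Longrightarrow> \<kappa> c m = \<kappa> c m' \<Longrightarrow> q t = q s"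
      if s: "s \<in> S" "f s = (c, m)" and "m \<le> m'" for s t c m m'
      using that(3)
    proof (induction m' arbitrary: t rule: dec_induct)
      case base
      then show ?case
        using finerD[OF f(2) base(1) s(1)] s(2) by simp
    next
      case (step n)
      have "n \<in> E c"
        by (rule flat[OF step.prems(3)]) (use step.hyps in auto)
      then obtain u u' where u: "u \<in> special I v" "(u, u') \<in> Rrel F" "f u = (c, n)" "f u' = (c, Suc n)"
        unfolding E_def by blast
      have S: "u \<in> S" "u' \<in> S"
        using R_in[OF u(2)] by auto
      have "\<kappa> c m \<le> \<kappa> c n" "\<kappa> c n \<le> \<kappa> c (Suc n)"
        using mono step.hyps by auto
      then have "\<kappa> c m = \<kappa> c n"
        using step.prems(3) by simp
      then have "q u = q s"
        by (rule step.IH[OF S(1) u(3)])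
      moreover have "q t = q u'"
        using finerD[OF f(2) step.prems(1) S(2)] step.prems(2) u(4) by simp
      moreover have "q u = q u'"
        by (rule collapseD[OF q u(2,1)])
      ultimately show ?case by simp
    qed
    show ?thesis
      unfolding finer_def
    proof (intro ballI impI)
      fix s t assume st: "s \<in> S" "t \<in> S" "g s = g t"
      obtain c m where fs: "f s = (c, m)" by (cases "f s")
      obtain m' where ft: "f t = (c, m')" and k: "\<kappa> c m = \<kappa> c m'"
        using st(3) fs by (cases "f t") (auto simp: g_def)
      show "q s = q t"
      proof (cases "m \<le> m'")
        case True
        then show ?thesis using chain[OF st(1) fs True st(2) ft k] by simp
      next
        case False
        then show ?thesis using chain[OF st(2) ft _ st(1) fs k[symmetric]] by simp
      qed
    qed
  qed
  ultimately show thesis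
    by (rule that)
qed

lemma good_refine:
  assumes M: "marked I K v" and q: "lc q" "collapse I v q"
  obtains g where "pregood I v g" "collapse I v g" "finer g q"
proof -
  obtain f where f: "pregood I v f" "finer f q"
    by (rule pregood_refine[OF M q(1)])
  show thesis
    by (rule collapse_refine[OF M f q(2)]) (rule that)
qed

end

section \<open>Room on a marked arc: free edges and infinite fibres\<close>

text \<open>By monotonicity each element of \<open>HB\<close> except the largest starts an edge that
  stays at level \<open>z\<close>. These are \<open>N + k\<close> edges, of which at most
  \<open>k\<close> lie in \<open>E\<close>.\<close>

lemma card_free_edges:
  fixes a :: "nat \<Rightarrow> nat"
  assumes mono: "\<And>i j. i \<le> j \<Longrightarrow> j \<le> hi \<Longrightarrow> a i \<le> a j"
    and HB: "HB \<subseteq> {lo..hi}" "\<And>h. h \<in> HB \<Longrightarrow> a h = z" "card HB = Suc (N + k)"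
    and E: "finite E" "card E \<le> k" and q: "q \<le> N"
  shows "q \<le> card {e. lo \<le> e \<and> e < hi \<and> e \<notin> E \<and> a e = z \<and> a (Suc e) = z}"
proof -
  have fin: "finite HB"
    using HB(1) finite_subset by blast
  have ne: "HB \<noteq> {}"
    using HB(3) by auto
  let ?m = "Max HB"
  have m: "?m \<in> HB" "\<And>h. h \<in> HB \<Longrightarrow> h \<le> ?m"
    using Max_in[OF fin ne] Max_ge[OF fin] by auto
  have "HB - {?m} - E \<subseteq> {e. lo \<le> e \<and> e < hi \<and> e \<notin> E \<and> a e = z \<and> a (Suc e) = z}"
  proof
    fix e assume e: "e \<in> HB - {?m} - E"
    then have "e < ?m" "?m \<le> hi" "lo \<le> e"
      using m HB(1) by (auto simp: order.not_eq_order_implies_strict)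
    moreover have "a (Suc e) = z"
      using mono[of e "Suc e"] mono[of "Suc e" ?m] HB(2)[of e] HB(2)[OF m(1)] e calculation by simp
    ultimately show "e \<in> {e. lo \<le> e \<and> e < hi \<and> e \<notin> E \<and> a e = z \<and> a (Suc e) = z}"
      using e HB(2) by simp
  qed
  then have "card (HB - {?m} - E) \<le> card {e. lo \<le> e \<and> e < hi \<and> e \<notin> E \<and> a e = z \<and> a (Suc e) = z}"
    by (intro card_mono) auto
  moreover have "card (HB - {?m}) = N + k"
    using m(1) HB(3) fin by simp
  then have "N + k - card E \<le> card (HB - {?m} - E)"
    using diff_card_le_card_Diff[OF E(1), of "HB - {?m}"] by simp
  ultimately show ?thesis
    using E(2) q by linarith
qed

context fraisse_limit
begin

text \<open>Stated for an arbitrary order \<open>Q\<close> on the strand so that it applies above and below \<open>v\<close>. Were the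
  fibre finite, its elements would form one class, which would have to extend past the fibre at
  both ends although special classes cannot.\<close>

lemma infinite_fibre_general:
  fixes \<rho> :: "'a \<Rightarrow> int"
  assumes TS: "T \<subseteq> S" and vT: "v \<in> T" and xT: "x \<in> T" "(v, x) \<in> Q"
    and lin: "\<And>s t. s \<in> T \<Longrightarrow> t \<in> T \<Longrightarrow> (s, t) \<in> Q \<or> (t, s) \<in> Q"
    and anti: "\<And>s t. (s, t) \<in> Q \<Longrightarrow> (t, s) \<in> Q \<Longrightarrow> s = t"
    and tr: "\<And>s t w. (s, t) \<in> Q \<Longrightarrow> (t, w) \<in> Q \<Longrightarrow> (s, w) \<in> Q"
    and jump: "\<And>s t. s \<in> T \<Longrightarrow> t \<in> T \<Longrightarrow> (s, t) \<in> Q \<Longrightarrow>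
      (\<And>w. w \<in> T \<Longrightarrow> (s, w) \<in> Q \<Longrightarrow> (w, t) \<in> Q \<Longrightarrow> w = s \<or> w = t) \<Longrightarrow> (s, t) \<in> Rrel F"
    and mx: "\<And>Z. closedin (Top F) Z \<Longrightarrow> Z \<noteq> {} \<Longrightarrow> Z \<subseteq> T \<Longrightarrow> \<exists>m\<in>Z. \<forall>z\<in>Z. (z, m) \<in> Q"
    and mn: "\<And>Z. closedin (Top F) Z \<Longrightarrow> Z \<noteq> {} \<Longrightarrow> Z \<subseteq> T \<Longrightarrow> \<exists>m\<in>Z. \<forall>z\<in>Z. (m, z) \<in> Q"
    and \<rho>: "\<And>s t. s \<in> T \<Longrightarrow> t \<in> T \<Longrightarrow> (s, t) \<in> Q \<Longrightarrow> \<rho> s \<le> \<rho> t"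
    and cl: "\<And>P. closedin (Top F) {w \<in> T. P (\<rho> w)}"
    and top: "t \<in> T" "\<And>w. w \<in> T \<Longrightarrow> (w, t) \<in> Q" "(v, t) \<notin> Rrel F"
    and coll: "\<And>w. (v, w) \<in> Rrel F \<Longrightarrow> \<rho> v = \<rho> w" "\<And>w. (t, w) \<in> Rrel F \<Longrightarrow> \<rho> t = \<rho> w"
  shows "infinite {w \<in> T. (v, w) \<in> Q \<and> \<rho> w = \<rho> x}" (is "infinite ?A")
proof
  assume fin: "finite ?A"
  have xA: "x \<in> ?A"
    using xT by simp
  have clA: "closedin (Top F) B" if "B \<subseteq> ?A" for B
    by (rule closedin_Hausdorff_finite[OF Hausdorff_F]) (use that fin TS finite_subset in auto)
  obtain s0 where s0: "s0 \<in> ?A" "\<And>w. w \<in> ?A \<Longrightarrow> (s0, w) \<in> Q"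
    using mn[OF clA[OF order_refl]] xA by blast
  obtain s1 where s1: "s1 \<in> ?A" "\<And>w. w \<in> ?A \<Longrightarrow> (w, s1) \<in> Q"
    using mx[OF clA[OF order_refl]] xA by blast
  have s0T: "s0 \<in> T" "(v, s0) \<in> Q" "\<rho> s0 = \<rho> x" and s1T: "s1 \<in> T" "(v, s1) \<in> Q" "\<rho> s1 = \<rho> x"
    using s0(1) s1(1) by auto
  \<comment> \<open>Consecutive elements of the finite fibre are consecutive in \<open>T\<close>,
    hence related. Here \<open>y\<close> is the least element outside the class of
    \<open>s0\<close>, and \<open>u\<close> its predecessor, so relatedness to \<open>s0\<close>
    passes from \<open>u\<close> to \<open>y\<close>.\<close>
  have cls: "(s0, w) \<in> Rrel F" if "w \<in> ?A" for w
  proof (rule ccontr)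
    assume w0: "(s0, w) \<notin> Rrel F"
    let ?D = "{w \<in> ?A. (s0, w) \<notin> Rrel F}"
    have "?D \<subseteq> ?A" "?D \<subseteq> T" "?D \<noteq> {}"
      using that w0 by auto
    then obtain y where y: "y \<in> ?D" "\<And>z. z \<in> ?D \<Longrightarrow> (y, z) \<in> Q"
      using mn[OF clA] by meson
    have yT: "y \<in> T" "\<rho> y = \<rho> x" "y \<noteq> s0"
      using y(1) R_refl s0T(1) TS by auto
    let ?P = "{z \<in> ?A. (z, y) \<in> Q \<and> z \<noteq> y}"
    have "?P \<subseteq> ?A" "?P \<subseteq> T" "s0 \<in> ?P"
      using s0 y(1) yT(3) by auto
    then obtain u where u: "u \<in> ?P" "\<And>z. z \<in> ?P \<Longrightarrow> (z, u) \<in> Q"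
      using mx[OF clA] by (metis (no_types, lifting) empty_iff)
    have uT: "u \<in> T" "(v, u) \<in> Q" "\<rho> u = \<rho> x" "(u, y) \<in> Q" "u \<noteq> y"
      using u(1) by auto
    have "u \<notin> ?D"
    proof
      assume "u \<in> ?D"
      then have "(y, u) \<in> Q" by (rule y(2))
      then show False using anti uT(4,5) by blast
    qed
    then have s0u: "(s0, u) \<in> Rrel F"
      using u(1) by blast
    have "(u, y) \<in> Rrel F"
    proof (rule jump[OF uT(1) yT(1) uT(4)])
      fix z assume z: "z \<in> T" "(u, z) \<in> Q" "(z, y) \<in> Q"
      have "\<rho> z = \<rho> x"
        using \<rho>[OF uT(1) z(1,2)] \<rho>[OF z(1) yT(1) z(3)] uT(3) yT(2) by simp
      moreover have "(v, z) \<in> Q"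
        by (rule tr[OF uT(2) z(2)])
      ultimately have "z = y \<or> z \<in> ?P"
        using z by blast
      then show "z = u \<or> z = y"
        using u(2) anti z(2) by blast
    qed
    then have "(s0, y) \<in> Rrel F"
      by (rule R_trans[OF s0u])
    then show False
      using y(1) by blast
  qed
  \<comment> \<open>Either the fibre reaches the top point \<open>t\<close>, or its last point
    \<open>s1\<close> jumps to the first point of larger value.\<close>
  have upper: "\<rho> t = \<rho> x \<or> (\<exists>b. \<rho> x < \<rho> b \<and> (s1, b) \<in> Rrel F)"
  proof (cases "\<rho> t = \<rho> x")
    case False
    then have "\<rho> x < \<rho> t"
      using \<rho>[OF xT(1) top(1) top(2)[OF xT(1)]] by simp
    then have "{w \<in> T. \<rho> x < \<rho> w} \<noteq> {}"
      using top(1) by blast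
    then obtain b where b: "b \<in> {w \<in> T. \<rho> x < \<rho> w}" "\<And>w. w \<in> {w \<in> T. \<rho> x < \<rho> w} \<Longrightarrow> (b, w) \<in> Q"
      using mn[OF cl[of "\<lambda>r. \<rho> x < r"]] by blast
    then have bT: "b \<in> T" "\<rho> x < \<rho> b" by auto
    have sb: "(s1, b) \<in> Q"
      using lin[OF s1T(1) bT(1)] \<rho>[OF bT(1) s1T(1)] bT(2) s1T(3) by auto
    have "(s1, b) \<in> Rrel F"
    proof (rule jump[OF s1T(1) bT(1) sb])
      fix z assume z: "z \<in> T" "(s1, z) \<in> Q" "(z, b) \<in> Q"
      have "\<rho> x \<le> \<rho> z"
        using \<rho>[OF s1T(1) z(1,2)] s1T(3) by simp
      then consider "\<rho> z = \<rho> x" | "\<rho> x < \<rho> z" by linarith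
      then show "z = s1 \<or> z = b"
      proof cases
        case 1
        then have "(z, s1) \<in> Q"
          using s1(2) z(1) tr[OF s1T(2) z(2)] by blast
        then show ?thesis using anti z(2) by blast
      next
        case 2
        then have "(b, z) \<in> Q"
          using b(2) z(1) by blast
        then show ?thesis using anti z(3) by blast
      qed
    qed
    then show ?thesis using bT(2) by blast
  qed simp
  have s01: "(s0, s1) \<in> Rrel F"
    by (rule cls[OF s1(1)])
  have tA: "(s0, t) \<in> Rrel F" if "\<rho> t = \<rho> x"
    by (rule cls) (use that top vT in blast)
  show False
  proof (cases "\<rho> v = \<rho> x")
    case True
    \<comment> \<open>The fibre now starts at \<open>v\<close>, so the class of \<open>v\<close>
      contains \<open>t\<close>, contrary to the assumption on \<open>t\<close>, or a point of
      larger value, contrary to collapsing.\<close>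
    have "(v, v) \<in> Q"
      using lin vT by blast
    then have "v \<in> ?A"
      using True vT by blast
    then have "s0 = v"
      using s0(2) s0T(2) anti by blast
    then show False
      using upper tA top(3) coll(1) R_trans[OF s01] True by force
  next
    case False
    then have "\<rho> v < \<rho> x"
      using \<rho>[OF vT xT] by simp
    then have "{w \<in> T. \<rho> w < \<rho> x} \<noteq> {}"
      using vT by blast
    then obtain b where b: "b \<in> {w \<in> T. \<rho> w < \<rho> x}" "\<And>w. w \<in> {w \<in> T. \<rho> w < \<rho> x} \<Longrightarrow> (w, b) \<in> Q"
      using mx[OF cl[of "\<lambda>r. r < \<rho> x"]] by blast
    then have bT: "b \<in> T" "\<rho> b < \<rho> x" and vb: "(v, b) \<in> Q"
      using vT \<open>\<rho> v < \<rho> x\<close> by auto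
    have bs: "(b, s0) \<in> Q"
      using lin[OF bT(1) s0T(1)] \<rho>[OF s0T(1) bT(1)] bT(2) s0T(3) by auto
    have bR: "(b, s0) \<in> Rrel F"
    proof (rule jump[OF bT(1) s0T(1) bs])
      fix z assume z: "z \<in> T" "(b, z) \<in> Q" "(z, s0) \<in> Q"
      have "\<rho> z \<le> \<rho> x"
        using \<rho>[OF z(1) s0T(1) z(3)] s0T(3) by simp
      then consider "\<rho> z = \<rho> x" | "\<rho> z < \<rho> x" by linarith
      then show "z = b \<or> z = s0"
      proof cases
        case 1
        then have "(s0, z) \<in> Q"
          using s0(2) z(1) tr[OF vb z(2)] by blast
        then show ?thesis using anti z(3) by blast
      next
        case 2
        then have "(z, b) \<in> Q"
          using b(2) z(1) by blast
        then show ?thesis using anti z(2) by blast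
      qed
    qed
    show False
      using upper
    proof
      assume t: "\<rho> t = \<rho> x"
      have "(t, b) \<in> Rrel F"
        by (rule R_sym, rule R_trans[OF bR tA[OF t]])
      then show False
        using coll(2)[of b] bT(2) t by simp
    next
      assume "\<exists>b'. \<rho> x < \<rho> b' \<and> (s1, b') \<in> Rrel F"
      then obtain b' where b': "\<rho> x < \<rho> b'" "(s1, b') \<in> Rrel F" by blast
      \<comment> \<open>The class of \<open>s0\<close> would contain a point of smaller value,
        \<open>s0\<close> itself and a point of larger value: three elements.\<close>
      show False
        using R_class_le_2[OF R_sym[OF bR] R_trans[OF s01 b'(2)]] b'(1) bT(2) s0T(3) by auto
    qed
  qed
qed

lemma special_base:
  assumes "i \<in> I" "m \<in> insert (v i) (ends (v i))" "m \<in> S"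
  shows "m \<in> special I v"
  unfolding special_def using assms R_refl by blast

text \<open>The second half is the first for the reversed order, with the bottom of the strand as
  its top; heights become integers so that they can be negated.\<close>

lemma infinite_fibre:
  assumes M: "marked I K v" and i: "i \<in> K" and f: "proj f" "collapse I v f" and x: "x \<in> strand (v i)"
  shows "(v i, x) \<in> Leq F \<Longrightarrow> infinite {w \<in> strand (v i). (v i, w) \<in> Leq F \<and> snd (f w) = snd (f x)}"
    and "(x, v i) \<in> Leq F \<Longrightarrow> infinite {w \<in> strand (v i). (w, v i) \<in> Leq F \<and> snd (f w) = snd (f x)}"
proof -
  have iI: "i \<in> I" and vS: "v i \<in> S"
    using M i by (auto simp: marked_def)
  have hf: "hom f"
    by (rule proj_hom[OF f(1)])
  obtain b t where bt: "b \<in> strand (v i)" "t \<in> strand (v i)" "\<And>w. w \<in> strand (v i) \<Longrightarrow> (b, w) \<in> Leq F"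
      "\<And>w. w \<in> strand (v i) \<Longrightarrow> (w, t) \<in> Leq F" "ends (v i) = {b, t}"
    by (rule ends_cases[OF vS]) blast
  have nb: "(v i, b) \<notin> Rrel F" "(v i, t) \<notin> Rrel F"
    using M i bt(5) by (auto simp: marked_def)
  have sp: "v i \<in> special I v" "b \<in> special I v" "t \<in> special I v"
    using special_base[OF iI, of "v i" v] special_base[OF iI, of b v] special_base[OF iI, of t v]
      bt(1,2,5) vS strand_sub by blast+
  have cl: "closedin (Top F) {w \<in> strand (v i). P (snd (f w))}" for P
  proof -
    have "{w \<in> strand (v i). P (snd (f w))} = strand (v i) \<inter> {w \<in> S. P (snd (f w))}"
      using strand_sub by blast
    then show ?thesis
      using lc_closedin[OF proj_lc[OF f(1)], of "\<lambda>a. P (snd a)"] closedin_strand by auto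
  qed
  have mono: "snd (f s) \<le> snd (f t)" if "(s, t) \<in> Leq F" for s t
    using hom_L[OF hf that] by (simp add: cle_def)
  have jump: "(s, t) \<in> Rrel F" if "s \<in> strand (v i)" "(s, t) \<in> Leq F"
      "\<And>w. w \<in> strand (v i) \<Longrightarrow> (s, w) \<in> Leq F \<Longrightarrow> (w, t) \<in> Leq F \<Longrightarrow> w = s \<or> w = t" for s t
  proof (rule strand_jump[OF that(2)])
    fix w assume w: "(s, w) \<in> Leq F" "(w, t) \<in> Leq F"
    have "w \<in> strand (v i)"
      using L_strand[OF w(1)] strand_eq[OF that(1)] by simp
    then show "w = s \<or> w = t"
      using that(3) w by blast
  qed
  have mx: "\<exists>m\<in>Z. \<forall>z\<in>Z. (z, m) \<in> Leq F" and mn: "\<exists>m\<in>Z. \<forall>z\<in>Z. (m, z) \<in> Leq F"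
    if "closedin (Top F) Z" "Z \<noteq> {}" "Z \<subseteq> strand (v i)" for Z
  proof -
    show "\<exists>m\<in>Z. \<forall>z\<in>Z. (z, m) \<in> Leq F"
      by (rule strand_has_max[OF that]) blast
    show "\<exists>m\<in>Z. \<forall>z\<in>Z. (m, z) \<in> Leq F"
      by (rule strand_has_min[OF that]) blast
  qed
  show "infinite {w \<in> strand (v i). (v i, w) \<in> Leq F \<and> snd (f w) = snd (f x)}" if vx: "(v i, x) \<in> Leq F"
  proof -
    have "infinite {w \<in> strand (v i). (v i, w) \<in> Leq F \<and> int (snd (f w)) = int (snd (f x))}"
    proof (rule infinite_fibre_general[where t = t and Q = "Leq F" and \<rho> = "\<lambda>w. int (snd (f w))"])
      show "closedin (Top F) {w \<in> strand (v i). P (int (snd (f w)))}" for P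
        by (rule cl)
      show "int (snd (f (v i))) = int (snd (f w))" if "(v i, w) \<in> Rrel F" for w
        using collapseD[OF f(2) that sp(1)] by simp
      show "int (snd (f t)) = int (snd (f w))" if "(t, w) \<in> Rrel F" for w
        using collapseD[OF f(2) that sp(3)] by simp
      show "(s, t) \<in> Rrel F" if "s \<in> strand (v i)" "(s, t) \<in> Leq F"
          "\<And>w. w \<in> strand (v i) \<Longrightarrow> (s, w) \<in> Leq F \<Longrightarrow> (w, t) \<in> Leq F \<Longrightarrow> w = s \<or> w = t" for s t
        by (rule jump) (fact that)+
      show "int (snd (f s)) \<le> int (snd (f t))" if "(s, t) \<in> Leq F" for s t
        using mono[OF that] by simp
      show "(s, t) \<in> Leq F \<or> (t, s) \<in> Leq F" if "s \<in> strand (v i)" "t \<in> strand (v i)" for s t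
        by (rule strand_linear[OF that])
    qed (fact strand_sub strand_self[OF vS] x vx L_antisym L_trans mx mn bt nb | assumption)+
    then show ?thesis by simp
  qed
  show "infinite {w \<in> strand (v i). (w, v i) \<in> Leq F \<and> snd (f w) = snd (f x)}" if vx: "(x, v i) \<in> Leq F"
  proof -
    have "infinite {w \<in> strand (v i). (v i, w) \<in> (Leq F)\<inverse> \<and> - int (snd (f w)) = - int (snd (f x))}"
    proof (rule infinite_fibre_general[where t = b and Q = "(Leq F)\<inverse>" and \<rho> = "\<lambda>w. - int (snd (f w))"])
      show "closedin (Top F) {w \<in> strand (v i). P (- int (snd (f w)))}" for P
        by (rule cl)
      show "- int (snd (f (v i))) = - int (snd (f w))" if "(v i, w) \<in> Rrel F" for w
        using collapseD[OF f(2) that sp(1)] by simp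
      show "- int (snd (f b)) = - int (snd (f w))" if "(b, w) \<in> Rrel F" for w
        using collapseD[OF f(2) that sp(2)] by simp
      show "- int (snd (f s)) \<le> - int (snd (f t))" if "(s, t) \<in> (Leq F)\<inverse>" for s t
        using mono that by simp
      show "(s, t) \<in> Rrel F" if "t \<in> strand (v i)" "(s, t) \<in> (Leq F)\<inverse>"
          "\<And>w. w \<in> strand (v i) \<Longrightarrow> (s, w) \<in> (Leq F)\<inverse> \<Longrightarrow> (w, t) \<in> (Leq F)\<inverse> \<Longrightarrow> w = s \<or> w = t" for s t
        by (rule R_sym, rule jump) (use that in auto)
      show "(s, t) \<in> (Leq F)\<inverse> \<or> (t, s) \<in> (Leq F)\<inverse>" if "s \<in> strand (v i)" "t \<in> strand (v i)" for s t
        using strand_linear[OF that] by blast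
      show "s = t" if "(s, t) \<in> (Leq F)\<inverse>" "(t, s) \<in> (Leq F)\<inverse>" for s t
        using L_antisym that by blast
      show "(s, w) \<in> (Leq F)\<inverse>" if "(s, t) \<in> (Leq F)\<inverse>" "(t, w) \<in> (Leq F)\<inverse>" for s t w
        using L_trans that by blast
      show "\<exists>m\<in>Z. \<forall>z\<in>Z. (z, m) \<in> (Leq F)\<inverse>" "\<exists>m\<in>Z. \<forall>z\<in>Z. (m, z) \<in> (Leq F)\<inverse>"
        if "closedin (Top F) Z" "Z \<noteq> {}" "Z \<subseteq> strand (v i)" for Z
        using mn[OF that] mx[OF that] by simp_all
      show "(v i, x) \<in> (Leq F)\<inverse>"
        using vx by simp
      show "(w, b) \<in> (Leq F)\<inverse>" if "w \<in> strand (v i)" for w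
        using bt(3)[OF that] by simp
    qed (fact strand_sub strand_self[OF vS] x bt nb)+
    then show ?thesis by simp
  qed
qed

section \<open>Lifting a refinement exactly along the marked strands\<close>

text \<open>Marks lie in distinct columns, so of the copies \<open>2 * c\<close> and
  \<open>2 * c + 1\<close> of a column at most one carries a mark. The other copy later secures
  surjectivity.\<close>

lemma duplicate_columns:
  assumes f: "pregood I v f" and M: "marked I K v"
  obtains g where "pregood I v g" "\<And>s. s \<in> S \<Longrightarrow> f s = (fst (g s) div 2, snd (g s))"
    "\<And>s e. s \<in> S \<Longrightarrow> e < 2 \<Longrightarrow> \<exists>t\<in>S. g t = (2 * fst (f s) + e, snd (f s))"
proof -
  let ?X = "f ` S" and ?k = "\<lambda>a :: nat \<times> nat. (fst a div 2, snd a)"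
  let ?Y = "{a. ?k a \<in> ?X}"
  have pf: "proj f"
    using f by (rule pregood_proj)
  then have X: "column_set ?X"
    by (simp add: proj_def)
  have sec: "?k (2 * fst a, snd a) = a" "a \<in> ?X \<Longrightarrow> (2 * fst a, snd a) \<in> ?Y" for a :: "nat \<times> nat"
    by auto
  have Y: "column_set ?Y"
    unfolding column_set_def
  proof (intro conjI allI impI)
    have "?Y \<subseteq> (\<lambda>a. (2 * fst a, snd a)) ` ?X \<union> (\<lambda>a. (Suc (2 * fst a), snd a)) ` ?X"
    proof
      fix a assume a: "a \<in> ?Y"
      have "a = (2 * (fst a div 2), snd a) \<or> a = (Suc (2 * (fst a div 2)), snd a)"
        by (cases a; cases "even (fst a)") auto
      then show "a \<in> (\<lambda>a. (2 * fst a, snd a)) ` ?X \<union> (\<lambda>a. (Suc (2 * fst a), snd a)) ` ?X"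
      proof
        assume "a = (2 * (fst a div 2), snd a)"
        then show ?thesis
          by (intro UnI1 image_eqI[of _ _ "?k a"]) (use a in simp_all)
      next
        assume "a = (Suc (2 * (fst a div 2)), snd a)"
        then show ?thesis
          by (intro UnI2 image_eqI[of _ _ "?k a"]) (use a in simp_all)
      qed
    qed
    then show "finite ?Y"
      using column_set_finite[OF X] finite_subset by blast
    show "?Y \<noteq> {}"
      using sec(2) column_set_nonempty[OF X] by blast
    fix c i j assume "(c, j) \<in> ?Y \<and> i \<le> j"
    then show "(c, i) \<in> ?Y"
      using column_set_down[OF X, of "c div 2" j i] by simp
  qed
  have "epimorphism (chains ?Y) (chains ?X) ?k"
  proof (rule chains_epimorphismI)
    fix a b :: "nat \<times> nat"
    show "cle (?k a) (?k b)" if "cle a b"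
      using that by (simp add: cle_def)
    show "cadj (?k a) (?k b)" if "cadj a b"
      using that by (simp add: cadj_def)
    assume ab: "a \<in> ?X" "b \<in> ?X"
    have Y2: "(2 * fst a, snd a) \<in> ?Y" "(2 * fst b, snd b) \<in> ?Y"
      using sec(2) ab by blast+
    show "\<exists>a'\<in>?Y. \<exists>b'\<in>?Y. cle a' b' \<and> ?k a' = a \<and> ?k b' = b" if "cle a b"
    proof -
      have "cle (2 * fst a, snd a) (2 * fst b, snd b)"
        using that by (simp add: cle_def)
      then show ?thesis
        using Y2 sec(1)[of a] sec(1)[of b] by blast
    qed
    show "\<exists>a'\<in>?Y. \<exists>b'\<in>?Y. cadj a' b' \<and> ?k a' = a \<and> ?k b' = b" if "cadj a b"
    proof -
      have "cadj (2 * fst a, snd a) (2 * fst b, snd b)"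
        using that by (simp add: cadj_def)
      then show ?thesis
        using Y2 sec(1)[of a] sec(1)[of b] by blast
    qed
  qed auto
  then show thesis
  proof (rule proj_lift[OF pf Y])
    fix g assume g: "proj g" "g ` S = ?Y" and fg: "\<And>s. s \<in> S \<Longrightarrow> f s = ?k (g s)"
    have vS: "v i \<in> S" if "i \<in> I" for i
      using M that by (simp add: marked_def)
    have "pregood I v g"
      unfolding pregood_def
    proof (intro conjI ballI impI g(1))
      fix i s assume i: "i \<in> I" and s: "s \<in> S" "fst (g s) = fst (g (v i))"
      then have "fst (f s) = fst (f (v i))"
        using fg vS by simp
      then obtain w where w: "w \<in> strand (v i)" "f s = f w"
        using pregood_full[OF f i s(1)] by auto
      then have "fst (g w) = fst (g s)" "snd (g w) = snd (g s)"
      proof -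
        show "fst (g w) = fst (g s)"
          using strand_hom[OF proj_hom[OF g(1)] vS[OF i] w(1)] s(2) by simp
        have "w \<in> S"
          using w(1) strand_sub by blast
        then show "snd (g w) = snd (g s)"
          using w(2) fg[of w] fg[OF s(1)] by simp
      qed
      then show "g s \<in> g ` strand (v i)"
        using w(1) by (metis imageI prod_eq_iff)
    next
      fix i j assume "i \<in> I" "j \<in> I" "fst (g (v i)) = fst (g (v j))"
      then show "i = j"
        using pregood_inj[OF f, of i j] fg vS by simp
    qed
    moreover have "\<exists>t\<in>S. g t = (2 * fst (f s) + e, snd (f s))" if "s \<in> S" "e < 2" for s e
    proof -
      have "(2 * fst (f s) + e, snd (f s)) \<in> ?Y"
        using that by simp
      then have "(2 * fst (f s) + e, snd (f s)) \<in> g ` S"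
        using g(2) by simp
      then show ?thesis by (metis imageE)
    qed
    ultimately show thesis
      using that fg by blast
  qed
qed

end

lemma chains_epi_cadj:
  assumes "epimorphism (chains Y) (chains X) \<psi>" "y \<in> Y" "y' \<in> Y" "cadj y y'"
  shows "cadj (\<psi> y) (\<psi> y')"
proof -
  have "Rrel (chains X) = map_prod \<psi> \<psi> ` Rrel (chains Y)"
    using assms(1) unfolding epimorphism_def by blast
  moreover have "(y, y') \<in> Rrel (chains Y)"
    using assms(2-4) by simp
  ultimately have "(\<psi> y, \<psi> y') \<in> Rrel (chains X)"
    by (metis map_prod_imageI)
  then show ?thesis by simp
qed

lemma chains_epi_cle:
  assumes "epimorphism (chains Y) (chains X) \<psi>" "y \<in> Y" "y' \<in> Y" "cle y y'"
  shows "cle (\<psi> y) (\<psi> y')"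
proof -
  have "Leq (chains X) = map_prod \<psi> \<psi> ` Leq (chains Y)"
    using assms(1) unfolding epimorphism_def by blast
  moreover have "(y, y') \<in> Leq (chains Y)"
    using assms(2-4) by simp
  ultimately have "(\<psi> y, \<psi> y') \<in> Leq (chains X)"
    by (metis map_prod_imageI)
  then show ?thesis by simp
qed

context fraisse_limit
begin

text \<open>All that is required of the new map on one marked column, bundled so that it can be
  chosen for all \<open>i\<close> at once. Only heights are chosen; the column index is that of
  \<open>b\<close>.\<close>

definition column_map where
  "column_map I v f Y \<psi> \<xi> i b g \<longleftrightarrow>
    (\<forall>s\<in>S. fst (\<xi> s) = fst (\<xi> (v i)) \<longrightarrow> (fst b, g (\<xi> s)) \<in> Y \<and> \<psi> (fst b, g (\<xi> s)) = f s) \<and>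
    (\<forall>s\<in>S. \<forall>t\<in>S. fst (\<xi> s) = fst (\<xi> (v i)) \<and> cle (\<xi> s) (\<xi> t) \<longrightarrow> g (\<xi> s) \<le> g (\<xi> t)) \<and>
    (\<forall>s\<in>S. \<forall>t\<in>S. fst (\<xi> s) = fst (\<xi> (v i)) \<and> cadj (\<xi> s) (\<xi> t) \<longrightarrow> g (\<xi> s) \<le> Suc (g (\<xi> t))) \<and>
    (\<forall>s t. (s, t) \<in> Rrel F \<and> s \<in> special I v \<and> fst (\<xi> s) = fst (\<xi> (v i)) \<longrightarrow> g (\<xi> s) = g (\<xi> t)) \<and>
    g (\<xi> (v i)) = snd b \<and> (\<forall>y\<in>Y. fst y = fst b \<longrightarrow> (\<exists>w\<in>strand (v i). g (\<xi> w) = snd y))"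

text \<open>Along the column, \<open>f\<close> becomes a monotone sequence \<open>a\<close> with
  steps of at most one, and the target column another one, \<open>\<beta>\<close>, with the same
  range; \<open>monotone_lift\<close> supplies the heights. Sets \<open>B\<close> from infinite
  fibres provide the free edges. For a one-point component the target column is a single element and
  no climb occurs.\<close>

lemma strand_lift:
  assumes M: "marked I K v" and i: "i \<in> I" and f: "proj f" "collapse I v f"
    and \<xi>: "pregood I v \<xi>" "finer \<xi> f"
    and Y: "column_set Y" and \<psi>: "epimorphism (chains Y) (chains (f ` S)) \<psi>"
    and b: "b \<in> Y" "\<psi> b = f (v i)" "\<psi> ` {y \<in> Y. fst y = fst b} = f ` strand (v i)"
    and sing: "i \<notin> K \<Longrightarrow> {y \<in> Y. fst y = fst b} = {b}"
    and N: "\<And>y. y \<in> Y \<Longrightarrow> snd y \<le> N"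
    and up: "\<And>w. i \<in> K \<Longrightarrow> w \<in> strand (v i) \<Longrightarrow> (v i, w) \<in> Leq F \<Longrightarrow>
      \<exists>B. B \<subseteq> {u \<in> strand (v i). (v i, u) \<in> Leq F \<and> snd (f u) = snd (f w)} \<and> inj_on \<xi> B \<and>
        card B = Suc (N + card (special I v))"
    and down: "\<And>w. i \<in> K \<Longrightarrow> w \<in> strand (v i) \<Longrightarrow> (w, v i) \<in> Leq F \<Longrightarrow>
      \<exists>B. B \<subseteq> {u \<in> strand (v i). (u, v i) \<in> Leq F \<and> snd (f u) = snd (f w)} \<and> inj_on \<xi> B \<and>
        card B = Suc (N + card (special I v))"
  shows "\<exists>g. column_map I v f Y \<psi> \<xi> i b g"
proof -
  have vS: "v i \<in> S"
    using M i by (simp add: marked_def)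
  have pc: "proj \<xi>" and hc: "hom \<xi>" and hf: "hom f"
    using pregood_proj[OF \<xi>(1)] proj_hom f(1) by auto
  define C where "C = fst (\<xi> (v i))"
  have "C \<in> fst ` \<xi> ` S"
    unfolding C_def using vS by blast
  moreover have "column_set (\<xi> ` S)"
    using pc by (simp add: proj_def)
  ultimately obtain n where n: "\<And>m. (C, m) \<in> \<xi> ` S \<longleftrightarrow> m \<le> n"
    using column_set_top by blast
  have "fst b \<in> fst ` Y"
    using b(1) by blast
  then obtain q where q: "\<And>j. (fst b, j) \<in> Y \<longleftrightarrow> j \<le> q"
    using column_set_top[OF Y] by blast
  have "\<exists>w. m \<le> n \<longrightarrow> w \<in> strand (v i) \<and> \<xi> w = (C, m)" for m
  proof (cases "m \<le> n")
    case True
    then obtain s where s: "s \<in> S" "\<xi> s = (C, m)"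
      using n by (metis imageE)
    then have "\<xi> s \<in> \<xi> ` strand (v i)"
      by (intro pregood_full[OF \<xi>(1) i]) (simp_all add: C_def)
    then show ?thesis
      using s(2) by (metis imageE)
  qed simp
  \<comment> \<open>Points of the marked strand at every height of the \<open>\<xi>\<close>-column,
    available because the strand fills it.\<close>
  then obtain w where w: "\<And>m. m \<le> n \<Longrightarrow> w m \<in> strand (v i) \<and> \<xi> (w m) = (C, m)"
    by metis
  have wS: "w m \<in> S" if "m \<le> n" for m
    using w[OF that] strand_sub by blast
  define a where "a m = snd (f (w m))" for m
  define \<beta> where "\<beta> j = snd (\<psi> (fst b, j))" for j
  have cn: "snd (\<xi> s) \<le> n" if "s \<in> S" "fst (\<xi> s) = C" for s
    using n[of "snd (\<xi> s)"] that by (metis imageI prod.collapse)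
  have ceq: "\<xi> s = (C, snd (\<xi> s))" if "fst (\<xi> s) = C" for s
    using that by (simp add: prod_eq_iff)
  have fw: "f (w (snd (\<xi> s))) = f s" if s: "s \<in> S" "fst (\<xi> s) = C" for s
  proof (rule finerD[OF \<xi>(2)])
    show "\<xi> (w (snd (\<xi> s))) = \<xi> s"
      using w[OF cn[OF s]] ceq[OF s(2)] by simp
  qed (use wS[OF cn[OF s]] s in auto)
  have amono: "a m \<le> a m'" if "m \<le> m'" "m' \<le> n" for m m'
  proof -
    have "cle (\<xi> (w m)) (\<xi> (w m'))"
      using w[of m] w[of m'] that by (simp add: cle_def)
    then have "cle (f (w m)) (f (w m'))"
      by (rule finer_cle[OF pc hf \<xi>(2), rotated 2]) (use wS that in auto)
    then show ?thesis by (simp add: a_def cle_def)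
  qed
  have astep: "a (Suc m) \<le> Suc (a m)" if "m < n" for m
  proof -
    have "cadj (\<xi> (w m)) (\<xi> (w (Suc m)))"
      using w[of m] w[of "Suc m"] that by (simp add: cadj_def)
    then have "cadj (f (w m)) (f (w (Suc m)))"
      by (rule finer_cadj[OF pc hf \<xi>(2), rotated 2]) (use wS that in auto)
    then show ?thesis by (simp add: a_def cadj_def)
  qed
  have \<beta>mono: "\<beta> j \<le> \<beta> j'" if "j \<le> j'" "j' \<le> q" for j j'
    using chains_epi_cle[OF \<psi>, of "(fst b, j)" "(fst b, j')"] q that by (simp add: \<beta>_def cle_def)
  have \<beta>step: "\<beta> (Suc j) \<le> Suc (\<beta> j)" if "j < q" for j
    using chains_epi_cadj[OF \<psi>, of "(fst b, j)" "(fst b, Suc j)"] q that by (simp add: \<beta>_def cadj_def)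
  have bq: "snd b \<le> q"
    using q[of "snd b"] b(1) by simp
  have bY: "\<psi> (fst b, j) = (fst (f (v i)), \<beta> j)" if "j \<le> q" for j
  proof -
    have y: "(fst b, j) \<in> Y"
      using q that by simp
    have "cle (fst b, j) b \<or> cle b (fst b, j)"
      by (rule cle_linear) simp
    then have "cle (\<psi> (fst b, j)) (\<psi> b) \<or> cle (\<psi> b) (\<psi> (fst b, j))"
      using chains_epi_cle[OF \<psi> y b(1)] chains_epi_cle[OF \<psi> b(1) y] by blast
    then have "fst (\<psi> (fst b, j)) = fst (\<psi> b)"
      by (auto simp: cle_def)
    then show ?thesis
      by (simp add: \<beta>_def prod_eq_iff b(2))
  qed
  have fa: "f (w m) = (fst (f (v i)), a m)" if "m \<le> n" for m
    using strand_hom[OF hf vS, of "w m"] w[OF that] by (simp add: a_def prod_eq_iff)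
  have range: "\<exists>m\<le>n. a m = \<beta> j" if "j \<le> q" for j
  proof -
    have "\<psi> (fst b, j) \<in> \<psi> ` {y \<in> Y. fst y = fst b}"
      using q that by auto
    then obtain u where u: "u \<in> strand (v i)" "f u = \<psi> (fst b, j)"
      using b(3) by (metis imageE)
    have uS: "u \<in> S" and uC: "fst (\<xi> u) = C"
      using u(1) strand_sub strand_hom[OF hc vS u(1)] by (auto simp: C_def)
    then show ?thesis
      using fw[OF uS uC] u(2) cn[OF uS uC] by (intro exI[of _ "snd (\<xi> u)"]) (simp add: a_def \<beta>_def)
  qed
  have range': "\<exists>j\<le>q. \<beta> j = a m" if "m \<le> n" for m
  proof -
    have "f (w m) \<in> \<psi> ` {y \<in> Y. fst y = fst b}"
      using w[OF that] b(3) by simp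
    then obtain y where y: "y \<in> Y" "fst y = fst b" "f (w m) = \<psi> y" by blast
    then have "y = (fst b, snd y)" by (simp add: prod_eq_iff)
    then show ?thesis
      using q[of "snd y"] y by (intro exI[of _ "snd y"]) (simp add: a_def \<beta>_def)
  qed
  \<comment> \<open>Two monotone sequences with the same range share their least and greatest
    values.\<close>
  have ends: "a 0 = \<beta> 0" "a n = \<beta> q"
  proof -
    obtain m j where "m \<le> n" "a m = \<beta> 0" "j \<le> q" "\<beta> j = a 0"
      using range[of 0] range'[of 0] by auto
    then show "a 0 = \<beta> 0"
      using amono[of 0 m] \<beta>mono[of 0 j] by simp
    obtain m j where "m \<le> n" "a m = \<beta> q" "j \<le> q" "\<beta> j = a n"
      using range[of q] range'[of n] by auto
    then show "a n = \<beta> q"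
      using amono[of m n] \<beta>mono[of j q] by simp
  qed
  \<comment> \<open>The edges of the \<open>\<xi>\<close>-column crossed by special pairs; the
    heights have to stay constant across them.\<close>
  define E where "E = {e. \<exists>s t. s \<in> special I v \<and> (s, t) \<in> Rrel F \<and> \<xi> s = (C, e) \<and> \<xi> t = (C, Suc e)}"
  have Esub: "E \<subseteq> (\<lambda>s. snd (\<xi> s)) ` special I v"
  proof
    fix e assume "e \<in> E"
    then obtain s where "s \<in> special I v" "\<xi> s = (C, e)"
      unfolding E_def by blast
    then show "e \<in> (\<lambda>s. snd (\<xi> s)) ` special I v"
      by (intro image_eqI[of _ _ s]) auto
  qed
  have Efin: "finite E" "card E \<le> card (special I v)"
    using Esub finite_special[OF M] finite_surj surj_card_le by blast+
  have Ea: "a (Suc e) = a e" if "e \<in> E" "e < n" for e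
  proof -
    obtain s t where st: "s \<in> special I v" "(s, t) \<in> Rrel F" "\<xi> s = (C, e)" "\<xi> t = (C, Suc e)"
      using \<open>e \<in> E\<close> unfolding E_def by blast
    have "s \<in> S" "t \<in> S"
      using R_in[OF st(2)] by auto
    moreover have "f s = f t"
      by (rule collapseD[OF f(2) st(2,1)])
    ultimately show ?thesis
      using fw[of s] fw[of t] st(3,4) by (simp add: a_def)
  qed
  define d where "d = snd (\<xi> (v i))"
  have vd: "\<xi> (v i) = (C, d)"
    by (simp add: C_def d_def)
  have dn: "d \<le> n"
    unfolding d_def by (rule cn[OF vS]) (simp add: C_def)
  have db: "a d = \<beta> (snd b)"
    using fw[OF vS] vd b(2) by (simp add: a_def \<beta>_def)
  have qN: "q \<le> N"
    using N[of "(fst b, q)"] q by simp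
  have q0: "q = 0" if "i \<notin> K"
  proof -
    have "(fst b, q) \<in> {y \<in> Y. fst y = fst b}" "(fst b, 0) \<in> {y \<in> Y. fst y = fst b}"
      using q by auto
    then have "(fst b, q) = b" "(fst b, 0) = b"
      unfolding sing[OF that] by auto
    then show ?thesis by (metis snd_conv)
  qed
  \<comment> \<open>Points of one fibre of \<open>f\<close> that \<open>\<xi>\<close> keeps apart
    occupy distinct positions at one level of \<open>a\<close>.\<close>
  have heights: "\<exists>HB. HB \<subseteq> {lo..hi} \<and> (\<forall>h\<in>HB. a h = a m) \<and> card HB = Suc (N + card (special I v))"
    if B: "B \<subseteq> {u \<in> strand (v i). P u \<and> snd (f u) = snd (f x)}" "inj_on \<xi> B"
      "card B = Suc (N + card (special I v))" and x: "snd (f x) = a m"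
      and P: "\<And>u. u \<in> strand (v i) \<Longrightarrow> P u \<Longrightarrow> lo \<le> snd (\<xi> u) \<and> snd (\<xi> u) \<le> hi" for B P x m lo hi
  proof (intro exI[of _ "(\<lambda>u. snd (\<xi> u)) ` B"] conjI ballI)
    have uC: "fst (\<xi> u) = C" "u \<in> S" if "u \<in> B" for u
      using that B(1) strand_hom[OF hc vS] strand_sub by (auto simp: C_def)
    show "(\<lambda>u. snd (\<xi> u)) ` B \<subseteq> {lo..hi}"
      using B(1) P by auto
    have "inj_on (\<lambda>u. snd (\<xi> u)) B"
      using B(2) uC by (auto simp: inj_on_def prod_eq_iff)
    then show "card ((\<lambda>u. snd (\<xi> u)) ` B) = Suc (N + card (special I v))"
      using B(3) by (simp add: card_image)
    fix h assume "h \<in> (\<lambda>u. snd (\<xi> u)) ` B"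
    then obtain u where u: "u \<in> B" "h = snd (\<xi> u)" by blast
    then have "a h = snd (f u)"
      using fw[OF uC(2,1)[OF u(1)]] by (simp add: a_def)
    then show "a h = a m"
      using B(1) u(1) x by auto
  qed
  have chi_le: "snd (\<xi> s) \<le> snd (\<xi> t)" if "(s, t) \<in> Leq F" for s t
    using hom_L[OF hc that] by (simp add: cle_def)
  have chi_n: "snd (\<xi> u) \<le> n" if "u \<in> strand (v i)" for u
    using cn[of u] that strand_sub strand_hom[OF hc vS that] by (auto simp: C_def)
  obtain H where H: "H 0 = 0" "H n = q" "\<And>m. m < n \<Longrightarrow> H m \<le> H (Suc m) \<and> H (Suc m) \<le> Suc (H m)"
    "\<And>e. e \<in> E \<Longrightarrow> e < n \<Longrightarrow> H (Suc e) = H e" "\<And>m. m \<le> n \<Longrightarrow> \<beta> (H m) = a m \<and> H m \<le> q" "H d = snd b"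
  proof (rule monotone_lift[of n a q \<beta> E d "snd b"])
    show "a m \<le> a (Suc m) \<and> a (Suc m) \<le> Suc (a m)" if "m < n" for m
      using amono[of m "Suc m"] astep[OF that] that by simp
    show "\<beta> j \<le> \<beta> (Suc j) \<and> \<beta> (Suc j) \<le> Suc (\<beta> j)" if "j < q" for j
      using \<beta>mono[of j "Suc j"] \<beta>step[OF that] that by simp
    show "q \<le> card {e. d \<le> e \<and> e < n \<and> e \<notin> E \<and> a e = a m \<and> a (Suc e) = a m}"
      if m: "d \<le> m" "m \<le> n" for m
    proof (cases "i \<in> K")
      case True
      \<comment> \<open>At \<open>m = d\<close> the mark itself is taken: \<open>w d\<close> has the
        same \<open>\<xi>\<close>-value but could lie on the other side of it.\<close>
      define x where "x = (if m = d then v i else w m)"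
      have x: "x \<in> strand (v i)" "snd (f x) = a m" "(v i, x) \<in> Leq F"
      proof -
        have "(v i, w m) \<in> Leq F" if "m \<noteq> d"
          by (rule strand_cle[OF hc strand_self[OF vS]]) (use w[OF m(2)] m that vd in auto)
        then show "x \<in> strand (v i)" "snd (f x) = a m" "(v i, x) \<in> Leq F"
          using w[OF m(2)] strand_self[OF vS] L_refl[OF vS] fw[OF vS] vd by (auto simp: x_def a_def)
      qed
      obtain B where B: "B \<subseteq> {u \<in> strand (v i). (v i, u) \<in> Leq F \<and> snd (f u) = snd (f x)}" "inj_on \<xi> B"
          "card B = Suc (N + card (special I v))"
        using up[OF True x(1,3)] by blast
      obtain HB where "HB \<subseteq> {d..n}" "\<forall>h\<in>HB. a h = a m" "card HB = Suc (N + card (special I v))"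
        using heights[OF B x(2), of d n] chi_le[of "v i"] chi_n by (auto simp: d_def)
      then show ?thesis
        by (intro card_free_edges[OF amono _ _ _ Efin qN]) auto
    qed (simp add: q0)
    show "q \<le> card {e. e < d \<and> e \<notin> E \<and> a e = a m \<and> a (Suc e) = a m}" if m: "m \<le> d" for m
    proof (cases "i \<in> K")
      case True
      have mn: "m \<le> n"
        using m dn by simp
      define x where "x = (if m = d then v i else w m)"
      have x: "x \<in> strand (v i)" "snd (f x) = a m" "(x, v i) \<in> Leq F"
      proof -
        have "(w m, v i) \<in> Leq F" if "m \<noteq> d"
          by (rule strand_cle[OF hc _ strand_self[OF vS]]) (use w[OF mn] m that vd in auto)
        then show "x \<in> strand (v i)" "snd (f x) = a m" "(x, v i) \<in> Leq F"
          using w[OF mn] strand_self[OF vS] L_refl[OF vS] fw[OF vS] vd by (auto simp: x_def a_def)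
      qed
      obtain B where B: "B \<subseteq> {u \<in> strand (v i). (u, v i) \<in> Leq F \<and> snd (f u) = snd (f x)}" "inj_on \<xi> B"
          "card B = Suc (N + card (special I v))"
        using down[OF True x(1,3)] by blast
      obtain HB where HB: "HB \<subseteq> {0..d}" "\<forall>h\<in>HB. a h = a m" "card HB = Suc (N + card (special I v))"
        using heights[OF B x(2), of 0 d] chi_le[of _ "v i"] by (auto simp: d_def)
      have "a h \<le> a h'" if "h \<le> h'" "h' \<le> d" for h h'
        using amono that dn by simp
      then have "q \<le> card {e. 0 \<le> e \<and> e < d \<and> e \<notin> E \<and> a e = a m \<and> a (Suc e) = a m}"
        by (rule card_free_edges[OF _ _ _ _ Efin qN]) (use HB in auto)
      then show ?thesis by simp
    qed (simp add: q0)
  qed (use ends Ea dn bq db in auto)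
  have Hmono: "H m \<le> H m'" if "m \<le> m'" "m' \<le> n" for m m'
    using that
  proof (induction m' rule: dec_induct)
    case (step j)
    then show ?case using H(3)[of j] by auto
  qed simp
  have Hsurj: "j \<le> H m \<Longrightarrow> m \<le> n \<Longrightarrow> \<exists>m'\<le>m. H m' = j" for j m
  proof (induction m)
    case 0
    then show ?case using H(1) by auto
  next
    case (Suc m)
    then show ?case
      using H(3)[of m] by (cases "j \<le> H m") (auto simp: le_Suc_eq)
  qed
  define g where "g x = H (snd x)" for x :: "nat \<times> nat"
  show ?thesis
    unfolding column_map_def
  proof (intro exI[of _ g] conjI ballI allI impI; (elim conjE)?)
    fix s assume s: "s \<in> S" "fst (\<xi> s) = fst (\<xi> (v i))"
    then have sC: "fst (\<xi> s) = C" by (simp add: C_def)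
    have le: "H (snd (\<xi> s)) \<le> q" "\<beta> (H (snd (\<xi> s))) = a (snd (\<xi> s))"
      using H(5)[OF cn[OF s(1) sC]] by auto
    then show "(fst b, g (\<xi> s)) \<in> Y"
      using q by (simp add: g_def)
    show "\<psi> (fst b, g (\<xi> s)) = f s"
      using bY[OF le(1)] le(2) fa[OF cn[OF s(1) sC]] fw[OF s(1) sC] by (simp add: g_def)
  next
    fix s t assume st: "s \<in> S" "t \<in> S" "fst (\<xi> s) = fst (\<xi> (v i))" "cle (\<xi> s) (\<xi> t)"
    then have "fst (\<xi> t) = C" "snd (\<xi> s) \<le> snd (\<xi> t)"
      by (auto simp: cle_def C_def)
    then show "g (\<xi> s) \<le> g (\<xi> t)"
      using Hmono cn[OF st(2)] by (simp add: g_def)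
  next
    fix s t assume st: "s \<in> S" "t \<in> S" "fst (\<xi> s) = fst (\<xi> (v i))" "cadj (\<xi> s) (\<xi> t)"
    then have C: "fst (\<xi> t) = C" "fst (\<xi> s) = C" "snd (\<xi> s) \<le> Suc (snd (\<xi> t))"
      by (auto simp: cadj_def C_def)
    have sn: "snd (\<xi> s) \<le> n" "snd (\<xi> t) \<le> n"
      using cn st C by auto
    show "g (\<xi> s) \<le> Suc (g (\<xi> t))"
    proof (cases "snd (\<xi> s) \<le> snd (\<xi> t)")
      case True
      then show ?thesis using Hmono[OF True sn(2)] by (simp add: g_def)
    next
      case False
      then have "snd (\<xi> s) = Suc (snd (\<xi> t))" "snd (\<xi> t) < n"
        using C(3) sn by auto
      then show ?thesis using H(3)[of "snd (\<xi> t)"] by (simp add: g_def)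
    qed
  next
    fix s t assume st: "(s, t) \<in> Rrel F" "s \<in> special I v" "fst (\<xi> s) = fst (\<xi> (v i))"
    have S: "s \<in> S" "t \<in> S"
      using R_in[OF st(1)] by auto
    have adj: "cadj (\<xi> s) (\<xi> t)"
      by (rule hom_R[OF hc st(1)])
    then have C: "fst (\<xi> t) = C" "fst (\<xi> s) = C"
      using st(3) by (auto simp: cadj_def C_def)
    have sn: "snd (\<xi> s) \<le> n" "snd (\<xi> t) \<le> n"
      using cn S C by auto
    consider "snd (\<xi> s) = snd (\<xi> t)" | "snd (\<xi> t) = Suc (snd (\<xi> s))" | "snd (\<xi> s) = Suc (snd (\<xi> t))"
      using adj unfolding cadj_def by linarith
    then show "g (\<xi> s) = g (\<xi> t)"
    proof cases
      case 2
      then have "\<xi> s = (C, snd (\<xi> s))" "\<xi> t = (C, Suc (snd (\<xi> s)))"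
        using C by (simp_all add: prod_eq_iff)
      then have "snd (\<xi> s) \<in> E"
        unfolding E_def using st(1,2) by blast
      then show ?thesis
        using H(4)[of "snd (\<xi> s)"] 2 sn by (simp add: g_def)
    next
      case 3
      then have "\<xi> t = (C, snd (\<xi> t))" "\<xi> s = (C, Suc (snd (\<xi> t)))"
        using C by (simp_all add: prod_eq_iff)
      then have "snd (\<xi> t) \<in> E"
        unfolding E_def using R_sym[OF st(1)] special_R[OF st(2,1)] by blast
      then show ?thesis
        using H(4)[of "snd (\<xi> t)"] 3 sn by (simp add: g_def)
    qed (simp add: g_def)
  next
    show "g (\<xi> (v i)) = snd b"
      using H(6) vd by (simp add: g_def)
  next
    fix y assume y: "y \<in> Y" "fst y = fst b"
    then have "snd y \<le> q"
      using q[of "snd y"] by (metis prod.collapse)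
    then obtain m where "m \<le> n" "H m = snd y"
      using Hsurj[of "snd y" n] H(2) by auto
    then show "\<exists>w\<in>strand (v i). g (\<xi> w) = snd y"
      using w[of m] by (intro bexI[of _ "w m"]) (auto simp: g_def)
  qed
qed

text \<open>\<open>g0\<close> is the lift given by the extension axiom, uncontrolled at the marks.
  On the marked columns of a sufficiently fine \<open>\<xi>\<close> it is replaced by the maps from
  \<open>strand_lift\<close>; the unmarked copies of columns keep \<open>g0\<close> and keep the
  result surjective.\<close>

lemma good_lift:
  assumes M: "marked I K v" and f: "proj f" "collapse I v f"
    and Y: "column_set Y" and \<psi>: "epimorphism (chains Y) (chains (f ` S)) \<psi>"
    and b: "\<And>i. i \<in> I \<Longrightarrow> b i \<in> Y" "\<And>i. i \<in> I \<Longrightarrow> \<psi> (b i) = f (v i)"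
      "\<And>i. i \<in> I \<Longrightarrow> \<psi> ` {y \<in> Y. fst y = fst (b i)} = f ` strand (v i)"
    and binj: "\<And>i j. i \<in> I \<Longrightarrow> j \<in> I \<Longrightarrow> fst (b i) = fst (b j) \<Longrightarrow> i = j"
    and sing: "\<And>i. i \<in> I \<Longrightarrow> i \<notin> K \<Longrightarrow> {y \<in> Y. fst y = fst (b i)} = {b i}"
  obtains g where "pregood I v g" "collapse I v g" "g ` S = Y" "\<And>s. s \<in> S \<Longrightarrow> f s = \<psi> (g s)"
    "\<And>i. i \<in> I \<Longrightarrow> g (v i) = b i"
proof -
  have finI: "finite I" and KI: "K \<subseteq> I" and vS: "\<And>i. i \<in> I \<Longrightarrow> v i \<in> S"
    using M by (auto simp: marked_def)
  have hf: "hom f"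
    by (rule proj_hom[OF f(1)])
  define N where "N = Max (snd ` Y)"
  have N: "snd y \<le> N" if "y \<in> Y" for y
    unfolding N_def using that column_set_finite[OF Y] by (intro Max_ge) auto
  \<comment> \<open>So many positions at one level that \<open>N\<close> edges remain after removing
    those crossed by special pairs; \<open>N\<close> bounds the height of every target
    column.\<close>
  define n where "n = Suc (N + card (special I v))"
  obtain g0 where g0: "proj g0" "g0 ` S = Y" "\<And>s. s \<in> S \<Longrightarrow> f s = \<psi> (g0 s)"
    using proj_lift[OF f(1) Y \<psi>] by blast
  have g0f: "finer g0 f"
    unfolding finer_def using g0(3) by simp
  define AU where "AU i z = {u \<in> strand (v i). (v i, u) \<in> Leq F \<and> snd (f u) = z}" for i z
  define AD where "AD i z = {u \<in> strand (v i). (u, v i) \<in> Leq F \<and> snd (f u) = z}" for i z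
  \<comment> \<open>\<open>sel\<close> picks \<open>n\<close> points from every infinite set. Their
    union \<open>BB\<close> over the relevant fibres is finite, so a refinement can be made
    injective on it.\<close>
  have "\<forall>A. \<exists>B. if infinite (A :: 'a set) then B \<subseteq> A \<and> finite B \<and> card B = n else B = {}"
    using infinite_arbitrarily_large by (metis (full_types))
  from choice[OF this] obtain sel :: "'a set \<Rightarrow> 'a set" where
    sel: "\<And>A. if infinite A then sel A \<subseteq> A \<and> finite (sel A) \<and> card (sel A) = n else sel A = {}"
    by blast
  have sel_sub: "sel A \<subseteq> A" "finite (sel A)" for A
    using sel[of A] by (auto split: if_splits)
  define BB where "BB = (\<Union>i\<in>K. \<Union>z\<in>(\<lambda>s. snd (f s)) ` S. sel (AU i z) \<union> sel (AD i z))"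
  have "finite ((\<lambda>s. snd (f s)) ` S)"
    using lc_finite_image[OF lc_comp[OF proj_lc[OF f(1)]]] .
  then have "finite BB"
    unfolding BB_def using sel_sub(2) finite_subset[OF KI finI] by blast
  moreover have "BB \<subseteq> S"
  proof -
    have "AU i z \<subseteq> S" "AD i z \<subseteq> S" for i z
      using strand_sub by (auto simp: AU_def AD_def)
    then show ?thesis
      unfolding BB_def using sel_sub(1) by blast
  qed
  ultimately obtain f0 where f0: "proj f0" "inj_on f0 BB" "finer f0 g0"
    using separate_finite[OF _ _ proj_lc[OF g0(1)]] by blast
  obtain f1 where f1: "pregood I v f1" "finer f1 f0"
    by (rule pregood_refine[OF M proj_lc[OF f0(1)]])
  obtain \<xi> where \<xi>: "pregood I v \<xi>" "\<And>s. s \<in> S \<Longrightarrow> f1 s = (fst (\<xi> s) div 2, snd (\<xi> s))"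
      "\<And>s e. s \<in> S \<Longrightarrow> e < 2 \<Longrightarrow> \<exists>t\<in>S. \<xi> t = (2 * fst (f1 s) + e, snd (f1 s))"
    by (rule duplicate_columns[OF f1(1) M]) blast
  have p1: "proj f1" "proj \<xi>" and hx: "hom \<xi>"
    using pregood_proj[OF f1(1)] pregood_proj[OF \<xi>(1)] proj_hom by auto
  have \<xi>f1: "finer \<xi> f1"
    unfolding finer_def using \<xi>(2) by simp
  have f1g0: "finer f1 g0"
    by (rule finer_trans[OF f1(2) f0(3)])
  have \<xi>g0: "finer \<xi> g0"
    by (rule finer_trans[OF \<xi>f1 f1g0])
  have \<xi>f: "finer \<xi> f"
    by (rule finer_trans[OF \<xi>g0 g0f])
  have injB: "inj_on \<xi> BB"
  proof (rule inj_onI)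
    fix s t assume st: "s \<in> BB" "t \<in> BB" "\<xi> s = \<xi> t"
    then have "f0 s = f0 t"
      using finerD[OF finer_trans[OF \<xi>f1 f1(2)]] \<open>BB \<subseteq> S\<close> by blast
    then show "s = t"
      using f0(2) st by (simp add: inj_on_eq_iff)
  qed
  have "\<forall>i\<in>I. \<exists>g. column_map I v f Y \<psi> \<xi> i (b i) g"
  proof
    fix i assume i: "i \<in> I"
    have big: "\<exists>B. B \<subseteq> A \<and> inj_on \<xi> B \<and> card B = Suc (N + card (special I v))"
      if "infinite A" "sel A \<subseteq> BB" for A
      using sel[of A] that inj_on_subset[OF injB that(2)] unfolding n_def by (intro exI[of _ "sel A"]) auto
    show "\<exists>g. column_map I v f Y \<psi> \<xi> i (b i) g"
    proof (rule strand_lift[OF M i f \<xi>(1) \<xi>f Y \<psi> b(1)[OF i] b(2)[OF i] b(3)[OF i] sing[OF i] N])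
      fix w assume iK: "i \<in> K" and w: "w \<in> strand (v i)"
      have wS: "w \<in> S"
        using w strand_sub by blast
      show "\<exists>B. B \<subseteq> {u \<in> strand (v i). (v i, u) \<in> Leq F \<and> snd (f u) = snd (f w)} \<and> inj_on \<xi> B \<and>
          card B = Suc (N + card (special I v))" if "(v i, w) \<in> Leq F"
      proof (rule big)
        show "infinite {u \<in> strand (v i). (v i, u) \<in> Leq F \<and> snd (f u) = snd (f w)}"
          by (rule infinite_fibre(1)[OF M iK f w that])
        show "sel {u \<in> strand (v i). (v i, u) \<in> Leq F \<and> snd (f u) = snd (f w)} \<subseteq> BB"
          unfolding BB_def AU_def using iK wS by blast
      qed
      show "\<exists>B. B \<subseteq> {u \<in> strand (v i). (u, v i) \<in> Leq F \<and> snd (f u) = snd (f w)} \<and> inj_on \<xi> B \<and>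
          card B = Suc (N + card (special I v))" if "(w, v i) \<in> Leq F"
      proof (rule big)
        show "infinite {u \<in> strand (v i). (u, v i) \<in> Leq F \<and> snd (f u) = snd (f w)}"
          by (rule infinite_fibre(2)[OF M iK f w that])
        show "sel {u \<in> strand (v i). (u, v i) \<in> Leq F \<and> snd (f u) = snd (f w)} \<subseteq> BB"
          unfolding BB_def AD_def using iK wS by blast
      qed
    qed
  qed
  from bchoice[OF this] obtain H where "\<forall>i\<in>I. column_map I v f Y \<psi> \<xi> i (b i) (H i)"
    by (elim exE)
  note H = bspec[OF this, unfolded column_map_def]
  have HY: "(fst (b i), H i (\<xi> s)) \<in> Y" and H\<psi>: "\<psi> (fst (b i), H i (\<xi> s)) = f s"
    if "i \<in> I" "s \<in> S" "fst (\<xi> s) = fst (\<xi> (v i))" for i s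
    using H[OF that(1), THEN conjunct1, rule_format, OF that(2,3)] by auto
  have Hle: "H i (\<xi> s) \<le> H i (\<xi> t)"
    if "i \<in> I" "s \<in> S" "t \<in> S" "fst (\<xi> s) = fst (\<xi> (v i))" "cle (\<xi> s) (\<xi> t)" for i s t
    using H[OF that(1), THEN conjunct2, THEN conjunct1, rule_format, OF that(2,3) conjI[OF that(4,5)]] .
  have Hadj: "H i (\<xi> s) \<le> Suc (H i (\<xi> t))"
    if "i \<in> I" "s \<in> S" "t \<in> S" "fst (\<xi> s) = fst (\<xi> (v i))" "cadj (\<xi> s) (\<xi> t)" for i s t
    using H[OF that(1), THEN conjunct2, THEN conjunct2, THEN conjunct1, rule_format, OF that(2,3) conjI[OF that(4,5)]] .
  have Hcoll: "H i (\<xi> s) = H i (\<xi> t)"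
    if "i \<in> I" "(s, t) \<in> Rrel F" "s \<in> special I v" "fst (\<xi> s) = fst (\<xi> (v i))" for i s t
    using H[OF that(1), THEN conjunct2, THEN conjunct2, THEN conjunct2, THEN conjunct1, rule_format,
        OF conjI[OF that(2) conjI[OF that(3,4)]]] .
  have Hv: "H i (\<xi> (v i)) = snd (b i)" if "i \<in> I" for i
    using H[OF that, THEN conjunct2, THEN conjunct2, THEN conjunct2, THEN conjunct2, THEN conjunct1] .
  have Hsurj: "\<exists>w\<in>strand (v i). H i (\<xi> w) = snd y" if "i \<in> I" "y \<in> Y" "fst y = fst (b i)" for i y
    using H[OF that(1), THEN conjunct2, THEN conjunct2, THEN conjunct2, THEN conjunct2, THEN conjunct2,
        rule_format, OF that(2,3)] .
  \<comment> \<open>\<open>a0\<close> and \<open>b0\<close> have \<open>g0\<close>-values spanning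
    the column of \<open>y\<close>, and \<open>e\<close> selects the unmarked copy of their
    \<open>f1\<close>-column. A strand sweeping that copy goes at least as far down and up under
    \<open>f1\<close>, hence under the coarser \<open>g0\<close>.\<close>
  have spare: "\<exists>a b. (a, b) \<in> Leq F \<and> fst (g0 a) = fst y \<and> snd (g0 a) = 0 \<and>
      (\<forall>t\<in>Y. fst t = fst y \<longrightarrow> snd t \<le> snd (g0 b)) \<and> (\<forall>i\<in>I. fst (\<xi> a) \<noteq> fst (\<xi> (v i)))"
    if y: "y \<in> Y" for y
  proof -
    obtain s where s: "s \<in> S" "g0 s = y"
      using y g0(2) by blast
    obtain a0 b0 where ab0: "(a0, b0) \<in> Leq F" "fst (g0 a0) = fst (g0 s)" "snd (g0 a0) = 0"
        "\<And>t. t \<in> S \<Longrightarrow> fst (g0 t) = fst (g0 s) \<Longrightarrow> snd (g0 t) \<le> snd (g0 b0)"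
      by (rule proj_full[OF g0(1) s(1)]) blast
    have S0: "a0 \<in> S" "b0 \<in> S"
      using L_in[OF ab0(1)] by auto
    have d: "fst (f1 b0) = fst (f1 a0)"
      using hom_L_fst[OF proj_hom[OF p1(1)] ab0(1)] by simp
    have "\<exists>e<2. \<forall>i\<in>I. 2 * fst (f1 a0) + e \<noteq> fst (\<xi> (v i))"
    proof (rule ccontr)
      assume "\<not> ?thesis"
      then obtain i j where ij: "i \<in> I" "2 * fst (f1 a0) + 0 = fst (\<xi> (v i))"
          "j \<in> I" "2 * fst (f1 a0) + 1 = fst (\<xi> (v j))"
        by (metis one_less_numeral_iff semiring_norm(76) zero_less_numeral)
      then have "fst (f1 (v i)) = fst (f1 a0)" "fst (f1 (v j)) = fst (f1 a0)"
        using \<xi>(2) vS by (simp_all flip: ij(2,4))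
      then have "i = j"
        by (intro pregood_inj[OF f1(1) ij(1,3)]) simp
      then show False
        using ij by simp
    qed
    then obtain e where e: "e < 2" "\<And>i. i \<in> I \<Longrightarrow> 2 * fst (f1 a0) + e \<noteq> fst (\<xi> (v i))"
      by blast
    obtain ta tb where ta: "ta \<in> S" "\<xi> ta = (2 * fst (f1 a0) + e, snd (f1 a0))"
      and tb: "tb \<in> S" "\<xi> tb = (2 * fst (f1 a0) + e, snd (f1 b0))"
      using \<xi>(3)[OF S0(1) e(1)] \<xi>(3)[OF S0(2) e(1)] d by auto
    obtain a b where ab: "(a, b) \<in> Leq F" "fst (\<xi> a) = fst (\<xi> ta)" "snd (\<xi> a) = 0"
        "\<And>t. t \<in> S \<Longrightarrow> fst (\<xi> t) = fst (\<xi> ta) \<Longrightarrow> snd (\<xi> t) \<le> snd (\<xi> b)"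
      by (rule proj_full[OF p1(2) ta(1)]) blast
    have S: "a \<in> S" "b \<in> S"
      using L_in[OF ab(1)] by auto
    have bta: "fst (\<xi> b) = fst (\<xi> ta)"
      using hom_L_fst[OF hx ab(1)] ab(2) by simp
    have e2: "(2 * fst (f1 a0) + e) div 2 = fst (f1 a0)"
      using e(1) by simp
    have "cle (f1 a) (f1 a0)"
      using \<xi>(2)[OF S(1)] ab(2,3) ta(2) e2 by (simp add: cle_def)
    then have ga: "cle (g0 a) (g0 a0)"
      by (rule finer_cle[OF p1(1) proj_hom[OF g0(1)] f1g0 S(1) S0(1)])
    have "snd (f1 b0) \<le> snd (\<xi> b)"
      using ab(4)[OF tb(1)] ta(2) tb(2) by simp
    then have "cle (f1 b0) (f1 b)"
      using \<xi>(2)[OF S(2)] bta ta(2) e2 d by (simp add: cle_def)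
    then have gb: "cle (g0 b0) (g0 b)"
      by (rule finer_cle[OF p1(1) proj_hom[OF g0(1)] f1g0 S0(2) S(2)])
    have "snd t \<le> snd (g0 b)" if t: "t \<in> Y" "fst t = fst y" for t
    proof -
      obtain t' where "t' \<in> S" "g0 t' = t"
        using t(1) g0(2) by blast
      then have "snd t \<le> snd (g0 b0)"
        using ab0(4)[of t'] t(2) s(2) by simp
      then show ?thesis
        using gb by (simp add: cle_def)
    qed
    then show ?thesis
      using ab(1,2) ga ab0(2,3) s(2) e(2) ta(2)
      by (intro exI[of _ a] exI[of _ b]) (auto simp: cle_def)
  qed
  define CC where "CC = (\<lambda>i. fst (\<xi> (v i))) ` I"
  define idx where "idx c = (SOME i. i \<in> I \<and> fst (\<xi> (v i)) = c)" for c
  have idx: "idx (fst (\<xi> (v i))) = i" if "i \<in> I" for i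
    unfolding idx_def by (rule some_equality) (use that pregood_inj[OF \<xi>(1)] in auto)
  define g where "g w = (if fst (\<xi> w) \<in> CC then
      (fst (b (idx (fst (\<xi> w)))), H (idx (fst (\<xi> w))) (\<xi> w)) else g0 w)" for w
  have gin: "g w = (fst (b i), H i (\<xi> w))" if "i \<in> I" "fst (\<xi> w) = fst (\<xi> (v i))" for i w
    using that idx[OF that(1)] by (auto simp: g_def CC_def)
  have gout: "g w = g0 w" if "\<And>i. i \<in> I \<Longrightarrow> fst (\<xi> w) \<noteq> fst (\<xi> (v i))" for w
    using that by (auto simp: g_def CC_def)
  have cases: "(\<exists>i\<in>I. fst (\<xi> w) = fst (\<xi> (v i))) \<or> (\<forall>i\<in>I. fst (\<xi> w) \<noteq> fst (\<xi> (v i)))" for w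
    by blast
  have gY: "g w \<in> Y" and fg: "f w = \<psi> (g w)" if "w \<in> S" for w
    using cases[of w] gin gout HY H\<psi> that g0(2,3) by fastforce+
  have strand_\<xi>: "fst (\<xi> w) = fst (\<xi> (v i))" if "i \<in> I" "w \<in> strand (v i)" for i w
    by (rule strand_hom[OF hx vS[OF that(1)] that(2)])
  have lcg: "lc g"
    using lc_comp[OF lc_pair[OF proj_lc[OF p1(2)] proj_lc[OF g0(1)]], of
        "\<lambda>(x, y). if fst x \<in> CC then (fst (b (idx (fst x))), H (idx (fst x)) x) else y"]
    by (simp add: g_def[abs_def])
  have g_adj: "cadj (g s) (g t)" if st: "(s, t) \<in> Rrel F" for s t
  proof -
    have S: "s \<in> S" "t \<in> S"
      using R_in[OF st] by auto
    have adj: "cadj (\<xi> s) (\<xi> t)"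
      by (rule hom_R[OF hx st])
    then have fst: "fst (\<xi> s) = fst (\<xi> t)" by (simp add: cadj_def)
    from cases[of s] show ?thesis
    proof
      assume "\<exists>i\<in>I. fst (\<xi> s) = fst (\<xi> (v i))"
      then obtain i where i: "i \<in> I" "fst (\<xi> s) = fst (\<xi> (v i))" "fst (\<xi> t) = fst (\<xi> (v i))"
        using fst by auto
      show ?thesis
        using Hadj[OF i(1) S i(2) adj] Hadj[OF i(1) S(2,1) i(3) cadj_sym[OF adj]]
        by (simp add: gin[OF i(1,2)] gin[OF i(1,3)] cadj_def)
    next
      assume "\<forall>i\<in>I. fst (\<xi> s) \<noteq> fst (\<xi> (v i))"
      then have "g s = g0 s" "g t = g0 t"
        using gout fst by auto
      then show ?thesis
        using hom_R[OF proj_hom[OF g0(1)] st] by simp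
    qed
  qed
  have g_le: "cle (g s) (g t)" if st: "(s, t) \<in> Leq F" for s t
  proof -
    have S: "s \<in> S" "t \<in> S"
      using L_in[OF st] by auto
    have le: "cle (\<xi> s) (\<xi> t)"
      by (rule hom_L[OF hx st])
    then have fst: "fst (\<xi> s) = fst (\<xi> t)" by (simp add: cle_def)
    from cases[of s] show ?thesis
    proof
      assume "\<exists>i\<in>I. fst (\<xi> s) = fst (\<xi> (v i))"
      then obtain i where i: "i \<in> I" "fst (\<xi> s) = fst (\<xi> (v i))" "fst (\<xi> t) = fst (\<xi> (v i))"
        using fst by auto
      show ?thesis
        using Hle[OF i(1) S i(2) le]
        by (simp add: gin[OF i(1,2)] gin[OF i(1,3)] cle_def)
    next
      assume "\<forall>i\<in>I. fst (\<xi> s) \<noteq> fst (\<xi> (v i))"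
      then have "g s = g0 s" "g t = g0 t"
        using gout fst by auto
      then show ?thesis
        using hom_L[OF proj_hom[OF g0(1)] st] by simp
    qed
  qed
  have homg: "hom g"
    unfolding hom_def using lcg g_adj g_le by blast
  \<comment> \<open>On the spare strands \<open>g\<close> is still \<open>g0\<close>, so they sweep
    every column of \<open>Y\<close>, as \<open>hom_imp_proj\<close> demands.\<close>
  have covered: "\<exists>a b. (a, b) \<in> Leq F \<and> fst (g a) = fst y \<and> snd (g a) = 0 \<and>
      fst (g b) = fst y \<and> (\<forall>t\<in>Y. fst t = fst y \<longrightarrow> snd t \<le> snd (g b))" if y: "y \<in> Y" for y
  proof -
    obtain a b where ab: "(a, b) \<in> Leq F" "fst (g0 a) = fst y" "snd (g0 a) = 0"
      "\<forall>t\<in>Y. fst t = fst y \<longrightarrow> snd t \<le> snd (g0 b)" "\<forall>i\<in>I. fst (\<xi> a) \<noteq> fst (\<xi> (v i))"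
      using spare[OF y] by blast
    have "fst (\<xi> b) = fst (\<xi> a)"
      using hom_L_fst[OF hx ab(1)] by simp
    then have "g a = g0 a" "g b = g0 b"
      using gout ab(5) by auto
    then show ?thesis
      using ab hom_L_fst[OF homg ab(1)] by (intro exI[of _ a] exI[of _ b]) auto
  qed
  have pg: "proj g"
  proof (rule hom_imp_proj[OF homg])
    fix s assume "s \<in> S"
    then show "\<exists>a b. (a, b) \<in> Leq F \<and> fst (g a) = fst (g s) \<and> snd (g a) = 0 \<and>
        (\<forall>t\<in>S. fst (g t) = fst (g s) \<longrightarrow> snd (g t) \<le> snd (g b))"
      using covered[OF gY] gY by blast
  qed
  have gS: "g ` S = Y"
  proof
    show "g ` S \<subseteq> Y" using gY by blast
    show "Y \<subseteq> g ` S"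
    proof
      fix y assume y: "y \<in> Y"
      then obtain a b where ab: "(a, b) \<in> Leq F" "fst (g b) = fst y" "snd y \<le> snd (g b)"
        using covered by blast
      have "b \<in> S"
        using L_in[OF ab(1)] by simp
      moreover have "g b = (fst y, snd (g b))"
        using ab(2) by (simp add: prod_eq_iff)
      ultimately obtain w where "w \<in> S" "g w = (fst y, snd y)"
        using ab(3) by (rule proj_down[OF pg])
      then show "y \<in> g ` S"
        by (metis imageI prod.collapse)
    qed
  qed
  have gv: "g (v i) = b i" if "i \<in> I" for i
    using gin[OF that] Hv[OF that] by (simp add: prod_eq_iff)
  have "pregood I v g"
    unfolding pregood_def
  proof (intro conjI ballI impI pg)
    fix i s assume i: "i \<in> I" and s: "s \<in> S" "fst (g s) = fst (g (v i))"
    then have "fst (g s) = fst (b i)"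
      using gv by simp
    then obtain w where w: "w \<in> strand (v i)" "H i (\<xi> w) = snd (g s)"
      using Hsurj[OF i gY[OF s(1)]] by blast
    then have "g w = g s"
      using gin[OF i strand_\<xi>[OF i w(1)]] \<open>fst (g s) = fst (b i)\<close> by (simp add: prod_eq_iff)
    then show "g s \<in> g ` strand (v i)"
      using w(1) by (metis imageI)
  next
    fix i j assume "i \<in> I" "j \<in> I" "fst (g (v i)) = fst (g (v j))"
    then show "i = j"
      using binj gv by simp
  qed
  moreover have "collapse I v g"
  proof (rule collapseI)
    fix s t assume st: "(s, t) \<in> Rrel F" "s \<in> special I v"
    obtain i where i: "i \<in> I" "s \<in> strand (v i)"
      using special_in[OF M] st(2) by blast
    have "t \<in> strand (v i)"
      using R_strand[OF st(1)] strand_eq[OF i(2)] by simp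
    then show "g s = g t"
      using Hcoll[OF i(1) st strand_\<xi>[OF i]] gin[OF i(1)] strand_\<xi>[OF i(1)] i(2) by simp
  qed
  ultimately show thesis
    using that gS fg gv by blast
qed

end

section \<open>Back and forth\<close>

context fraisse_limit
begin

text \<open>Restricted to collapsed clopen sets, because a map that collapses special classes can
  decide no others.\<close>

definition decides :: "nat set \<Rightarrow> (nat \<Rightarrow> 'a) \<Rightarrow> (nat \<Rightarrow> 'a \<Rightarrow> nat \<times> nat) \<Rightarrow> bool" where
  "decides I v f \<longleftrightarrow> (\<forall>U. openin (Top F) U \<and> closedin (Top F) U \<and> collapse I v (\<lambda>s. s \<in> U) \<longrightarrow>
     (\<exists>n. finer (f n) (\<lambda>s. s \<in> U)))"

text \<open>Phrased with \<open>proj\<close> rather than \<open>pregood\<close>, since the constant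
  maps that start the construction put all marks into one column. The clause on strands is what
  \<open>good_lift\<close> requires when a refinement is carried to the other side.\<close>

definition match where
  "match I u v f g \<longleftrightarrow> proj f \<and> proj g \<and> collapse I u f \<and> collapse I v g \<and> f ` S = g ` S \<and>
     (\<forall>i\<in>I. f (u i) = g (v i) \<and> f ` strand (u i) = g ` strand (v i))"

lemma match_sym: "match I u v f g \<Longrightarrow> match I v u g f"
  by (auto simp: match_def)

lemma pregood_column:
  assumes M: "marked I K v" and f: "pregood I v f" and i: "i \<in> I"
  shows "{y \<in> f ` S. fst y = fst (f (v i))} = f ` strand (v i)"
proof
  show "{y \<in> f ` S. fst y = fst (f (v i))} \<subseteq> f ` strand (v i)"
    using pregood_full[OF f i] by blast
  have "v i \<in> S"
    using M i by (simp add: marked_def)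
  then show "f ` strand (v i) \<subseteq> {y \<in> f ` S. fst y = fst (f (v i))}"
    using strand_hom[OF proj_hom[OF pregood_proj[OF f]]] strand_sub by blast
qed

text \<open>Refine \<open>f\<close> to an adapted \<open>f'\<close> that decides \<open>U\<close>,
  write \<open>f\<close> as \<open>\<psi>\<close> after \<open>f'\<close>, and lift \<open>g\<close>
  along the same \<open>\<psi>\<close>, sending each \<open>v i\<close> to the value of
  \<open>f'\<close> at \<open>u i\<close>.\<close>

lemma match_forth:
  assumes M: "marked I K u" "marked I K v" and m: "match I u v f g"
    and U: "openin (Top F) U" "closedin (Top F) U" "collapse I u (\<lambda>s. s \<in> U)"
  shows "\<exists>f' g' \<psi>. match I u v f' g' \<and> (\<forall>s\<in>S. f s = \<psi> (f' s) \<and> g s = \<psi> (g' s)) \<and>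
    finer f' (\<lambda>s. s \<in> U)"
proof -
  have pf: "proj f" "proj g" and cf: "collapse I u f" "collapse I v g" and im: "f ` S = g ` S"
    and uv: "\<And>i. i \<in> I \<Longrightarrow> f (u i) = g (v i)" "\<And>i. i \<in> I \<Longrightarrow> f ` strand (u i) = g ` strand (v i)"
    using m by (auto simp: match_def)
  have uS: "u i \<in> S" if "i \<in> I" for i
    using M(1) that by (simp add: marked_def)
  have "collapse I u (\<lambda>s. (f s, s \<in> U))"
    using cf(1) U(3) unfolding collapse_def by blast
  then obtain f' where f': "pregood I u f'" "collapse I u f'" "finer f' (\<lambda>s. (f s, s \<in> U))"
    using good_refine[OF M(1) lc_pair[OF proj_lc[OF pf(1)] lc_clopen[OF U(1,2)]]] by blast
  then have fine: "finer f' f" "finer f' (\<lambda>s. s \<in> U)"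
    unfolding finer_pair by simp_all
  have pf': "proj f'"
    by (rule pregood_proj[OF f'(1)])
  define \<psi> where "\<psi> y = f (SOME s. s \<in> S \<and> f' s = y)" for y
  have \<psi>: "\<psi> (f' s) = f s" if "s \<in> S" for s
  proof -
    have "(SOME t. t \<in> S \<and> f' t = f' s) \<in> S \<and> f' (SOME t. t \<in> S \<and> f' t = f' s) = f' s"
      by (rule someI[of _ s]) (use that in simp)
    then show ?thesis
      using finerD[OF fine(1) _ that] by (simp add: \<psi>_def)
  qed
  have ep: "epimorphism F (chains (f' ` S)) f'" "epimorphism F (chains (f ` S)) f"
    using pf' pf(1) by (auto simp: proj_def)
  have \<psi>epi: "epimorphism (chains (f' ` S)) (chains (g ` S)) \<psi>"
    unfolding im[symmetric]
    by (rule epimorphism_factor[OF ep _ R_sub L_sub \<psi>]) simp_all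
  have Y: "column_set (f' ` S)"
    using pf' by (simp add: proj_def)
  have col: "{y \<in> f' ` S. fst y = fst (f' (u i))} = f' ` strand (u i)" if "i \<in> I" for i
    by (rule pregood_column[OF M(1) f'(1) that])
  obtain g' where g': "pregood I v g'" "collapse I v g'" "g' ` S = f' ` S"
      "\<And>s. s \<in> S \<Longrightarrow> g s = \<psi> (g' s)" "\<And>i. i \<in> I \<Longrightarrow> g' (v i) = f' (u i)"
  proof (rule good_lift[OF M(2) pf(2) cf(2) Y \<psi>epi, of "\<lambda>i. f' (u i)"])
    fix i assume i: "i \<in> I"
    show "f' (u i) \<in> f' ` S"
      using uS[OF i] by blast
    show "\<psi> (f' (u i)) = g (v i)"
      using \<psi>[OF uS[OF i]] uv(1)[OF i] by simp
    have "\<psi> ` f' ` strand (u i) = f ` strand (u i)"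
      unfolding image_image by (rule image_cong) (use \<psi> strand_sub in auto)
    then show "\<psi> ` {y \<in> f' ` S. fst y = fst (f' (u i))} = g ` strand (v i)"
      unfolding col[OF i] using uv(2)[OF i] by simp
    show "i = j" if "j \<in> I" "fst (f' (u i)) = fst (f' (u j))" for j
      by (rule pregood_inj[OF f'(1) i that])
    \<comment> \<open>Over a one-point component the strand is a single special class, which
      \<open>f'\<close> collapses to one value.\<close>
    show "{y \<in> f' ` S. fst y = fst (f' (u i))} = {f' (u i)}" if "i \<notin> K"
    proof -
      have str: "strand (u i) = p (u i)"
        using M(1) i that by (simp add: marked_def)
      have sp: "u i \<in> special I u"
        by (rule special_base[OF i _ uS[OF i]]) simp
      have "f' s = f' (u i)" if "s \<in> strand (u i)" for s
        using collapseD[OF f'(2) _ sp, of s] that unfolding str p_in_iff by simp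
      then have "f' ` strand (u i) = (\<lambda>_. f' (u i)) ` strand (u i)"
        by (rule image_cong[OF refl])
      then show ?thesis
        unfolding col[OF i] using strand_self[OF uS[OF i]] by (simp only: image_constant)
    qed
  qed blast
  have "match I u v f' g'"
    unfolding match_def
  proof (intro conjI ballI)
    fix i assume i: "i \<in> I"
    show "f' (u i) = g' (v i)"
      using g'(5)[OF i] by simp
    show "f' ` strand (u i) = g' ` strand (v i)"
      using col[OF i] pregood_column[OF M(2) g'(1) i] g'(3) g'(5)[OF i] by simp
  qed (use pf' pregood_proj[OF g'(1)] f'(2) g'(2,3) in simp_all)
  then show ?thesis
    using \<psi> g'(4) fine(2) by (intro exI[of _ f'] exI[of _ g'] exI[of _ \<psi>]) simp
qed

text \<open>Forth to decide \<open>U\<close>, then back to decide \<open>V\<close>; the second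
  refinement preserves the first decision.\<close>

lemma match_step:
  assumes M: "marked I K u" "marked I K v" and m: "match I u v f g"
    and U: "openin (Top F) U" "closedin (Top F) U" "collapse I u (\<lambda>s. s \<in> U)"
    and V: "openin (Top F) V" "closedin (Top F) V" "collapse I v (\<lambda>s. s \<in> V)"
  shows "\<exists>f' g' \<psi>. match I u v f' g' \<and> (\<forall>s\<in>S. f s = \<psi> (f' s) \<and> g s = \<psi> (g' s)) \<and>
    finer f' (\<lambda>s. s \<in> U) \<and> finer g' (\<lambda>s. s \<in> V)"
proof -
  obtain f1 g1 \<psi>1 where 1: "match I u v f1 g1" "\<forall>s\<in>S. f s = \<psi>1 (f1 s) \<and> g s = \<psi>1 (g1 s)"
      "finer f1 (\<lambda>s. s \<in> U)"
    using match_forth[OF M m U] by blast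
  obtain g2 f2 \<psi>2 where 2: "match I v u g2 f2" "\<forall>s\<in>S. g1 s = \<psi>2 (g2 s) \<and> f1 s = \<psi>2 (f2 s)"
      "finer g2 (\<lambda>s. s \<in> V)"
    using match_forth[OF M(2,1) match_sym[OF 1(1)] V] by blast
  have "finer f2 f1"
    unfolding finer_def using 2(2) by metis
  then have "finer f2 (\<lambda>s. s \<in> U)"
    using 1(3) finer_trans by blast
  then show ?thesis
    using match_sym[OF 2(1)] 1(2) 2(2,3)
    by (intro exI[of _ f2] exI[of _ g2] exI[of _ "\<lambda>x. \<psi>1 (\<psi>2 x)"]) simp
qed

section \<open>Enumerating clopen sets and building the towers\<close>

text \<open>Finite covers by small open sets, one cover for each \<open>n\<close>, form a countable
  base, and a clopen set is compact, hence a finite union of base members.\<close>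

lemma countable_clopens: "countable {U. openin (Top F) U \<and> closedin (Top F) U}"
proof -
  obtain M d where d: "Metric_space M d" and T: "Top F = Metric_space.mtopology M d"
    using metrizable_F unfolding metrizable_space_def by blast
  interpret Metric_space M d by (rule d)
  have SM: "S = M"
    by (simp add: T)
  have "\<exists>\<U>. finite \<U> \<and> S \<subseteq> \<Union>\<U> \<and> (\<forall>U\<in>\<U>. openin (Top F) U \<and> (\<exists>c. U \<subseteq> mball c (inverse (Suc n))))" for n
  proof -
    let ?W = "{U. openin (Top F) U \<and> (\<exists>c. U \<subseteq> mball c (inverse (Suc n)))}"
    have "S \<subseteq> \<Union>?W"
    proof
      fix s assume "s \<in> S"
      then have "s \<in> mball s (inverse (Suc n))"
        using SM by simp
      moreover have "openin (Top F) (mball s (inverse (Suc n)))"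
        by (simp add: T)
      ultimately show "s \<in> \<Union>?W" by blast
    qed
    then have "\<exists>\<F>. finite \<F> \<and> \<F> \<subseteq> ?W \<and> S \<subseteq> \<Union>\<F>"
      using compact_F[unfolded compact_space_alt, rule_format, of ?W] by blast
    then show ?thesis by blast
  qed
  then obtain \<U> where \<U>: "\<And>n. finite (\<U> n)" "\<And>n. S \<subseteq> \<Union>(\<U> n)"
      "\<And>n U. U \<in> \<U> n \<Longrightarrow> openin (Top F) U \<and> (\<exists>c. U \<subseteq> mball c (inverse (Suc n)))"
    by metis
  let ?B = "\<Union>n. \<U> n"
  have base: "\<exists>V\<in>?B. s \<in> V \<and> V \<subseteq> U" if U: "openin (Top F) U" and s: "s \<in> U" for U s
  proof -
    obtain r where r: "r > 0" "mball s r \<subseteq> U"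
      using U s unfolding T openin_mtopology by blast
    obtain n where n: "inverse (real (Suc n)) < r / 2"
      using reals_Archimedean[of "r / 2"] r(1) by auto
    have sS: "s \<in> S"
      using openin_subset[OF U] s by blast
    then obtain V where V: "V \<in> \<U> n" "s \<in> V"
      using \<U>(2)[of n] by blast
    then obtain c where c: "V \<subseteq> mball c (inverse (Suc n))"
      using \<U>(3) by blast
    have "w \<in> mball s r" if "w \<in> V" for w
    proof -
      have "s \<in> mball c (inverse (Suc n))" "w \<in> mball c (inverse (Suc n))"
        using c V(2) that by auto
      then have *: "c \<in> M" "s \<in> M" "w \<in> M" "d c s < inverse (Suc n)" "d c w < inverse (Suc n)"
        by auto
      then have "d s w \<le> d c s + d c w"
        using triangle'[of s c w] commute by (metis triangle'')
      then show ?thesis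
        using * n by simp
    qed
    then show ?thesis
      using V r(2) by blast
  qed
  have "{U. openin (Top F) U \<and> closedin (Top F) U} \<subseteq> Union ` {A. finite A \<and> A \<subseteq> ?B}"
  proof
    fix U assume "U \<in> {U. openin (Top F) U \<and> closedin (Top F) U}"
    then have U: "openin (Top F) U" "closedin (Top F) U" by auto
    let ?G = "{V \<in> ?B. V \<subseteq> U}"
    have "compactin (Top F) U"
      by (rule closedin_compact_space[OF compact_F U(2)])
    moreover have "openin (Top F) V" if "V \<in> ?G" for V
      using \<U>(3) that by blast
    moreover have "U \<subseteq> \<Union>?G"
    proof
      fix s assume "s \<in> U"
      then show "s \<in> \<Union>?G"
        using base[OF U(1)] by blast
    qed
    ultimately obtain A where "finite A" "A \<subseteq> ?G" "U \<subseteq> \<Union>A"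
      using compactinD[of "Top F" U ?G] by blast
    then have "U = \<Union>A" "finite A" "A \<subseteq> ?B" by blast+
    then show "U \<in> Union ` {A. finite A \<and> A \<subseteq> ?B}" by blast
  qed
  moreover have "countable ?B"
    using \<U>(1) by (simp add: countable_finite)
  ultimately show ?thesis
    by (rule countable_subset[OF _ countable_image[OF countable_Collect_finite_subset]])
qed

lemma match_const:
  assumes "marked I K u" "marked I K v"
  shows "match I u v (\<lambda>_. (0, 0)) (\<lambda>_. (0, 0))"
proof -
  have "lc (\<lambda>_. (0, 0) :: nat \<times> nat)"
    by (rule lc_const)
  then have "hom (\<lambda>_. (0, 0))"
    by (simp add: hom_def)
  moreover obtain s where "s \<in> S"
    using S_nonempty by blast
  ultimately have "proj (\<lambda>_. (0, 0))"
    using L_refl by (intro hom_imp_proj) auto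
  moreover have "strand (u i) \<noteq> {}" "strand (v i) \<noteq> {}" if "i \<in> I" for i
  proof -
    have "u i \<in> S" "v i \<in> S"
      using assms that by (simp_all add: marked_def)
    then show "strand (u i) \<noteq> {}" "strand (v i) \<noteq> {}"
      using strand_self by blast+
  qed
  ultimately show ?thesis
    unfolding match_def collapse_def by auto
qed

text \<open>The refinement made at stage \<open>n\<close> decides the \<open>n\<close>-th collapsed
  clopen set on either side.\<close>

lemma matching_sequence:
  assumes M: "marked I K u" "marked I K v"
  obtains f g where "\<And>n. match I u v (f n) (g n)"
    "\<And>n. \<exists>\<psi>. \<forall>s\<in>S. f n s = \<psi> (f (Suc n) s) \<and> g n s = \<psi> (g (Suc n) s)"
    "decides I u f" "decides I v g"
proof -
  define CU where "CU w = {U. (openin (Top F) U \<and> closedin (Top F) U) \<and> collapse I w (\<lambda>s. s \<in> U)}" for w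
  have "countable (CU w)" for w
    unfolding CU_def by (rule countable_subset[OF _ countable_clopens]) blast
  moreover have ne: "CU w \<noteq> {}" for w
  proof -
    have "{} \<in> CU w"
      by (simp add: CU_def collapse_def)
    then show ?thesis by blast
  qed
  ultimately have enum: "range (from_nat_into (CU w)) = CU w" for w
    by (rule range_from_nat_into[rotated])
  have mem: "from_nat_into (CU w) n \<in> CU w" for w n
    by (rule from_nat_into[OF ne])
  let ?P = "\<lambda>(n::nat) x. match I u v (fst x) (snd x)"
  let ?Q = "\<lambda>n x y. (\<exists>\<psi>. \<forall>s\<in>S. fst x s = \<psi> (fst y s) \<and> snd x s = \<psi> (snd y s)) \<and>
      finer (fst y) (\<lambda>s. s \<in> from_nat_into (CU u) n) \<and> finer (snd y) (\<lambda>s. s \<in> from_nat_into (CU v) n)"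
  have "\<exists>h. \<forall>n. ?P n (h n) \<and> ?Q n (h n) (h (Suc n))"
  proof (rule dependent_nat_choice)
    show "\<exists>x. ?P 0 x"
      using match_const[OF M] by (intro exI[of _ "(\<lambda>_. (0, 0), \<lambda>_. (0, 0))"]) simp
    fix x n assume x: "?P n x"
    have U: "openin (Top F) (from_nat_into (CU w) n)" "closedin (Top F) (from_nat_into (CU w) n)"
        "collapse I w (\<lambda>s. s \<in> from_nat_into (CU w) n)" for w
      using mem[of w n] unfolding CU_def by blast+
    obtain f' g' \<psi> where "match I u v f' g'" "\<forall>s\<in>S. fst x s = \<psi> (f' s) \<and> snd x s = \<psi> (g' s)"
        "finer f' (\<lambda>s. s \<in> from_nat_into (CU u) n)" "finer g' (\<lambda>s. s \<in> from_nat_into (CU v) n)"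
      using match_step[OF M x U U] by blast
    then show "\<exists>y. ?P (Suc n) y \<and> ?Q n x y"
      by (intro exI[of _ "(f', g')"]) auto
  qed
  then obtain h where h: "\<And>n. ?P n (h n)" "\<And>n. ?Q n (h n) (h (Suc n))"
    by blast
  show thesis
  proof (rule that[of "\<lambda>n. fst (h n)" "\<lambda>n. snd (h n)"])
    show "match I u v (fst (h n)) (snd (h n))" for n
      by (rule h(1))
    show "\<exists>\<psi>. \<forall>s\<in>S. fst (h n) s = \<psi> (fst (h (Suc n)) s) \<and> snd (h n) s = \<psi> (snd (h (Suc n)) s)" for n
      using h(2)[of n] by blast
    have dec: "decides I w (\<lambda>n. g n)"
      if "\<And>n. finer (g (Suc n)) (\<lambda>s. s \<in> from_nat_into (CU w) n)" for w and g :: "nat \<Rightarrow> 'a \<Rightarrow> nat \<times> nat"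
      unfolding decides_def
    proof (intro allI impI)
      fix U assume "openin (Top F) U \<and> closedin (Top F) U \<and> collapse I w (\<lambda>s. s \<in> U)"
      then have "U \<in> range (from_nat_into (CU w))"
        unfolding enum by (simp add: CU_def)
      then obtain n where "U = from_nat_into (CU w) n" by blast
      then show "\<exists>n. finer (g n) (\<lambda>s. s \<in> U)" using that[of n] by blast
    qed
    show "decides I u (\<lambda>n. fst (h n))" "decides I v (\<lambda>n. snd (h n))"
      by (rule dec, use h(2) in blast)+
  qed
qed

section \<open>From matching towers to a homeomorphism of the fence\<close>

text \<open>Take a map injective on the finite set formed by the class of \<open>s\<close>, the
  point \<open>x\<close> and all special points, and let \<open>U\<close> be the preimage of its
  values on that class. On special points \<open>U\<close> agrees with the class of
  \<open>s\<close>, so it splits no special class.\<close>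

lemma class_separate:
  assumes M: "marked I K u" and st: "s \<in> S" "x \<in> S" "(s, x) \<notin> Rrel F"
  obtains U where "openin (Top F) U" "closedin (Top F) U" "collapse I u (\<lambda>s. s \<in> U)" "s \<in> U" "x \<notin> U"
proof -
  let ?A = "p s \<union> insert x (special I u)"
  have pS: "p s \<subseteq> S" "x \<notin> p s" "s \<in> p s"
    using R_in R_refl[OF st(1)] st(3) by (auto simp: p_in_iff)
  have spS: "special I u \<subseteq> S"
    using R_sub unfolding special_def by blast
  have "finite (p s)"
    using finite_class[of s] by (simp add: class_map_def)
  then have A: "finite ?A" "?A \<subseteq> S"
    using finite_special[OF M] pS st(2) spS by auto
  have "lc (\<lambda>_. ())"
    by (rule lc_const)
  from A this obtain f where f: "proj f" "inj_on f ?A"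
    by (rule separate_finite)
  let ?U = "{w \<in> S. f w \<in> f ` p s}"
  have U: "w \<in> ?U \<longleftrightarrow> w \<in> p s" if "w \<in> ?A" for w
  proof -
    have "w \<in> S" using that A(2) by blast
    moreover have "f w \<in> f ` p s \<longleftrightarrow> w \<in> p s"
      by (rule inj_on_image_mem_iff[OF f(2) that]) blast
    ultimately show ?thesis by simp
  qed
  have "collapse I u (\<lambda>w. w \<in> ?U)"
  proof (rule collapseI)
    fix a b assume ab: "(a, b) \<in> Rrel F" "a \<in> special I u"
    then have "b \<in> special I u"
      using special_R by blast
    then have "a \<in> ?A" "b \<in> ?A"
      using ab(2) by auto
    moreover have "a \<in> p s \<longleftrightarrow> b \<in> p s"
      using R_trans R_sym ab(1) p_in_iff by blast
    ultimately show "(a \<in> ?U) = (b \<in> ?U)"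
      using U by blast
  qed
  moreover have "s \<in> ?U" "x \<notin> ?U"
    using U[of s] U[of x] pS by auto
  moreover have "openin (Top F) ?U" "closedin (Top F) ?U"
    using lc_openin[OF proj_lc[OF f(1)]] lc_closedin[OF proj_lc[OF f(1)]] by auto
  ultimately show thesis
    using that by blast
qed

text \<open>Compactness turns the approximating pairs into one pair of \<open>Q\<close> that no map
  of the tower distinguishes from \<open>(s, t)\<close>. By \<open>class_separate\<close> the tower
  separates distinct classes, so this pair is equivalent to \<open>(s, t)\<close>.\<close>

lemma recover_relation:
  assumes M: "marked I K u"
    and fn: "\<And>n. proj (f n)" "\<And>n. finer (f (Suc n)) (f n)"
    and dec: "decides I u f"
    and Q: "closedin (prod_topology (Top F) (Top F)) Q" and st: "s \<in> S" "t \<in> S"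
    and ex: "\<And>n. \<exists>x y. (x, y) \<in> Q \<and> f n x = f n s \<and> f n y = f n t"
  obtains x y where "(x, y) \<in> Q" "(s, x) \<in> Rrel F" "(t, y) \<in> Rrel F"
proof -
  have QS: "Q \<subseteq> S \<times> S"
    using closedin_subset[OF Q] by simp
  define D where "D n = Q \<inter> ({x \<in> S. f n x = f n s} \<times> {y \<in> S. f n y = f n t})" for n
  have "(\<Inter>n. D n) \<noteq> {}"
  proof (rule compact_space_imp_nest[of "prod_topology (Top F) (Top F)"])
    show "compact_space (prod_topology (Top F) (Top F))"
      using compact_F by (simp add: compact_space_prod_topology)
    show "closedin (prod_topology (Top F) (Top F)) (D n)" for n
    proof -
      have "closedin (Top F) {x \<in> S. f n x = f n w}" for w
        using lc_closedin[OF proj_lc[OF fn(1)], of "\<lambda>a. a = f n w"] .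
      then show ?thesis
        unfolding D_def by (intro closedin_Int Q) (simp add: closedin_prod_Times_iff)
    qed
    show "D n \<noteq> {}" for n
      using ex[of n] QS unfolding D_def by blast
    show "decseq D"
      unfolding decseq_Suc_iff D_def using finerD[OF fn(2) _ st(1)] finerD[OF fn(2) _ st(2)] by blast
  qed
  then obtain z where "z \<in> (\<Inter>n. D n)" by blast
  then obtain x y where xy: "\<And>n. (x, y) \<in> D n"
    by (cases z) blast
  have key: "(s', x') \<in> Rrel F" if k: "s' \<in> S" "x' \<in> S" "\<And>n. f n x' = f n s'" for s' x'
  proof (rule ccontr)
    assume "(s', x') \<notin> Rrel F"
    then obtain U where U: "openin (Top F) U" "closedin (Top F) U" "collapse I u (\<lambda>s. s \<in> U)" "s' \<in> U" "x' \<notin> U"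
      using class_separate[OF M k(1,2)] by blast
    then obtain n where "finer (f n) (\<lambda>s. s \<in> U)"
      using dec unfolding decides_def by blast
    then show False
      using finerD[of "f n" "\<lambda>s. s \<in> U" x' s'] k U(4,5) by simp
  qed
  show thesis
  proof (rule that)
    show "(x, y) \<in> Q"
      using xy[of 0] by (simp add: D_def)
    show "(s, x) \<in> Rrel F" "(t, y) \<in> Rrel F"
      using key[OF st(1), of x] key[OF st(2), of y] xy by (auto simp: D_def)
  qed
qed

text \<open>\<open>T\<close> relates a point to possibly several points, but all in one class. For
  continuity, the preimage of a closed set is the projection of a closed subset of \<open>T\<close>
  along a compact factor.\<close>

lemma induced_map:
  assumes T: "closedin (prod_topology (Top F) (Top F)) T" and tot: "\<And>s. s \<in> S \<Longrightarrow> \<exists>t. (s, t) \<in> T"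
    and R: "\<And>s t s' t'. (s, t) \<in> T \<Longrightarrow> (s', t') \<in> T \<Longrightarrow> (s, s') \<in> Rrel F \<Longrightarrow> (t, t') \<in> Rrel F"
  shows "\<exists>h. continuous_map (fence_space F) (fence_space F) h \<and> (\<forall>s t. (s, t) \<in> T \<longrightarrow> h (p s) = p t)"
proof -
  have TS: "T \<subseteq> S \<times> S"
    using closedin_subset[OF T] by simp
  define h where "h c = p (SOME t. \<exists>s. p s = c \<and> (s, t) \<in> T)" for c
  have h: "h (p s) = p t" if st: "(s, t) \<in> T" for s t
  proof -
    let ?t = "SOME t. \<exists>s'. p s' = p s \<and> (s', t) \<in> T"
    have "\<exists>s'. p s' = p s \<and> (s', ?t) \<in> T"
      by (rule someI[of _ t]) (use st in blast)
    then obtain s' where s': "p s' = p s" "(s', ?t) \<in> T" by blast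
    have S: "s \<in> S" "s' \<in> S" "t \<in> S" "?t \<in> S"
      using TS st s'(2) by auto
    then have "(s', s) \<in> Rrel F"
      using s'(1) p_eq_iff by blast
    then have "(?t, t) \<in> Rrel F"
      by (rule R[OF s'(2) st])
    then show ?thesis
      unfolding h_def using p_eq_iff S(3,4) by blast
  qed
  have hp: "continuous_map (Top F) (fence_space F) (\<lambda>s. h (p s))"
    unfolding continuous_map_closedin
  proof (intro conjI ballI allI impI)
    show "(\<lambda>s. h (p s)) \<in> S \<rightarrow> topspace (fence_space F)"
    proof
      fix s assume "s \<in> S"
      then obtain t where "(s, t) \<in> T" using tot by blast
      then show "h (p s) \<in> topspace (fence_space F)"
        using h TS topspace_fence by auto
    qed
    fix C assume C: "closedin (fence_space F) C"
    have "{s \<in> S. h (p s) \<in> C} = fst ` (T \<inter> (S \<times> {t \<in> S. p t \<in> C}))"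
    proof
      show "{s \<in> S. h (p s) \<in> C} \<subseteq> fst ` (T \<inter> (S \<times> {t \<in> S. p t \<in> C}))"
      proof
        fix s assume s: "s \<in> {s \<in> S. h (p s) \<in> C}"
        then obtain t where t: "(s, t) \<in> T" using tot by blast
        then have "(s, t) \<in> T \<inter> (S \<times> {t \<in> S. p t \<in> C})"
          using s h[OF t] TS by auto
        then show "s \<in> fst ` (T \<inter> (S \<times> {t \<in> S. p t \<in> C}))"
          by force
      qed
      show "fst ` (T \<inter> (S \<times> {t \<in> S. p t \<in> C})) \<subseteq> {s \<in> S. h (p s) \<in> C}"
        using h by auto
    qed
    moreover have "closedin (Top F) (fst ` (T \<inter> (S \<times> {t \<in> S. p t \<in> C})))"
    proof -
      have "closedin (prod_topology (Top F) (Top F)) (T \<inter> (S \<times> {t \<in> S. p t \<in> C}))"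
        using closedin_continuous_map_preimage[OF continuous_p C]
        by (intro closedin_Int T) (simp add: closedin_prod_Times_iff)
      then show ?thesis
        using closed_map_fst[OF compact_F, of "Top F"] unfolding closed_map_def by blast
    qed
    ultimately show "closedin (Top F) {s \<in> S. h (p s) \<in> C}"
      by simp
  qed
  have "continuous_map (fence_space F) (fence_space F) h"
    using continuous_compose_quotient_map[OF quotient_p, of "fence_space F" h] hp by (simp add: comp_def)
  then show ?thesis
    using h by blast
qed

text \<open>Equal threads carry the relation to every finite quotient on the other side, and
  \<open>recover_relation\<close> returns to the limit. The pair found there consists only of
  representatives of the right classes, so the order transfers to the fence.\<close>

lemma thread_transfer:
  assumes M: "marked I K v" and pr: "\<And>n. proj (f n)" "\<And>n. proj (g n)" and fin: "\<And>n. finer (g (Suc n)) (g n)"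
    and dec: "decides I v g"
    and S: "t \<in> S" "t' \<in> S" and eq: "\<And>n. f n s = g n t" "\<And>n. f n s' = g n t'"
  shows "(s, s') \<in> Rrel F \<Longrightarrow> (t, t') \<in> Rrel F" and "(s, s') \<in> Leq F \<Longrightarrow> (p t, p t') \<in> fence_le F"
proof -
  show "(t, t') \<in> Rrel F" if r: "(s, s') \<in> Rrel F"
  proof -
    have ex: "\<exists>x y. (x, y) \<in> Rrel F \<and> g n x = g n t \<and> g n y = g n t'" for n
    proof -
      have "cadj (g n t) (g n t')"
        using hom_R[OF proj_hom[OF pr(1)] r, of n] eq by simp
      then show ?thesis
        using proj_R_onto[OF pr(2) S] by metis
    qed
    obtain x y where "(x, y) \<in> Rrel F" "(t, x) \<in> Rrel F" "(t', y) \<in> Rrel F"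
      using recover_relation[OF M pr(2) fin dec closed_R S ex] by blast
    then show ?thesis
      using R_trans R_sym by blast
  qed
  show "(p t, p t') \<in> fence_le F" if r: "(s, s') \<in> Leq F"
  proof -
    have ex: "\<exists>x y. (x, y) \<in> Leq F \<and> g n x = g n t \<and> g n y = g n t'" for n
    proof -
      have "cle (g n t) (g n t')"
        using hom_L[OF proj_hom[OF pr(1)] r, of n] eq by simp
      then show ?thesis
        using proj_L_onto[OF pr(2) S] by metis
    qed
    obtain x y where xy: "(x, y) \<in> Leq F" "(t, x) \<in> Rrel F" "(t', y) \<in> Rrel F"
      using recover_relation[OF M pr(2) fin dec closed_L S ex] by blast
    then have "p t = p x" "p t' = p y"
      using p_eq_iff R_in by blast+
    then show ?thesis
      unfolding fence_le_def using xy(1) by (metis map_prod_imageI)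
  qed
qed

text \<open>The relation \<open>T\<close> of equal threads is closed and, by compactness, total on
  both sides. Transfer in both directions makes the maps induced by \<open>T\<close> and its
  converse mutually inverse and order preserving.\<close>

lemma fence_homogeneous:
  assumes M: "marked I K u" "marked I K v"
  obtains h where "homeomorphic_map (fence_space F) (fence_space F) h"
    "map_prod h h ` fence_le F = fence_le F" "\<And>i. i \<in> I \<Longrightarrow> h (p (u i)) = p (v i)"
proof -
  obtain f g where m: "\<And>n. match I u v (f n) (g n)"
    and bond: "\<And>n. \<exists>\<psi>. \<forall>s\<in>S. f n s = \<psi> (f (Suc n) s) \<and> g n s = \<psi> (g (Suc n) s)"
    and du: "decides I u f" and dv: "decides I v g"
    using matching_sequence[OF M] by blast
  have pr: "proj (f n)" "proj (g n)" and im: "f n ` S = g n ` S" for n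
    using m[of n] by (auto simp: match_def)
  have fin: "finer (f (Suc n)) (f n)" "finer (g (Suc n)) (g n)" for n
    using bond[of n] unfolding finer_def by metis+
  have down: "f n s = g n t" if "f (Suc n) s = g (Suc n) t" "s \<in> S" "t \<in> S" for n s t
    using bond[of n] that by metis
  define T where "T = {(s, t) \<in> S \<times> S. \<forall>n. f n s = g n t}"
  have TS: "s \<in> S" "t \<in> S" and Teq: "f n s = g n t" if "(s, t) \<in> T" for s t n
    using that by (auto simp: T_def)
  have graph: "closedin (prod_topology (Top F) (Top F)) {(s, t) \<in> S \<times> S. \<forall>n. a n s = (b n t :: nat \<times> nat)}"
    if "\<And>n. proj (a n)" "\<And>n. proj (b n)" for a b
  proof -
    have "closedin (prod_topology (Top F) (Top F)) {(s, t) \<in> S \<times> S. a n s = b n t}" for n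
    proof -
      have "{(s, t) \<in> S \<times> S. a n s = b n t} =
          \<Union>((\<lambda>y. {s \<in> S. a n s = y} \<times> {t \<in> S. b n t = y}) ` a n ` S)"
        by auto
      moreover have "closedin (prod_topology (Top F) (Top F))
          (\<Union>((\<lambda>y. {s \<in> S. a n s = y} \<times> {t \<in> S. b n t = y}) ` a n ` S))"
      proof (rule closedin_Union)
        show "finite ((\<lambda>y. {s \<in> S. a n s = y} \<times> {t \<in> S. b n t = y}) ` a n ` S)"
          using lc_finite_image[OF proj_lc[OF that(1)]] by blast
        fix C assume "C \<in> (\<lambda>y. {s \<in> S. a n s = y} \<times> {t \<in> S. b n t = y}) ` a n ` S"
        then obtain y where "C = {s \<in> S. a n s = y} \<times> {t \<in> S. b n t = y}" by blast
        moreover have "closedin (Top F) {s \<in> S. a n s = y}" "closedin (Top F) {t \<in> S. b n t = y}"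
          using lc_closedin[OF proj_lc[OF that(1)], of "\<lambda>x. x = y"]
            lc_closedin[OF proj_lc[OF that(2)], of "\<lambda>x. x = y"] by auto
        ultimately show "closedin (prod_topology (Top F) (Top F)) C"
          by (simp add: closedin_prod_Times_iff)
      qed
      ultimately show ?thesis by simp
    qed
    then have "closedin (prod_topology (Top F) (Top F)) (\<Inter>(range (\<lambda>n. {(s, t) \<in> S \<times> S. a n s = b n t})))"
      by (intro closedin_Inter) auto
    moreover have "\<Inter>(range (\<lambda>n. {(s, t) \<in> S \<times> S. a n s = b n t})) = {(s, t) \<in> S \<times> S. \<forall>n. a n s = b n t}"
      by auto
    ultimately show ?thesis by simp
  qed
  have clT: "closedin (prod_topology (Top F) (Top F)) T"
    unfolding T_def by (rule graph[OF pr])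
  have Tinv: "T\<inverse> = {(s, t) \<in> S \<times> S. \<forall>n. g n s = f n t}"
    by (auto simp: T_def)
  have clT': "closedin (prod_topology (Top F) (Top F)) (T\<inverse>)"
    unfolding Tinv by (rule graph[OF pr(2,1)])
  \<comment> \<open>A thread is realised by a point because its fibres are non-empty, closed and
    nested.\<close>
  have nest: "\<exists>t\<in>S. \<forall>n. b n t = a n s"
    if "\<And>n. proj (b n)" "\<And>n. a n s \<in> b n ` S" "\<And>n t. t \<in> S \<Longrightarrow> b (Suc n) t = a (Suc n) s \<Longrightarrow> b n t = a n s"
    for a b :: "nat \<Rightarrow> 'a \<Rightarrow> nat \<times> nat" and s
  proof -
    have "(\<Inter>n. {t \<in> S. b n t = a n s}) \<noteq> {}"
    proof (rule compact_space_imp_nest[OF compact_F])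
      show "closedin (Top F) {t \<in> S. b n t = a n s}" for n
        using lc_closedin[OF proj_lc[OF that(1)], of "\<lambda>x. x = a n s"] .
      show "{t \<in> S. b n t = a n s} \<noteq> {}" for n
        using that(2)[of n] by auto
      show "decseq (\<lambda>n. {t \<in> S. b n t = a n s})"
        unfolding decseq_Suc_iff using that(3) by blast
    qed
    then show ?thesis by auto
  qed
  have tot: "\<exists>t. (s, t) \<in> T" if s: "s \<in> S" for s
  proof -
    have "\<exists>t\<in>S. \<forall>n. g n t = f n s"
    proof (rule nest[OF pr(2)])
      show "f n s \<in> g n ` S" for n
        using im[of n] s by blast
      show "g n t = f n s" if "t \<in> S" "g (Suc n) t = f (Suc n) s" for n t
        using down[of n s t] that s by simp
    qed
    then show ?thesis
      using s by (auto simp: T_def)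
  qed
  have tot': "\<exists>s. (s, t) \<in> T" if t: "t \<in> S" for t
  proof -
    have "\<exists>s\<in>S. \<forall>n. f n s = g n t"
    proof (rule nest[OF pr(1)])
      show "g n t \<in> f n ` S" for n
        using im[of n] t by blast
      show "f n s = g n t" if "s \<in> S" "f (Suc n) s = g (Suc n) t" for n s
        using down[of n s t] that t by simp
    qed
    then show ?thesis
      using t by (auto simp: T_def)
  qed
  note fwd = thread_transfer[where f = f, OF M(2) pr fin(2) dv] and bwd = thread_transfer[where f = g, OF M(1) pr(2,1) fin(1) du]
  have RT: "(t, t') \<in> Rrel F" if T2: "(s, t) \<in> T" "(s', t') \<in> T" and r: "(s, s') \<in> Rrel F" for s t s' t'
    by (rule fwd(1)[OF TS(2)[OF T2(1)] TS(2)[OF T2(2)] Teq[OF T2(1)] Teq[OF T2(2)] r])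
  have RT': "(s, s') \<in> Rrel F" if T2: "(s, t) \<in> T" "(s', t') \<in> T" and r: "(t, t') \<in> Rrel F" for s t s' t'
    by (rule bwd(1)[OF TS(1)[OF T2(1)] TS(1)[OF T2(2)] Teq[OF T2(1), symmetric] Teq[OF T2(2), symmetric] r])
  have LT: "(p t, p t') \<in> fence_le F" if T2: "(s, t) \<in> T" "(s', t') \<in> T" and r: "(s, s') \<in> Leq F" for s t s' t'
    by (rule fwd(2)[OF TS(2)[OF T2(1)] TS(2)[OF T2(2)] Teq[OF T2(1)] Teq[OF T2(2)] r])
  have LT': "(p s, p s') \<in> fence_le F" if T2: "(s, t) \<in> T" "(s', t') \<in> T" and r: "(t, t') \<in> Leq F" for s t s' t'
    by (rule bwd(2)[OF TS(1)[OF T2(1)] TS(1)[OF T2(2)] Teq[OF T2(1), symmetric] Teq[OF T2(2), symmetric] r])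
  have "\<exists>h. continuous_map (fence_space F) (fence_space F) h \<and> (\<forall>s t. (s, t) \<in> T \<longrightarrow> h (p s) = p t)"
  proof (rule induced_map[OF clT])
    show "\<exists>t. (s, t) \<in> T" if "s \<in> S" for s
      by (rule tot[OF that])
    show "(t, t') \<in> Rrel F" if "(s, t) \<in> T" "(s', t') \<in> T" "(s, s') \<in> Rrel F" for s t s' t'
      by (rule RT[OF that])
  qed
  then obtain h where h: "continuous_map (fence_space F) (fence_space F) h" "\<And>s t. (s, t) \<in> T \<Longrightarrow> h (p s) = p t"
    by blast
  have "\<exists>k. continuous_map (fence_space F) (fence_space F) k \<and> (\<forall>s t. (s, t) \<in> T\<inverse> \<longrightarrow> k (p s) = p t)"
  proof (rule induced_map[OF clT'])
    show "\<exists>t. (s, t) \<in> T\<inverse>" if "s \<in> S" for s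
      using tot'[OF that] by simp
    show "(t, t') \<in> Rrel F" if "(s, t) \<in> T\<inverse>" "(s', t') \<in> T\<inverse>" "(s, s') \<in> Rrel F" for s t s' t'
      by (rule RT'[of t s t' s']) (use that in simp_all)
  qed
  then obtain k where k: "continuous_map (fence_space F) (fence_space F) k" "\<And>s t. (s, t) \<in> T\<inverse> \<Longrightarrow> k (p s) = p t"
    by blast
  have "homeomorphic_maps (fence_space F) (fence_space F) h k"
    unfolding homeomorphic_maps_def
  proof (intro conjI h(1) k(1) ballI)
    fix c assume "c \<in> topspace (fence_space F)"
    then obtain s where s: "s \<in> S" "c = p s"
      using topspace_fence by blast
    obtain t where t: "(s, t) \<in> T" using tot[OF s(1)] by blast
    then show "k (h c) = c"
      using h(2)[OF t] k(2)[of t s] s(2) by simp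
    obtain w where w: "(w, s) \<in> T" using tot'[OF s(1)] by blast
    then show "h (k c) = c"
      using h(2)[OF w] k(2)[of s w] s(2) by simp
  qed
  then have "homeomorphic_map (fence_space F) (fence_space F) h"
    using homeomorphic_map_maps by blast
  moreover have "map_prod h h ` fence_le F = fence_le F"
  proof
    show "map_prod h h ` fence_le F \<subseteq> fence_le F"
    proof
      fix z assume "z \<in> map_prod h h ` fence_le F"
      then obtain s s' where s: "(s, s') \<in> Leq F" "z = (h (p s), h (p s'))"
        unfolding fence_le_def by auto
      obtain t t' where t: "(s, t) \<in> T" "(s', t') \<in> T"
        using tot L_in[OF s(1)] by blast
      show "z \<in> fence_le F"
        unfolding s(2) h(2)[OF t(1)] h(2)[OF t(2)] by (rule LT[OF t s(1)])
    qed
    show "fence_le F \<subseteq> map_prod h h ` fence_le F"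
    proof
      fix z assume "z \<in> fence_le F"
      then obtain t t' where t: "(t, t') \<in> Leq F" "z = (p t, p t')"
        unfolding fence_le_def by auto
      obtain s s' where s: "(s, t) \<in> T" "(s', t') \<in> T"
        using tot' L_in[OF t(1)] by blast
      have "map_prod h h (p s, p s') = z"
        using h(2)[OF s(1)] h(2)[OF s(2)] t(2) by simp
      moreover have "(p s, p s') \<in> fence_le F"
        by (rule LT'[OF s t(1)])
      ultimately show "z \<in> map_prod h h ` fence_le F"
        by (metis imageI)
    qed
  qed
  moreover have "h (p (u i)) = p (v i)" if i: "i \<in> I" for i
  proof -
    have "(u i, v i) \<in> T"
      using M m i by (auto simp: T_def marked_def match_def)
    then show ?thesis
      by (rule h(2))
  qed
  ultimately show thesis
    using that by blast
qed

section \<open>Translating components into marked strands\<close>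

text \<open>Any representative of the prescribed point can be the mark, and any point over a
  singleton component: distinct components give distinct strands, and
  \<open>ends_not_interior\<close> supplies the clause for arcs.\<close>

lemma components_marked:
  fixes J :: "nat \<Rightarrow> 'a set set" and x :: "nat \<Rightarrow> 'a set"
  assumes J: "\<And>i. i \<in> {1..l} \<Longrightarrow> J i \<in> connected_components_of (fence_space F)"
    and inj: "inj_on J {1..l}" and kl: "k \<le> l"
    and arc: "\<And>i. i \<in> {1..k} \<Longrightarrow> is_arc (fence_space F) (J i)"
    and single: "\<And>i. i \<in> {k+1..l} \<Longrightarrow> is_singleton (J i)"
    and x: "\<And>i. i \<in> {1..k} \<Longrightarrow> x i \<in> J i \<and> \<not> arc_endpoint (fence_space F) (J i) (x i)"
  obtains u where "marked {1..l} {1..k} u" "\<And>i. i \<in> {1..l} \<Longrightarrow> u i \<in> S"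
    "\<And>i. i \<in> {1..l} \<Longrightarrow> p (u i) \<in> J i" "\<And>i. i \<in> {1..k} \<Longrightarrow> p (u i) = x i"
proof -
  have "\<exists>s\<in>S. p s \<in> J i \<and> (i \<in> {1..k} \<longrightarrow> p s = x i)" if i: "i \<in> {1..l}" for i
  proof -
    have sub: "J i \<subseteq> p ` S"
      using connected_components_of_subset[OF J[OF i]] topspace_fence by simp
    show ?thesis
    proof (cases "i \<in> {1..k}")
      case True
      then have "x i \<in> J i" using x by blast
      then obtain s where "s \<in> S" "x i = p s" using sub by blast
      then show ?thesis using \<open>x i \<in> J i\<close> by (intro bexI[of _ s]) auto
    next
      case False
      then have "is_singleton (J i)" using single[of i] i by simp
      then obtain y where "y \<in> J i" by (auto simp: is_singleton_def)
      then obtain s where "s \<in> S" "y = p s" using sub by blast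
      then show ?thesis using \<open>y \<in> J i\<close> False by (intro bexI[of _ s]) auto
    qed
  qed
  then obtain u where u: "\<And>i. i \<in> {1..l} \<Longrightarrow> u i \<in> S \<and> p (u i) \<in> J i \<and> (i \<in> {1..k} \<longrightarrow> p (u i) = x i)"
    by metis
  have Jeq: "J i = p ` strand (u i)" if "i \<in> {1..l}" for i
    using component_eq_strand[OF J[OF that]] u[OF that] by blast
  have kI: "i \<in> {1..l}" if "i \<in> {1..k}" for i
    using that kl by simp
  have "marked {1..l} {1..k} u"
    unfolding marked_def
  proof (intro conjI ballI impI)
    show "{1..k} \<subseteq> {1..l}"
      using kl by simp
    show "u i \<in> S" if "i \<in> {1..l}" for i
      using u[OF that] by blast
    show "u j \<notin> strand (u i)" if "i \<in> {1..l}" "j \<in> {1..l}" "i \<noteq> j" for i j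
    proof
      assume "u j \<in> strand (u i)"
      then have "J j = J i"
        using Jeq that strand_eq by simp
      then show False
        using inj that by (simp add: inj_on_eq_iff)
    qed
    show "(u i, m) \<notin> Rrel F" if i: "i \<in> {1..k}" and m: "m \<in> ends (u i)" for i m
    proof (rule ends_not_interior[OF _ _ _ m])
      show "is_arc (fence_space F) (p ` strand (u i))"
        using arc[OF i] Jeq[OF kI[OF i]] by simp
      show "u i \<in> S"
        using u[OF kI[OF i]] by blast
      show "\<not> arc_endpoint (fence_space F) (p ` strand (u i)) (p (u i))"
        using x[OF i] u[OF kI[OF i]] i Jeq[OF kI[OF i]] by simp
    qed
    show "strand (u i) = p (u i)" if "i \<in> {1..l} - {1..k}" for i
    proof (rule singleton_strand)
      show "is_singleton (p ` strand (u i))"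
        using single[of i] Jeq[of i] that by auto
      show "u i \<in> S"
        using u that by blast
    qed
  qed simp
  then show thesis
    using that u kI by blast
qed

end

theorem theorem5p6:
  fixes F :: "'a LR_structure"
    and J I :: "nat \<Rightarrow> 'a set set"
    and x y :: "nat \<Rightarrow> 'a set"
    and k l :: nat
  assumes "projective_fraisse_limit F"
    and "\<And>i. i \<in> {1..l} \<Longrightarrow> J i \<in> connected_components_of (fence_space F)"
    and "\<And>i. i \<in> {1..l} \<Longrightarrow> I i \<in> connected_components_of (fence_space F)"
    and "inj_on J {1..l}"
    and "inj_on I {1..l}"
    and "k \<le> l"
    and "\<And>i. i \<in> {1..k} \<Longrightarrow> is_arc (fence_space F) (J i) \<and> is_arc (fence_space F) (I i)"
    and "\<And>i. i \<in> {k+1..l} \<Longrightarrow> is_singleton (J i) \<and> is_singleton (I i)"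
    and "\<And>i. i \<in> {1..k} \<Longrightarrow> x i \<in> J i \<and> \<not> arc_endpoint (fence_space F) (J i) (x i)"
    and "\<And>i. i \<in> {1..k} \<Longrightarrow> y i \<in> I i \<and> \<not> arc_endpoint (fence_space F) (I i) (y i)"
  shows "\<exists>h. homeomorphic_map (fence_space F) (fence_space F) h \<and>
           map_prod h h ` fence_le F = fence_le F \<and>
           (\<forall>i\<in>{1..l}. h ` J i = I i) \<and>
           (\<forall>i\<in>{1..k}. h (x i) = y i)"
proof -
  interpret fraisse_limit F
    by unfold_locales (rule assms(1))
  have arcs: "is_arc (fence_space F) (J i)" "is_arc (fence_space F) (I i)" if "i \<in> {1..k}" for i
    using assms(7)[OF that] by auto
  have singles: "is_singleton (J i)" "is_singleton (I i)" if "i \<in> {k+1..l}" for i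
    using assms(8)[OF that] by auto
  obtain u where u: "marked {1..l} {1..k} u" "\<And>i. i \<in> {1..l} \<Longrightarrow> u i \<in> S"
    "\<And>i. i \<in> {1..l} \<Longrightarrow> p (u i) \<in> J i" "\<And>i. i \<in> {1..k} \<Longrightarrow> p (u i) = x i"
    using components_marked[OF assms(2,4,6) arcs(1) singles(1) assms(9)] by metis
  obtain v where v: "marked {1..l} {1..k} v" "\<And>i. i \<in> {1..l} \<Longrightarrow> v i \<in> S"
    "\<And>i. i \<in> {1..l} \<Longrightarrow> p (v i) \<in> I i" "\<And>i. i \<in> {1..k} \<Longrightarrow> p (v i) = y i"
    using components_marked[OF assms(3,5,6) arcs(2) singles(2) assms(10)] by metis
  obtain h where h: "homeomorphic_map (fence_space F) (fence_space F) h"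
    "map_prod h h ` fence_le F = fence_le F" "\<And>i. i \<in> {1..l} \<Longrightarrow> h (p (u i)) = p (v i)"
    using fence_homogeneous[OF u(1) v(1)] by blast
  have "h ` J i = I i" if i: "i \<in> {1..l}" for i
  proof -
    \<comment> \<open>A homeomorphism permutes the components, and a component is known from any one
      of its points, here \<open>p (v i)\<close>.\<close>
    have "h ` J i \<in> connected_components_of (fence_space F)"
      using homeomorphic_map_connected_components_of[OF h(1)] assms(2)[OF i] by blast
    moreover have "p (v i) \<in> h ` J i"
      using h(3)[OF i] u(3)[OF i] by (metis imageI)
    ultimately have "h ` J i = p ` strand (v i)"
      by (rule component_eq_strand[OF _ v(2)[OF i]])
    then show ?thesis
      using component_eq_strand[OF assms(3)[OF i] v(2)[OF i] v(3)[OF i]] by simp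
  qed
  moreover have "h (x i) = y i" if "i \<in> {1..k}" for i
    using h(3)[of i] u(4)[OF that] v(4)[OF that] that assms(6) by simp
  ultimately show ?thesis
    using h(1,2) by blast
qed

end
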